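(* Let $R\in\mathcal{E}^d(\Omega)$. Then $R\in\mathcal{E}^d_M(\Omega)$ if and only if the following holds: for every compact $K\subset\Omega$, every $\alpha\in\mathbb{N}_0^s$ and every $k\in\mathbb{N}_0$ there exists $N\in\mathbb{N}$ such that for every bounded subset $B\subseteq\mathcal{D}(\mathbb{R}^s)$ there exist $\varepsilon_0\in(0,1]$ and $C>0$ such that for all $\varepsilon\in(0,\varepsilon_0)$, all $x\in K$, all $\varphi\in B\cap\mathcal{A}_0(\mathbb{R}^s)$ and all $\psi_1,\dots,\psi_k\in B\cap\mathcal{A}_{00}(\mathbb{R}^s)$, the quantity below is defined and $$\big|\partial_x^\alpha\, \mathrm{d}_1^k(R\circ S^{(\varepsilon)})(\varphi,x)(\psi_1,\dots,\psi_k)\big|\le C\varepsilon^{-N}.$$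
   Context: Fix $s\ge1$ and an open set $\Omega\subseteq\mathbb{R}^s$. $\mathcal{D}(\mathbb{R}^s)$ is the space of compactly supported smooth complex functions with its usual (LF) topology. Define $\mathcal{A}_0(\mathbb{R}^s)=\{\varphi\in\mathcal{D}(\mathbb{R}^s):\int\varphi(\xi)\,d\xi=1\}$, $\mathcal{A}_{00}(\mathbb{R}^s)=\{\varphi\in\mathcal{D}(\mathbb{R}^s):\int\varphi=0\}$, and for $q\in\mathbb{N}$, $\mathcal{A}_q(\mathbb{R}^s)=\{\varphi\in\mathcal{A}_0(\mathbb{R}^s):\int\xi^\beta\varphi(\xi)\,d\xi=0\text{ for }1\le|\beta|\le q\}$. Let $U(\Omega)=\{(\varphi,x)\in\mathcal{A}_0(\mathbb{R}^s)\times\Omega:\ \mathrm{supp}\,\varphi\subseteq\Omega-x\}$, and $\mathcal{E}^d(\Omega)=C^\infty(U(\Omega))$, the complex-valued functions on $U(\Omega)$ that are smooth in the sense of convenient calculus (Kriegl–Michor: maps sending smooth curves to smooth curves), $U(\Omega)$ being viewed as a subset of the affine space $\mathcal{A}_0(\mathbb{R}^s)\times\mathbb{R}^s$. For $\varepsilon>0$ put $(S_\varepsilon\varphi)(\xi)=\varepsilon^{-s}\varphi(\xi/\varepsilon)$ and $S^{(\varepsilon)}(\varphi,x)=(S_\varepsilon\varphi,x)$; $R\circ S^{(\varepsilon)}$ is defined at those $(\varphi,x)$ with $(S_\varepsilon\varphi,x)\in U(\Omega)$. $\mathrm{d}_1^k$ denotes the $k$-th differential with respect to the first (test-function) variable,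 evaluated in directions $\psi_1,\dots,\psi_k\in\mathcal{A}_{00}(\mathbb{R}^s)$, and $\partial_x^\alpha$ denotes partial differentiation in $x$. $C^\infty_b((0,1]\times\Omega,\mathcal{A}_q(\mathbb{R}^s))$ ($q\in\mathbb{N}_0$) denotes the set of smooth maps $\phi:(0,1]\times\Omega\to\mathcal{A}_q(\mathbb{R}^s)$ such that for every compact $K\subset\Omega$ and every $\alpha\in\mathbb{N}_0^s$ the set $\{\partial_x^\alpha\phi(\varepsilon,x):\varepsilon\in(0,1],x\in K\}$ is bounded in $\mathcal{D}(\mathbb{R}^s)$ (for such $\phi$ and compact $K$, $(S_\varepsilon\phi(\varepsilon,x),x)\in U(\Omega)$ for $x\in K$ and all small $\varepsilon$). $R\in\mathcal{E}^d(\Omega)$ is moderate, written $R\in\mathcal{E}^d_M(\Omega)$, if for every compact $K\subset\Omega$ and every $\alpha\in\mathbb{N}_0^s$ there is $N\in\mathbb{N}$ such that for every $\phi\in C^\infty_b((0,1]\times\Omega,\mathcal{A}_0(\mathbb{R}^s))$: $\sup_{x\in K}|\partial_x^\alpha(R(S_\varepsilon\phi(\varepsilon,x),x))|=O(\varepsilon^{-N})$ as $\varepsilon\to0$. *)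

theory Defs
  imports "HOL-Analysis.Analysis"
begin

text \<open>R^s is modelled by an arbitrary Euclidean space 'a (s = DIM('a));
  test functions are maps 'a \<Rightarrow> complex.\<close>

text \<open>Iterated directional derivatives along a list of directions;
  pd [v1,...,vm] g y = d_{v1} ( ... (d_{vm} g)) at y.  For directions in Basis
  this is the partial derivative of multi-index given by the multiplicities.\<close>
fun pd :: "'a::real_normed_vector list \<Rightarrow> ('a \<Rightarrow> 'b::real_normed_vector) \<Rightarrow> 'a \<Rightarrow> 'b" where
  "pd [] g = g"
| "pd (v # vs) g = (\<lambda>y. vector_derivative (\<lambda>h::real. pd vs g (y + h *\<^sub>R v)) (at 0))"

definition Cinf_on :: "'a::euclidean_space set \<Rightarrow> ('a \<Rightarrow> 'b::real_normed_vector) \<Rightarrow> bool" where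
  "Cinf_on S f \<longleftrightarrow> open S \<and>
     (\<forall>vs. set vs \<subseteq> Basis \<longrightarrow>
        continuous_on S (pd vs f) \<and>
        (\<forall>v\<in>Basis. \<forall>y\<in>S.
           ((\<lambda>h::real. pd vs f (y + h *\<^sub>R v)) has_vector_derivative pd (v # vs) f y) (at 0)))"

definition tsupp :: "('a::real_normed_vector \<Rightarrow> complex) \<Rightarrow> 'a set" where
  "tsupp \<phi> = closure {\<xi>. \<phi> \<xi> \<noteq> 0}"

definition test_fun :: "('a::euclidean_space \<Rightarrow> complex) \<Rightarrow> bool" where
  "test_fun \<phi> \<longleftrightarrow> Cinf_on UNIV \<phi> \<and> compact (tsupp \<phi>)"

definition A0 :: "('a::euclidean_space \<Rightarrow> complex) set" where
  "A0 = {\<phi>. test_fun \<phi> \<and> integral UNIV \<phi> = 1}"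

definition A00 :: "('a::euclidean_space \<Rightarrow> complex) set" where
  "A00 = {\<phi>. test_fun \<phi> \<and> integral UNIV \<phi> = 0}"

definition UOm :: "'a::euclidean_space set \<Rightarrow> (('a \<Rightarrow> complex) \<times> 'a) set" where
  "UOm \<Omega> = {(\<phi>, x). \<phi> \<in> A0 \<and> x \<in> \<Omega> \<and> tsupp \<phi> \<subseteq> (\<lambda>y. y - x) ` \<Omega>}"

definition Seps :: "real \<Rightarrow> ('a::euclidean_space \<Rightarrow> complex) \<Rightarrow> 'a \<Rightarrow> complex" where
  "Seps \<epsilon> \<phi> = (\<lambda>\<xi>. complex_of_real (inverse (\<epsilon> ^ DIM('a))) * \<phi> (inverse \<epsilon> *\<^sub>R \<xi>))"

text \<open>Bounded subsets of D(R^s) (Dieudonne-Schwartz characterisation):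
  common compact support and uniform bounds on every derivative.\<close>
definition bounded_D :: "('a::euclidean_space \<Rightarrow> complex) set \<Rightarrow> bool" where
  "bounded_D B \<longleftrightarrow> (\<forall>\<phi>\<in>B. test_fun \<phi>) \<and>
     (\<exists>K. compact K \<and> (\<forall>\<phi>\<in>B. tsupp \<phi> \<subseteq> K)) \<and>
     (\<forall>vs. set vs \<subseteq> Basis \<longrightarrow> (\<exists>C. \<forall>\<phi>\<in>B. \<forall>\<xi>. norm (pd vs \<phi> \<xi>) \<le> C))"

text \<open>Smooth maps from an open W of a finite-dimensional space into D(R^s)
  (standard characterisation): jointly smooth, and supports locally uniformly
  contained in a compact set.\<close>
definition smooth_D_on :: "'p::euclidean_space set \<Rightarrow> ('p \<Rightarrow> 'a::euclidean_space \<Rightarrow> complex) \<Rightarrow> bool" where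
  "smooth_D_on W c \<longleftrightarrow> open W \<and> (\<forall>p\<in>W. test_fun (c p)) \<and>
     Cinf_on (W \<times> UNIV) (\<lambda>(p, \<xi>). c p \<xi>) \<and>
     (\<forall>L. compact L \<and> L \<subseteq> W \<longrightarrow> (\<exists>K. compact K \<and> (\<forall>p\<in>L. tsupp (c p) \<subseteq> K)))"

text \<open>E^d(Omega): smooth in the convenient sense on U(Omega), i.e. maps smooth curves
  in U(Omega) to smooth curves.\<close>
definition Ed :: "'a::euclidean_space set \<Rightarrow> ((('a \<Rightarrow> complex) \<times> 'a) \<Rightarrow> complex) \<Rightarrow> bool" where
  "Ed \<Omega> R \<longleftrightarrow> (\<forall>(c1 :: real \<Rightarrow> 'a \<Rightarrow> complex) (c2 :: real \<Rightarrow> 'a).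
      smooth_D_on UNIV c1 \<and> Cinf_on UNIV c2 \<and> (\<forall>t. (c1 t, c2 t) \<in> UOm \<Omega>) \<longrightarrow>
      Cinf_on UNIV (\<lambda>t. R (c1 t, c2 t)))"

text \<open>C^infinity_b((0,1] x Omega, A_0(R^s)): smooth (i.e. restriction of a smooth map
  defined on an open neighbourhood of (0,1] x Omega), A_0-valued, with all
  x-derivatives bounded in D(R^s) uniformly for eps in (0,1], x in compact K.\<close>
definition Cb :: "'a::euclidean_space set \<Rightarrow> (real \<Rightarrow> 'a \<Rightarrow> 'a \<Rightarrow> complex) \<Rightarrow> bool" where
  "Cb \<Omega> \<phi> \<longleftrightarrow>
     (\<forall>\<epsilon>\<in>{0<..1}. \<forall>x\<in>\<Omega>. \<phi> \<epsilon> x \<in> A0) \<and>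
     (\<exists>W \<Phi>. {0<..1} \<times> \<Omega> \<subseteq> W \<and> smooth_D_on W \<Phi> \<and>
        (\<forall>\<epsilon>\<in>{0<..1}. \<forall>x\<in>\<Omega>. \<Phi> (\<epsilon>, x) = \<phi> \<epsilon> x)) \<and>
     (\<forall>K vs. compact K \<and> K \<subseteq> \<Omega> \<and> set vs \<subseteq> Basis \<longrightarrow>
        bounded_D {(\<lambda>\<xi>. pd vs (\<lambda>y. \<phi> \<epsilon> y \<xi>) x) | \<epsilon> x. \<epsilon> \<in> {0<..1} \<and> x \<in> K})"

definition moderate :: "'a::euclidean_space set \<Rightarrow> ((('a \<Rightarrow> complex) \<times> 'a) \<Rightarrow> complex) \<Rightarrow> bool" where
  "moderate \<Omega> R \<longleftrightarrow> Ed \<Omega> R \<and>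
     (\<forall>K \<alpha>. compact K \<and> K \<subseteq> \<Omega> \<and> set \<alpha> \<subseteq> Basis \<longrightarrow>
       (\<exists>N::nat. \<forall>\<phi>. Cb \<Omega> \<phi> \<longrightarrow>
          (\<exists>\<epsilon>0 C. \<epsilon>0 \<in> {0<..1} \<and>
             (\<forall>\<epsilon>\<in>{0<..<\<epsilon>0}. \<forall>x\<in>K.
                norm (pd \<alpha> (\<lambda>y. R (Seps \<epsilon> (\<phi> \<epsilon> y), y)) x) \<le> C * \<epsilon> powr (- real N)))))"

text \<open>k-th differential in the first variable:
  d1 F [psi1,...,psik] phi x = d^k_1 F (phi,x)(psi1,...,psik), as iterated
  directional derivatives.\<close>
fun d1 :: "((('a::euclidean_space \<Rightarrow> complex) \<times> 'a) \<Rightarrow> complex) \<Rightarrow> ('a \<Rightarrow> complex) list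
           \<Rightarrow> ('a \<Rightarrow> complex) \<Rightarrow> 'a \<Rightarrow> complex" where
  "d1 F [] \<phi> x = F (\<phi>, x)"
| "d1 F (\<psi> # \<psi>s) \<phi> x =
     vector_derivative (\<lambda>t::real. d1 F \<psi>s (\<lambda>\<xi>. \<phi> \<xi> + complex_of_real t * \<psi> \<xi>) x) (at 0)"

end

theory Submission
  imports Defs
begin

text \<open>Fix a compact set L and put G(phi, y) = R(S_eps phi, theta y), where theta maps the whole space smoothly
  into a small ball and is the identity near the point of interest.  Then G is defined on an affine space of
  test functions supported in L times the whole space, and maps smooth curves to smooth curves.  By Boman's
  theorem in the plane every iterated directional derivative of G is again smooth along smooth curves, hence
  the differentials of G are symmetric, multilinear and obey the chain and Leibniz rules.

  If the differentials are of moderate growth, the higher chain rule writes a derivative of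
  R(S_eps phi(eps, x), x) as a finite sum of differentials applied to x-derivatives of phi, which stay in a
  bounded set.

  Conversely, let R be moderate and suppose that derivatives of y |-> R(S_eps (phi + l(y - x) T), y) at y = x,
  with l a coordinate function, were not uniformly of moderate growth for phi and T in a bounded set.
  Counterexamples at eps_0 > eps_1 > ... -> 0 glue to one admissible phi(eps, x) contradicting moderateness.
  These derivatives are differentials in directions (T, e), ..., (T, e), (0, v_1), ..., (0, v_m).  Taking
  T = l_1 psi_1 + ... + l_k psi_k with scalars l_i, they are polynomials in the l_i; extracting the coefficient
  of l_1 ... l_k, one variable at a time, gives the required differential.\<close>

section \<open>Smooth functions on open sets of Euclidean spaces\<close>

text \<open>Membership in E^d gives smoothness only along curves, while a differential in a moving
  direction is a partial derivative of a function of two parameters. Hence a theorem about the plane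
  is needed, and dimension two is enough: each further direction adds one parameter to the curve
  parameter, and the result is again restricted to a curve.

  Moderateness sees only x-derivatives of R(S_eps phi(eps, x), x). A test-function direction becomes
  visible only if phi varies with x, and phi + l(y - x) T is the simplest variation: its derivative
  is T along one basis vector e, 0 along the others, and there are no higher ones. The price is that
  all inserted directions are the same T with e attached; this forces k extra derivatives along e
  and the polarisation over l_1, ..., l_k.

  The exponent N must be fixed before the bounded set B. It comes from moderateness for K and the
  enlarged multi-index alone; gluing then makes the estimate uniform over B. A Landau inequality
  serves twice, for mixed derivatives in Boman's theorem and for extracting coefficients.\<close>

fun Ck :: "nat \<Rightarrow> 'a::real_normed_vector set \<Rightarrow> ('a \<Rightarrow> 'b::real_normed_vector) \<Rightarrow> bool" where
  "Ck 0 S f = continuous_on S f"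
| "Ck (Suc n) S f = (\<exists>f'. (\<forall>x\<in>S. (f has_derivative f' x) (at x)) \<and> (\<forall>v. Ck n S (\<lambda>x. f' x v)))"

lemma Ck_SucI:
  assumes "\<And>x. x \<in> S \<Longrightarrow> (f has_derivative f' x) (at x)" "\<And>v. Ck n S (\<lambda>x. f' x v)"
  shows "Ck (Suc n) S f"
  using assms by auto

lemma Ck_imp_continuous_on: "Ck n S f \<Longrightarrow> continuous_on S f"
  by (cases n) (auto intro!: continuous_at_imp_continuous_on dest: has_derivative_continuous)

lemma Ck_SucD: "Ck (Suc n) S f \<Longrightarrow> Ck n S f"
proof (induction n arbitrary: f)
  case 0 then show ?case using Ck_imp_continuous_on by (metis Ck.simps(1))
next
  case (Suc n)
  from Suc.prems obtain f' where f': "\<forall>x\<in>S. (f has_derivative f' x) (at x)" "\<forall>v. Ck (Suc n) S (\<lambda>x. f' x v)"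
    by (subst (asm) Ck.simps(2)) blast
  from f'(2) Suc.IH have "\<forall>v. Ck n S (\<lambda>x. f' x v)" by blast
  with f'(1) show ?case by (intro Ck_SucI[of S f f']) blast+
qed

lemma Ck_cong:
  assumes "Ck n S f" "open S" "\<And>x. x \<in> S \<Longrightarrow> f x = g x"
  shows "Ck n S g"
proof (cases n)
  case 0 then show ?thesis using assms by (auto simp: continuous_on_eq)
next
  case (Suc m)
  then obtain f' where f': "\<forall>x\<in>S. (f has_derivative f' x) (at x)" "\<forall>v. Ck m S (\<lambda>x. f' x v)"
    using assms by auto
  then show ?thesis unfolding Suc
    by (intro Ck_SucI[of S g f']) (auto intro: has_derivative_transform_within_open[OF _ assms(2) _ assms(3)])
qed

lemma Ck_subset: "Ck n S f \<Longrightarrow> T \<subseteq> S \<Longrightarrow> Ck n T f"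
proof (induction n arbitrary: f)
  case 0 then show ?case by (auto intro: continuous_on_subset)
next
  case (Suc n)
  then obtain f' where f': "\<forall>x\<in>S. (f has_derivative f' x) (at x)" "\<forall>v. Ck n S (\<lambda>x. f' x v)"
    by auto
  with Suc show ?case by (intro Ck_SucI[of T f f']) auto
qed

lemma Ck_const: "Ck n S (\<lambda>x. c)"
  by (induction n arbitrary: c) (auto intro!: exI[of _ "\<lambda>x v. 0"])

lemma Ck_linear:
  assumes "bounded_linear L"
  shows "Ck n S L"
proof (cases n)
  case 0 then show ?thesis using assms by (simp add: linear_continuous_on)
next
  case (Suc m)
  show ?thesis unfolding Suc
    by (rule Ck_SucI[of S L "\<lambda>x. L"]) (auto simp: Ck_const assms bounded_linear_imp_has_derivative)
qed

lemma Ck_add: "Ck n S f \<Longrightarrow> Ck n S g \<Longrightarrow> Ck n S (\<lambda>x. f x + g x)"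
proof (induction n arbitrary: f g)
  case 0 then show ?case by (auto intro: continuous_on_add)
next
  case (Suc n)
  from Suc.prems obtain f' g' where "\<forall>x\<in>S. (f has_derivative f' x) (at x)" "\<forall>v. Ck n S (\<lambda>x. f' x v)"
     "\<forall>x\<in>S. (g has_derivative g' x) (at x)" "\<forall>v. Ck n S (\<lambda>x. g' x v)" by auto
  with Suc.IH show ?case
    by (intro Ck_SucI[of S _ "\<lambda>x v. f' x v + g' x v"]) (auto intro: has_derivative_add)
qed

lemma Ck_sum: "(\<And>i. i \<in> I \<Longrightarrow> Ck n S (f i)) \<Longrightarrow> Ck n S (\<lambda>x. \<Sum>i\<in>I. f i x)"
  by (induction I rule: infinite_finite_induct) (auto simp: Ck_const Ck_add)

lemma Ck_bilinear:
  assumes B: "bounded_bilinear B"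
  shows "Ck n S f \<Longrightarrow> Ck n S g \<Longrightarrow> Ck n S (\<lambda>x. B (f x) (g x))"
proof (induction n arbitrary: f g)
  case 0 then show ?case using bounded_bilinear.continuous_on[OF B] by auto
next
  case (Suc n)
  from Suc.prems obtain f' g' where d: "\<forall>x\<in>S. (f has_derivative f' x) (at x)" "\<forall>v. Ck n S (\<lambda>x. f' x v)"
     "\<forall>x\<in>S. (g has_derivative g' x) (at x)" "\<forall>v. Ck n S (\<lambda>x. g' x v)" by auto
  have fg: "Ck n S f" "Ck n S g" using Suc.prems Ck_SucD by blast+
  show ?case
  proof (rule Ck_SucI[of S _ "\<lambda>x v. B (f x) (g' x v) + B (f' x v) (g x)"])
    show "((\<lambda>x. B (f x) (g x)) has_derivative (\<lambda>v. B (f x) (g' x v) + B (f' x v) (g x))) (at x)"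
      if "x \<in> S" for x using d that by (intro bounded_bilinear.FDERIV[OF B]) auto
    show "Ck n S (\<lambda>x. B (f x) (g' x v) + B (f' x v) (g x))" for v
      by (intro Ck_add Suc.IH fg) (use d in auto)
  qed
qed

lemma Ck_bounded_linear_compose:
  assumes L: "bounded_linear L"
  shows "Ck n S f \<Longrightarrow> Ck n S (\<lambda>x. L (f x))"
proof (induction n arbitrary: f)
  case 0 then show ?case using bounded_linear.continuous_on[OF L] by auto
next
  case (Suc n)
  from Suc.prems obtain f' where d: "\<forall>x\<in>S. (f has_derivative f' x) (at x)" "\<forall>v. Ck n S (\<lambda>x. f' x v)" by auto
  show ?case
    by (rule Ck_SucI[of S _ "\<lambda>x v. L (f' x v)"])
      (use d Suc.IH in \<open>auto intro: bounded_linear.has_derivative[OF L]\<close>)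
qed

text \<open>\<open>Ck\<close> controls the derivative in fixed directions only, but the chain rule
  produces g'(f x) in the direction f' x v, which moves with x. Expanding that direction in the
  basis of the intermediate space leaves finitely many fixed directions with scalar coefficients;
  hence the Euclidean type of the middle space.\<close>

lemma Ck_compose:
  fixes f :: "'a::real_normed_vector \<Rightarrow> 'b::euclidean_space" and g :: "'b \<Rightarrow> 'c::real_normed_vector"
  shows "Ck n S f \<Longrightarrow> Ck n T g \<Longrightarrow> f ` S \<subseteq> T \<Longrightarrow> Ck n S (\<lambda>x. g (f x))"
proof (induction n arbitrary: g)
  case 0 then show ?case by (auto intro: continuous_on_compose2)
next
  case (Suc n)
  from Suc.prems obtain f' g' where d: "\<forall>x\<in>S. (f has_derivative f' x) (at x)" "\<forall>v. Ck n S (\<lambda>x. f' x v)"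
     "\<forall>x\<in>T. (g has_derivative g' x) (at x)" "\<forall>v. Ck n T (\<lambda>x. g' x v)" by auto
  have fg: "Ck n S f" using Suc.prems Ck_SucD by blast+
  show ?case
  proof (rule Ck_SucI[of S _ "\<lambda>x v. \<Sum>b\<in>Basis. (f' x v \<bullet> b) *\<^sub>R g' (f x) b"])
    fix x assume x: "x \<in> S"
    have gd: "(g has_derivative g' (f x)) (at (f x))" using d x Suc.prems by auto
    have comp: "((\<lambda>x. g (f x)) has_derivative (\<lambda>v. g' (f x) (f' x v))) (at x)"
      using has_derivative_compose[of f "f' x" x UNIV g "g' (f x)"] gd d x by auto
    have rep: "g' (f x) w = (\<Sum>b\<in>Basis. (w \<bullet> b) *\<^sub>R g' (f x) b)" for w
    proof -
      have "g' (f x) w = g' (f x) (\<Sum>b\<in>Basis. (w \<bullet> b) *\<^sub>R b)" by (simp add: euclidean_representation)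
      also have "\<dots> = (\<Sum>b\<in>Basis. (w \<bullet> b) *\<^sub>R g' (f x) b)"
        using has_derivative_linear[OF gd] by (simp add: linear_sum linear_cmul)
      finally show ?thesis .
    qed
    show "((\<lambda>x. g (f x)) has_derivative (\<lambda>v. \<Sum>b\<in>Basis. (f' x v \<bullet> b) *\<^sub>R g' (f x) b)) (at x)"
    proof -
      have "(\<lambda>v. \<Sum>b\<in>Basis. (f' x v \<bullet> b) *\<^sub>R g' (f x) b) = (\<lambda>v. g' (f x) (f' x v))"
        by (rule ext, rule rep[symmetric])
      with comp show ?thesis by (simp only:)
    qed
  next
    fix v
    show "Ck n S (\<lambda>x. \<Sum>b\<in>Basis. (f' x v \<bullet> b) *\<^sub>R g' (f x) b)"
      by (intro Ck_sum Ck_bilinear[OF bounded_bilinear_scaleR] Suc.IH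
           Ck_bounded_linear_compose[OF bounded_linear_inner_left] fg)
        (use d Suc.prems in auto)
  qed
qed

lemma Ck_local:
  assumes "\<And>x. x \<in> S \<Longrightarrow> \<exists>T. open T \<and> x \<in> T \<and> Ck n T f"
  shows "Ck n S f"
  using assms
proof (induction n arbitrary: f)
  case 0
  show ?case unfolding Ck.simps
  proof (rule continuous_at_imp_continuous_on, rule ballI)
    fix x assume "x \<in> S"
    then obtain T where "open T" "x \<in> T" "continuous_on T f" using 0 by auto
    then show "isCont f x" by (simp add: continuous_on_eq_continuous_at)
  qed
next
  case (Suc n)
  \<comment> \<open>The neighbourhoods carry unrelated witnesses for the derivative. The canonical
    \<open>frechet_derivative\<close> agrees with each of them by uniqueness and so glues
    them.\<close>
  have fr: "(f has_derivative frechet_derivative f (at x)) (at x)" if "x \<in> T" "Ck (Suc n) T f" for x T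
  proof -
    from that(2) obtain f' where "\<forall>x\<in>T. (f has_derivative f' x) (at x)" by auto
    with that(1) have "f differentiable (at x)" unfolding differentiable_def by blast
    then show ?thesis by (simp add: frechet_derivative_works)
  qed
  show ?case
  proof (rule Ck_SucI)
    show "(f has_derivative frechet_derivative f (at x)) (at x)" if "x \<in> S" for x
      using Suc.prems[OF that] fr by blast
    show "Ck n S (\<lambda>x. frechet_derivative f (at x) v)" for v
    proof (rule Suc.IH)
      fix x assume "x \<in> S"
      then obtain T where T: "open T" "x \<in> T" "Ck (Suc n) T f" using Suc.prems by blast
      then obtain f' where f': "\<forall>x\<in>T. (f has_derivative f' x) (at x)" "\<forall>v. Ck n T (\<lambda>x. f' x v)" by auto
      have eq: "f' x v = frechet_derivative f (at x) v" if "x \<in> T" for x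
        using has_derivative_unique[OF f'(1)[rule_format, OF that] fr[OF that T(3)]] by simp
      have "Ck n T (\<lambda>x. frechet_derivative f (at x) v)"
        by (rule Ck_cong[of n T "\<lambda>x. f' x v", OF f'(2)[rule_format] T(1) eq])
      with T show "\<exists>T. open T \<and> x \<in> T \<and> Ck n T (\<lambda>x. frechet_derivative f (at x) v)" by blast
    qed
  qed
qed

lemma has_vector_derivative_shift:
  fixes x :: real
  shows "((\<lambda>h. f (x + h)) has_vector_derivative D) (at 0) \<longleftrightarrow> (f has_vector_derivative D) (at x)"
proof
  have d: "((\<lambda>t. t - x) has_vector_derivative 1) (at x)" by (auto intro!: derivative_eq_intros)
  assume "((\<lambda>h. f (x + h)) has_vector_derivative D) (at 0)"
  then show "(f has_vector_derivative D) (at x)"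
    using vector_diff_chain_at[OF d, of "\<lambda>h. f (x + h)" D] by (simp add: o_def)
next
  have d: "((\<lambda>h. x + h) has_vector_derivative 1) (at 0)" by (auto intro!: derivative_eq_intros)
  assume "(f has_vector_derivative D) (at x)"
  then show "((\<lambda>h. f (x + h)) has_vector_derivative D) (at 0)"
    using vector_diff_chain_at[OF d, of f D] by (simp add: o_def)
qed

text \<open>Move along one coordinate at a time.\<close>

lemma has_derivative_continuous_partials:
  fixes f :: "'a::euclidean_space \<Rightarrow> 'b::real_normed_vector" and g :: "'a \<Rightarrow> 'a \<Rightarrow> 'b" and x :: 'a
  assumes S: "open S" "x \<in> S"
    and d: "\<And>b y. b \<in> Basis \<Longrightarrow> y \<in> S \<Longrightarrow> ((\<lambda>h::real. f (y + h *\<^sub>R b)) has_vector_derivative g b y) (at 0)"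
    and c: "\<And>b. b \<in> Basis \<Longrightarrow> continuous_on S (g b)"
  shows "(f has_derivative (\<lambda>h::'a. \<Sum>b\<in>Basis. (h \<bullet> b) *\<^sub>R g b x)) (at x)"
proof -
  have key: "\<forall>e>0. \<exists>\<delta>>0. \<forall>y h::'a. norm (y - x) < \<delta> \<and> norm h < \<delta> \<longrightarrow>
      norm (f (y + (\<Sum>b\<in>D. (h \<bullet> b) *\<^sub>R b)) - f y - (\<Sum>b\<in>D. (h \<bullet> b) *\<^sub>R g b x)) \<le> e * norm h"
    if "D \<subseteq> Basis" "finite D" for D :: "'a set"
    using that(2,1)
  proof (induction D rule: finite_induct)
    case empty then show ?case by (auto intro: exI[of _ 1])
  next
    case (insert b D)
    then have b: "b \<in> Basis" and D: "D \<subseteq> Basis" by auto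
    show ?case
    proof (intro allI impI)
      fix e :: real assume e: "e > 0"
      obtain d1 where d1: "d1 > 0" "\<And>y h::'a. norm (y - x) < d1 \<Longrightarrow> norm h < d1 \<Longrightarrow>
          norm (f (y + (\<Sum>b\<in>D. (h \<bullet> b) *\<^sub>R b)) - f y - (\<Sum>b\<in>D. (h \<bullet> b) *\<^sub>R g b x)) \<le> e/2 * norm h"
        using insert.IH[OF D] e by (meson half_gt_zero)
      obtain d0 where d0: "d0 > 0" "ball x d0 \<subseteq> S" using S open_contains_ball by blast
      have "isCont (g b) x" using c[OF b] S by (simp add: continuous_on_eq_continuous_at)
      then obtain d2 where d2: "d2 > 0" "\<And>y. norm (y - x) < d2 \<Longrightarrow> norm (g b y - g b x) < e/2"
        unfolding continuous_at_eps_delta using e by (metis half_gt_zero dist_norm)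
      \<comment> \<open>Moving the coordinates in D shifts the base point by at most card D times
        norm h, hence the divisor. The quarters of d0 and d2 leave room for the last segment along
        b.\<close>
      define \<delta> where "\<delta> = Min {d1, d0/4, d2/4} / (real (card D) + 1)"
      have min: "Min {d1, d0/4, d2/4} > 0" using d0 d1 d2 by simp
      have cd: "real (card D) + 1 \<ge> 1" by simp
      have dp: "\<delta> > 0" unfolding \<delta>_def using min by (auto intro!: divide_pos_pos)
      have dle: "\<delta> * (real (card D) + 1) \<le> d1" "\<delta> * (real (card D) + 1) \<le> d0/4" "\<delta> * (real (card D) + 1) \<le> d2/4"
        by (auto simp: \<delta>_def)
      have dle0: "\<delta> \<le> \<delta> * (real (card D) + 1)" using dp by simp
      show "\<exists>\<delta>>0. \<forall>y h::'a. norm (y - x) < \<delta> \<and> norm h < \<delta> \<longrightarrow>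
          norm (f (y + (\<Sum>b\<in>insert b D. (h \<bullet> b) *\<^sub>R b)) - f y - (\<Sum>b\<in>insert b D. (h \<bullet> b) *\<^sub>R g b x)) \<le> e * norm h"
      proof (intro exI[of _ \<delta>] conjI allI impI dp)
        fix y h :: 'a assume yh: "norm (y - x) < \<delta> \<and> norm h < \<delta>"
        define y' where "y' = y + (\<Sum>b\<in>D. (h \<bullet> b) *\<^sub>R b)"
        have "norm (\<Sum>b\<in>D. (h \<bullet> b) *\<^sub>R b) \<le> (\<Sum>b\<in>D. norm h)"
          by (rule sum_norm_le) (use D Basis_le_norm in \<open>auto simp: subset_iff\<close>)
        also have "\<dots> \<le> real (card D) * \<delta>" using yh by (simp add: mult_left_mono)
        finally have y': "norm (y' - x) \<le> \<delta> * (real (card D) + 1)"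
          unfolding y'_def using yh norm_triangle_ineq[of "y - x" "\<Sum>b\<in>D. (h \<bullet> b) *\<^sub>R b"] by (simp add: algebra_simps)
        have hb: "\<bar>h \<bullet> b\<bar> \<le> norm h" using Basis_le_norm[OF b] .
        define s where "s = h \<bullet> b"
        have seg: "norm (y' + t *\<^sub>R b - x) < min d0 d2" if "\<bar>t\<bar> \<le> \<bar>s\<bar>" for t
        proof -
          have "norm (y' + t *\<^sub>R b - x) \<le> norm (y' - x) + norm (t *\<^sub>R b)"
            by (metis add.commute add_diff_eq norm_triangle_ineq)
          also have "norm (t *\<^sub>R b) = \<bar>t\<bar>" using b by simp
          also have "norm (y' - x) + \<bar>t\<bar> \<le> \<delta> * (real (card D) + 1) + \<delta>" using y' that hb yh s_def by linarith
          finally show ?thesis using dle dle0 d0 d2 dp by linarith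
        qed
        have D1: "((\<lambda>t. f (y' + t *\<^sub>R b)) has_vector_derivative g b (y' + t *\<^sub>R b)) (at t)" if "\<bar>t\<bar> \<le> \<bar>s\<bar>" for t
        proof -
          have "y' + t *\<^sub>R b \<in> S" using seg[OF that] d0(2) by (auto simp: dist_norm norm_minus_commute subset_iff)
          from d[OF b this] have "((\<lambda>h. f (y' + t *\<^sub>R b + h *\<^sub>R b)) has_vector_derivative g b (y' + t *\<^sub>R b)) (at 0)" .
          then have "((\<lambda>r. f (y' + t *\<^sub>R b + (r - t) *\<^sub>R b)) has_vector_derivative 1 *\<^sub>R g b (y' + t *\<^sub>R b)) (at t)"
            by (intro vector_diff_chain_at[of "\<lambda>r. r - t" 1 t "\<lambda>h. f (y' + t *\<^sub>R b + h *\<^sub>R b)", unfolded o_def])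
              (auto intro!: derivative_eq_intros)
          then show ?thesis by (simp add: algebra_simps)
        qed
        have D2: "((\<lambda>t. f (y' + t *\<^sub>R b) - t *\<^sub>R g b x) has_derivative (\<lambda>r. r *\<^sub>R (g b (y' + t *\<^sub>R b) - g b x))) (at t within closed_segment 0 s)"
          if "t \<in> closed_segment 0 s" for t
        proof -
          have t: "\<bar>t\<bar> \<le> \<bar>s\<bar>" using that by (auto simp: closed_segment_eq_real_ivl split: if_splits)
          have "((\<lambda>t. f (y' + t *\<^sub>R b) - t *\<^sub>R g b x) has_vector_derivative (g b (y' + t *\<^sub>R b) - g b x)) (at t)"
            by (auto intro!: derivative_eq_intros D1[OF t])
          then show ?thesis by (auto simp: has_vector_derivative_def intro: has_derivative_at_withinI)
        qed
        have "norm ((f (y' + s *\<^sub>R b) - s *\<^sub>R g b x) - (f (y' + 0 *\<^sub>R b) - 0 *\<^sub>R g b x)) \<le> e/2 * norm (s - 0)"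
        proof (rule differentiable_bound[OF _ D2])
          fix t assume "t \<in> closed_segment 0 s"
          then have t: "\<bar>t\<bar> \<le> \<bar>s\<bar>" by (auto simp: closed_segment_eq_real_ivl split: if_splits)
          have "norm (g b (y' + t *\<^sub>R b) - g b x) \<le> e/2" using d2(2) seg[OF t] by (simp add: less_imp_le)
          then show "onorm (\<lambda>r. r *\<^sub>R (g b (y' + t *\<^sub>R b) - g b x)) \<le> e/2"
          proof (intro onorm_le)
            fix r :: real
            assume "norm (g b (y' + t *\<^sub>R b) - g b x) \<le> e/2"
            from mult_right_mono[OF this, of "norm r"]
            show "norm (r *\<^sub>R (g b (y' + t *\<^sub>R b) - g b x)) \<le> e/2 * norm r" by (simp add: mult.commute)
          qed
        qed auto
        then have 1: "norm (f (y' + s *\<^sub>R b) - f y' - s *\<^sub>R g b x) \<le> e/2 * norm h"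
        proof -
          assume a: "norm ((f (y' + s *\<^sub>R b) - s *\<^sub>R g b x) - (f (y' + 0 *\<^sub>R b) - 0 *\<^sub>R g b x)) \<le> e/2 * norm (s - 0)"
          have "e/2 * norm (s - 0) \<le> e/2 * norm h" using e hb by (simp add: s_def)
          with a show ?thesis by (simp add: algebra_simps)
        qed
        have 2: "norm (f y' - f y - (\<Sum>b\<in>D. (h \<bullet> b) *\<^sub>R g b x)) \<le> e/2 * norm h"
          unfolding y'_def by (rule d1(2)) (use yh dle dle0 in linarith)+
        have eq: "f (y + (\<Sum>b\<in>insert b D. (h \<bullet> b) *\<^sub>R b)) - f y - (\<Sum>b\<in>insert b D. (h \<bullet> b) *\<^sub>R g b x)
            = (f (y' + s *\<^sub>R b) - f y' - s *\<^sub>R g b x) + (f y' - f y - (\<Sum>b\<in>D. (h \<bullet> b) *\<^sub>R g b x))"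
          using insert.hyps by (simp add: y'_def s_def algebra_simps)
        show "norm (f (y + (\<Sum>b\<in>insert b D. (h \<bullet> b) *\<^sub>R b)) - f y - (\<Sum>b\<in>insert b D. (h \<bullet> b) *\<^sub>R g b x)) \<le> e * norm h"
          unfolding eq using norm_triangle_ineq[of "f (y' + s *\<^sub>R b) - f y' - s *\<^sub>R g b x" "f y' - f y - (\<Sum>b\<in>D. (h \<bullet> b) *\<^sub>R g b x)"] 1 2
          by (simp add: field_simps)
      qed
    qed
  qed
  have lin: "bounded_linear (\<lambda>h. \<Sum>b\<in>Basis. (h \<bullet> b) *\<^sub>R g b x)"
    by (intro bounded_linear_sum bounded_linear_scaleR_const bounded_linear_inner_left)
  show ?thesis
    unfolding has_derivative_at_alt
  proof (intro conjI allI impI lin)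
    fix e :: real assume "e > 0"
    with key[OF subset_refl finite_Basis] obtain d where d: "d > 0" and
      d': "\<And>y h::'a. norm (y - x) < d \<and> norm h < d \<Longrightarrow>
      norm (f (y + (\<Sum>b\<in>Basis. (h \<bullet> b) *\<^sub>R b)) - f y - (\<Sum>b\<in>Basis. (h \<bullet> b) *\<^sub>R g b x)) \<le> e * norm h"
      by meson
    show "\<exists>d>0. \<forall>y. norm (y - x) < d \<longrightarrow>
        norm (f y - f x - (\<Sum>b\<in>Basis. ((y - x) \<bullet> b) *\<^sub>R g b x)) \<le> e * norm (y - x)"
    proof (intro exI[of _ d] conjI allI impI d)
      fix y assume "norm (y - x) < d"
      then show "norm (f y - f x - (\<Sum>b\<in>Basis. ((y - x) \<bullet> b) *\<^sub>R g b x)) \<le> e * norm (y - x)"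
        using d'[of x "y - x"] d by (simp add: euclidean_representation)
    qed
  qed
qed

section \<open>Iterated directional derivatives and differentiability of every finite order\<close>

lemma pd_append: "pd (us @ vs) f = pd us (pd vs f)"
  by (induction us) auto

lemma vector_derivative_cong_at:
  fixes f g :: "real \<Rightarrow> 'b::real_normed_vector"
  assumes "open T" "x \<in> T" "\<And>t. t \<in> T \<Longrightarrow> f t = g t"
  shows "vector_derivative f (at x) = vector_derivative g (at x)"
proof -
  have "(f has_vector_derivative d) (at x) = (g has_vector_derivative d) (at x)" for d
    using has_vector_derivative_transform_within_open[of f d x T g]
      has_vector_derivative_transform_within_open[of g d x T f] assms by auto
  then show ?thesis by (simp add: vector_derivative_def)
qed

lemma pd_cong_on:
  assumes S: "open S" and fg: "\<And>x. x \<in> S \<Longrightarrow> f x = g x" and x: "x \<in> S"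
  shows "pd vs f x = pd vs g x"
  using x
proof (induction vs arbitrary: x)
  case Nil then show ?case using fg by simp
next
  case (Cons v vs)
  have op: "open ((\<lambda>h::real. x + h *\<^sub>R v) -` S)"
    by (intro open_vimage S continuous_intros)
  show ?case unfolding pd.simps
    by (rule vector_derivative_cong_at[OF op]) (use Cons in auto)
qed

lemma has_derivative_dir:
  assumes "(f has_derivative f') (at y)"
  shows "((\<lambda>h::real. f (y + h *\<^sub>R v)) has_vector_derivative f' v) (at 0)"
proof -
  have "((\<lambda>h::real. y + h *\<^sub>R v) has_derivative (\<lambda>h. h *\<^sub>R v)) (at 0)"
    by (auto intro!: derivative_eq_intros)
  from has_derivative_compose[OF this, of f f'] assms
  have "((\<lambda>h. f (y + h *\<^sub>R v)) has_derivative (\<lambda>h. f' (h *\<^sub>R v))) (at 0)" by simp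
  then show ?thesis
    using has_derivative_linear[OF assms] by (simp add: has_vector_derivative_def linear_cmul)
qed

abbreviation (input) smooth :: "('a::euclidean_space \<Rightarrow> 'b::real_normed_vector) \<Rightarrow> bool" where
  "smooth \<equiv> Cinf_on UNIV"

lemma Cinf_on_open: "Cinf_on S f \<Longrightarrow> open S"
  by (simp add: Cinf_on_def)

lemma Cinf_on_pd_aux:
  assumes "Cinf_on S f" "set us \<subseteq> Basis"
  shows "Cinf_on S (pd us f)"
  unfolding Cinf_on_def
proof (intro conjI allI impI)
  show "open S" using assms by (simp add: Cinf_on_def)
  fix vs :: "'a list" assume vs: "set vs \<subseteq> Basis"
  then have 1: "set (vs @ us) \<subseteq> Basis" using assms by auto
  have "continuous_on S (pd (vs @ us) f)"
    "\<forall>v\<in>Basis. \<forall>y\<in>S. ((\<lambda>h. pd (vs @ us) f (y + h *\<^sub>R v)) has_vector_derivative pd (v # vs @ us) f y) (at 0)"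
    using assms(1) 1 unfolding Cinf_on_def by blast+
  then show "continuous_on S (pd vs (pd us f))"
    "\<forall>v\<in>Basis. \<forall>y\<in>S. ((\<lambda>h. pd vs (pd us f) (y + h *\<^sub>R v)) has_vector_derivative pd (v # vs) (pd us f) y) (at 0)"
    by (simp_all only: pd_append append_Cons[symmetric])
qed

lemma Cinf_on_partialD:
  assumes "Cinf_on S f" "v \<in> Basis" "y \<in> S"
  shows "((\<lambda>h. f (y + h *\<^sub>R v)) has_vector_derivative pd [v] f y) (at 0)"
proof -
  have "set [] \<subseteq> (Basis :: 'a set)" by simp
  with assms have "((\<lambda>h. pd [] f (y + h *\<^sub>R v)) has_vector_derivative pd [v] f y) (at 0)"
    unfolding Cinf_on_def by blast
  then show ?thesis by simp
qed

lemma Cinf_on_imp_continuous_on: "Cinf_on S f \<Longrightarrow> continuous_on S f"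
  unfolding Cinf_on_def by (metis empty_set empty_subsetI pd.simps(1))

lemma Cinf_on_has_derivative_Basis:
  assumes "Cinf_on S f" "x \<in> S"
  shows "(f has_derivative (\<lambda>h. \<Sum>b\<in>Basis. (h \<bullet> b) *\<^sub>R pd [b] f x)) (at x)"
proof (rule has_derivative_continuous_partials[of S x f "\<lambda>b. pd [b] f"])
  show "open S" "x \<in> S" using assms Cinf_on_open by auto
  show "continuous_on S (pd [b] f)" if "b \<in> Basis" for b
    by (rule Cinf_on_imp_continuous_on, rule Cinf_on_pd_aux) (use assms that in auto)
qed (rule Cinf_on_partialD[OF assms(1)])

lemma Cinf_on_imp_Ck: "Cinf_on S f \<Longrightarrow> Ck n S f"
proof (induction n arbitrary: f)
  case 0 then show ?case by (simp add: Cinf_on_imp_continuous_on)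
next
  case (Suc n)
  show ?case
  proof (rule Ck_SucI, rule Cinf_on_has_derivative_Basis)
    show "Ck n S (\<lambda>x. \<Sum>b\<in>Basis. (v \<bullet> b) *\<^sub>R pd [b] f x)" for v
      by (intro Ck_sum Ck_bounded_linear_compose[OF bounded_linear_scaleR_right] Suc.IH
          Cinf_on_pd_aux Suc.prems) auto
  qed (use Suc.prems in auto)
qed

lemma Ck_pd:
  assumes S: "open S" and f: "\<And>n. Ck n S f"
  shows "Ck n S (pd vs f)"
proof (induction vs arbitrary: n)
  case Nil then show ?case using f by simp
next
  case (Cons v vs)
  from Cons.IH[of "Suc n"] obtain g' where
    g': "\<forall>x\<in>S. (pd vs f has_derivative g' x) (at x)" "\<forall>v. Ck n S (\<lambda>x. g' x v)" by auto
  have "g' x v = pd (v # vs) f x" if "x \<in> S" for x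
    using has_derivative_dir[OF g'(1)[rule_format, OF that], of v] by (simp add: vector_derivative_at)
  then show ?case by (rule Ck_cong[OF g'(2)[rule_format, of v] S])
qed

text \<open>\<open>Cinf_on\<close> speaks of iterated partials along basis vectors,
  \<open>Ck\<close> of total derivatives. Continuous partials give total derivatives by
  \<open>has_derivative_continuous_partials\<close>; conversely a total derivative computes every
  directional one. Closure under sums, products and composition is proved for \<open>Ck\<close> by
  induction on the order and transported through this equivalence.\<close>

lemma Cinf_on_iff_Ck: "Cinf_on S f \<longleftrightarrow> open S \<and> (\<forall>n. Ck n S f)"
proof
  assume "Cinf_on S f" then show "open S \<and> (\<forall>n. Ck n S f)" using Cinf_on_imp_Ck Cinf_on_open by blast
next
  assume a: "open S \<and> (\<forall>n. Ck n S f)"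
  then have C: "Ck n S (pd vs f)" for n vs using Ck_pd by blast
  show "Cinf_on S f" unfolding Cinf_on_def
  proof (intro conjI allI impI ballI)
    show "open S" using a by simp
    fix vs :: "'a list" 
    show "continuous_on S (pd vs f)" using C[of 0] by simp
    fix v y :: 'a assume y: "y \<in> S"
    from C[of 1 vs] y obtain g' where "(pd vs f has_derivative g') (at y)" by auto
    from has_derivative_dir[OF this, of v]
    show "((\<lambda>h. pd vs f (y + h *\<^sub>R v)) has_vector_derivative pd (v # vs) f y) (at 0)"
      by (simp add: vector_derivative_at)
  qed
qed

lemma Cinf_onI: "open S \<Longrightarrow> (\<And>n. Ck n S f) \<Longrightarrow> Cinf_on S f"
  by (simp add: Cinf_on_iff_Ck)

lemma Cinf_on_pd: "Cinf_on S f \<Longrightarrow> Cinf_on S (pd vs f)"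
  using Ck_pd by (auto simp: Cinf_on_iff_Ck)

lemma Cinf_on_has_derivative:
  assumes "Cinf_on S f" "x \<in> S"
  shows "(f has_derivative (\<lambda>v. pd [v] f x)) (at x)"
proof -
  have d: "(f has_derivative (\<lambda>h. \<Sum>b\<in>Basis. (h \<bullet> b) *\<^sub>R pd [b] f x)) (at x)"
    using Cinf_on_has_derivative_Basis[OF assms] .
  have "(\<Sum>b\<in>Basis. (v \<bullet> b) *\<^sub>R pd [b] f x) = pd [v] f x" for v
    using has_derivative_dir[OF d, of v] by (simp add: vector_derivative_at)
  with d show ?thesis by simp
qed

lemma Cinf_on_dir:
  assumes "Cinf_on S f" "x \<in> S"
  shows "((\<lambda>h. f (x + h *\<^sub>R v)) has_vector_derivative pd [v] f x) (at 0)"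
  using has_derivative_dir[OF Cinf_on_has_derivative[OF assms]] .

lemma Cinf_on_has_vector_derivative:
  fixes f :: "real \<Rightarrow> 'b::real_normed_vector"
  assumes "Cinf_on S f" "x \<in> S"
  shows "(f has_vector_derivative pd [1] f x) (at x)"
proof -
  note d = Cinf_on_has_derivative[OF assms]
  have "(\<lambda>v. pd [v] f x) = (\<lambda>h. h *\<^sub>R pd [1] f x)"
    using linear_cmul[OF has_derivative_linear[OF d], of _ 1] by auto
  with d show ?thesis by (simp add: has_vector_derivative_def)
qed

section \<open>Closure properties of smooth maps\<close>

lemma Cinf_on_cong:
  assumes "Cinf_on S f" "\<And>x. x \<in> S \<Longrightarrow> f x = g x"
  shows "Cinf_on S g"
  using assms Ck_cong[of _ S f g] by (auto simp: Cinf_on_iff_Ck)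

lemma Cinf_on_subset: "Cinf_on S f \<Longrightarrow> open T \<Longrightarrow> T \<subseteq> S \<Longrightarrow> Cinf_on T f"
  using Ck_subset unfolding Cinf_on_iff_Ck by blast

lemma Cinf_on_local:
  assumes "\<And>x. x \<in> S \<Longrightarrow> \<exists>T. x \<in> T \<and> Cinf_on T f" "open S"
  shows "Cinf_on S f"
proof (rule Cinf_onI[OF assms(2)], rule Ck_local)
  show "\<exists>T. open T \<and> x \<in> T \<and> Ck n T f" if "x \<in> S" for x n
    using assms(1)[OF that] Cinf_on_iff_Ck by blast
qed

lemma Cinf_on_const: "open S \<Longrightarrow> Cinf_on S (\<lambda>x. c)"
  by (simp add: Cinf_on_iff_Ck Ck_const)

lemma Cinf_on_linear: "bounded_linear L \<Longrightarrow> open S \<Longrightarrow> Cinf_on S L"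
  by (simp add: Cinf_on_iff_Ck Ck_linear)

lemma Cinf_on_ident: "open S \<Longrightarrow> Cinf_on S (\<lambda>x. x)"
  by (rule Cinf_on_linear[OF bounded_linear_ident])

lemma Cinf_on_add: "Cinf_on S f \<Longrightarrow> Cinf_on S g \<Longrightarrow> Cinf_on S (\<lambda>x. f x + g x)"
  by (simp add: Cinf_on_iff_Ck Ck_add)

lemma Cinf_on_bilinear: "bounded_bilinear B \<Longrightarrow> Cinf_on S f \<Longrightarrow> Cinf_on S g \<Longrightarrow> Cinf_on S (\<lambda>x. B (f x) (g x))"
  by (simp add: Cinf_on_iff_Ck Ck_bilinear)

lemma Cinf_on_linear_compose: "bounded_linear L \<Longrightarrow> Cinf_on S f \<Longrightarrow> Cinf_on S (\<lambda>x. L (f x))"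
  by (simp add: Cinf_on_iff_Ck Ck_bounded_linear_compose)

lemma Cinf_on_compose:
  fixes f :: "'a::euclidean_space \<Rightarrow> 'b::euclidean_space" and g :: "'b \<Rightarrow> 'c::real_normed_vector"
  shows "Cinf_on S f \<Longrightarrow> Cinf_on T g \<Longrightarrow> (\<And>x. x \<in> S \<Longrightarrow> f x \<in> T) \<Longrightarrow> Cinf_on S (\<lambda>x. g (f x))"
  using Ck_compose[of _ S f T g] unfolding Cinf_on_iff_Ck by (simp add: image_subset_iff)

lemmas Cinf_on_scaleR = Cinf_on_bilinear[OF bounded_bilinear_scaleR]
lemmas Cinf_on_mult = Cinf_on_bilinear[OF bounded_bilinear_mult]
lemmas Cinf_on_inner = Cinf_on_bilinear[OF bounded_bilinear_inner]
lemmas Cinf_on_fst = Cinf_on_linear_compose[OF bounded_linear_fst]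
lemmas Cinf_on_snd = Cinf_on_linear_compose[OF bounded_linear_snd]
lemmas Cinf_on_of_real = Cinf_on_linear_compose[OF bounded_linear_of_real]
lemmas Cinf_on_minus = Cinf_on_linear_compose[OF bounded_linear_minus[OF bounded_linear_ident]]

lemma Cinf_on_diff: "Cinf_on S f \<Longrightarrow> Cinf_on S g \<Longrightarrow> Cinf_on S (\<lambda>x. f x - g x)"
  using Cinf_on_add[OF _ Cinf_on_minus, of S f g] by simp

lemma Cinf_on_sum: "(\<And>i. i \<in> I \<Longrightarrow> Cinf_on S (f i)) \<Longrightarrow> open S \<Longrightarrow> Cinf_on S (\<lambda>x. \<Sum>i\<in>I. f i x)"
  by (simp add: Cinf_on_iff_Ck Ck_sum)

lemma Cinf_on_Pair:
  fixes f :: "'a::euclidean_space \<Rightarrow> 'b::euclidean_space" and g :: "'a \<Rightarrow> 'c::euclidean_space"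
  assumes "Cinf_on S f" "Cinf_on S g"
  shows "Cinf_on S (\<lambda>x. (f x, g x))"
proof -
  have "Cinf_on S (\<lambda>x. (f x, 0) + (0, g x))"
    by (intro Cinf_on_add Cinf_on_linear_compose[of "\<lambda>x. (x, 0)"] Cinf_on_linear_compose[of "\<lambda>x. (0, x)"] assms
        bounded_linear_Pair bounded_linear_ident bounded_linear_zero)
  then show ?thesis by simp
qed

lemmas Cinf_intros = Cinf_on_Pair Cinf_on_add Cinf_on_diff Cinf_on_minus Cinf_on_scaleR Cinf_on_mult Cinf_on_inner
  Cinf_on_fst Cinf_on_snd Cinf_on_of_real Cinf_on_ident Cinf_on_const

lemma Cinf_on_pow: "Cinf_on S f \<Longrightarrow> Cinf_on S (\<lambda>x. (f x ^ k :: real))"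
  by (induction k) (auto intro: Cinf_on_mult Cinf_on_const Cinf_on_open)

text \<open>Differentiate the fundamental theorem of calculus for the inner variable under the integral sign.\<close>

lemma pd_commute:
  fixes f :: "'a::euclidean_space \<Rightarrow> 'b::banach"
  assumes f: "smooth f"
  shows "pd [v, w] f y = pd [w, v] f y"
proof -
  have D: "((\<lambda>h. g (z + h *\<^sub>R u)) has_vector_derivative pd [u] g (z + t *\<^sub>R u)) (at t)" if "smooth g" for g :: "'a \<Rightarrow> 'b" and z u t
  proof -
    have "((\<lambda>h. g ((z + t *\<^sub>R u) + h *\<^sub>R u)) has_vector_derivative pd [u] g (z + t *\<^sub>R u)) (at 0)"
      by (rule Cinf_on_dir[OF that]) simp
    then have "((\<lambda>r. g (z + t *\<^sub>R u + (r - t) *\<^sub>R u)) has_vector_derivative 1 *\<^sub>R pd [u] g (z + t *\<^sub>R u)) (at t)"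
      by (intro vector_diff_chain_at[of "\<lambda>r. r - t" 1 t "\<lambda>h. g (z + t *\<^sub>R u + h *\<^sub>R u)", unfolded o_def])
        (auto intro!: derivative_eq_intros)
    then show ?thesis by (simp add: algebra_simps)
  qed
  have cont: "continuous_on T (pd us f)" for T us
    using Cinf_on_imp_continuous_on[OF Cinf_on_pd[OF f]] continuous_on_subset by blast
  have ftc: "((\<lambda>r. pd [w] f (y + s *\<^sub>R v + r *\<^sub>R w)) has_integral f (y + s *\<^sub>R v + t *\<^sub>R w) - f (y + s *\<^sub>R v)) {0..t}"
    if "t \<ge> 0" for s t :: real
    using fundamental_theorem_of_calculus[OF that, of "\<lambda>r. f (y + s *\<^sub>R v + r *\<^sub>R w)" "\<lambda>r. pd [w] f (y + s *\<^sub>R v + r *\<^sub>R w)"]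
      D[OF f] has_vector_derivative_at_within by fastforce
  have eq: "pd [v] f (y + t *\<^sub>R w) - pd [v] f y = integral {0..t} (\<lambda>r. pd [v, w] f (y + r *\<^sub>R w))" if t: "t \<ge> 0" for t
  proof -
    have "((\<lambda>s. integral (cbox 0 t) (\<lambda>r. pd [w] f (y + r *\<^sub>R w + s *\<^sub>R v))) has_vector_derivative
        integral (cbox 0 t) (\<lambda>r. pd [v] (pd [w] f) (y + r *\<^sub>R w + 0 *\<^sub>R v))) (at 0 within UNIV)"
    proof (rule leibniz_rule_vector_derivative)
      show "((\<lambda>s. pd [w] f (y + r *\<^sub>R w + s *\<^sub>R v)) has_vector_derivative pd [v] (pd [w] f) (y + r *\<^sub>R w + s *\<^sub>R v)) (at s within UNIV)"
        for s r by (rule D[OF Cinf_on_pd[OF f]])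
      show "(\<lambda>r. pd [w] f (y + r *\<^sub>R w + s *\<^sub>R v)) integrable_on cbox 0 t" for s
        by (intro integrable_continuous continuous_on_compose2[OF cont[of UNIV]] continuous_intros) auto
      show "continuous_on (UNIV \<times> cbox 0 t) (\<lambda>(s, r). pd [v] (pd [w] f) (y + r *\<^sub>R w + s *\<^sub>R v))"
        unfolding split_beta pd_append[symmetric]
        by (intro continuous_on_compose2[OF cont[of UNIV]] continuous_intros) auto
    qed auto
    moreover have "integral (cbox 0 t) (\<lambda>r. pd [w] f (y + r *\<^sub>R w + s *\<^sub>R v)) = f (y + t *\<^sub>R w + s *\<^sub>R v) - f (y + s *\<^sub>R v)" for s
      using integral_unique[OF ftc[OF t, of s]] by (simp add: algebra_simps)
    ultimately have "((\<lambda>s. f (y + t *\<^sub>R w + s *\<^sub>R v) - f (y + s *\<^sub>R v)) has_vector_derivative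
        integral {0..t} (\<lambda>r. pd [v, w] f (y + r *\<^sub>R w))) (at 0)" by simp
    moreover have "((\<lambda>s. f (y + t *\<^sub>R w + s *\<^sub>R v) - f (y + s *\<^sub>R v)) has_vector_derivative
        pd [v] f (y + t *\<^sub>R w) - pd [v] f y) (at 0)"
      by (intro has_vector_derivative_diff Cinf_on_dir[OF f]) auto
    ultimately show ?thesis by (rule vector_derivative_unique_at[symmetric])
  qed
  \<comment> \<open>The integral representation is available for nonnegative t only, so the two
    derivatives at 0 are compared within {0..1}.\<close>
  have "((\<lambda>t. integral {0..t} (\<lambda>r. pd [v, w] f (y + r *\<^sub>R w))) has_vector_derivative pd [v, w] f (y + 0 *\<^sub>R w)) (at 0 within {0..1})"
    by (rule integral_has_vector_derivative) (auto intro!: continuous_on_compose2[OF cont[of UNIV]] continuous_intros simp del: pd.simps)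
  then have 1: "((\<lambda>t. pd [v] f (y + t *\<^sub>R w) - pd [v] f y) has_vector_derivative pd [v, w] f y) (at 0 within {0..1})"
    by (intro has_vector_derivative_transform[of 0 "{0..1}" "\<lambda>t. pd [v] f (y + t *\<^sub>R w) - pd [v] f y"
          "\<lambda>t. integral {0..t} (\<lambda>r. pd [v, w] f (y + r *\<^sub>R w))"]) (auto simp: eq simp del: pd.simps)
  have "((\<lambda>t. pd [v] f (y + t *\<^sub>R w) - pd [v] f y) has_vector_derivative pd [w] (pd [v] f) y - 0) (at 0)"
    by (intro has_vector_derivative_diff Cinf_on_dir[OF Cinf_on_pd[OF f]] has_vector_derivative_const) auto
  then have 2: "((\<lambda>t. pd [v] f (y + t *\<^sub>R w) - pd [v] f y) has_vector_derivative pd [w, v] f y) (at 0 within {0..1})"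
    by (simp add: has_vector_derivative_at_within del: pd.simps flip: pd_append)
  show ?thesis
    using vector_derivative_unique_within[OF _ 1 2] by (simp add: trivial_limit_within islimpt_Icc)
qed

text \<open>Each partial derivative in y moves under the integral and yields an integral of the same
  form, so induction on the order works once g is generalised. It makes the Hadamard quotients below
  smooth at the point 0 as well.\<close>

lemma Cinf_on_integral:
  fixes g :: "real \<times> 'a::euclidean_space \<Rightarrow> 'b::banach"
  assumes "smooth g"
  shows "smooth (\<lambda>y. integral {0..1} (\<lambda>u. g (u, y)))"
proof (rule Cinf_onI)
  have cont: "continuous_on T (\<lambda>(y, u). h (u, y))" if "smooth h" for h :: "real \<times> 'a \<Rightarrow> 'b" and T
    unfolding split_beta
    by (intro continuous_on_compose2[OF Cinf_on_imp_continuous_on[OF that]] continuous_intros) auto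
  have ci: "continuous_on UNIV (\<lambda>y. integral {0..1} (\<lambda>u. h (u, y)))" if "smooth h" for h :: "real \<times> 'a \<Rightarrow> 'b"
    using integral_continuous_on_param[OF cont[OF that], of UNIV 0 1] by simp
  show "Ck n UNIV (\<lambda>y. integral {0..1} (\<lambda>u. g (u, y)))" for n
    using assms
  proof (induction n arbitrary: g)
    case 0 then show ?case by (simp add: ci)
  next
    case (Suc n)
    note g = Suc.prems
    show ?case
    proof (rule Ck_SucI[of UNIV _ "\<lambda>y v. \<Sum>b\<in>Basis. (v \<bullet> b) *\<^sub>R integral {0..1} (\<lambda>u. pd [(0, b)] g (u, y))"])
      show "((\<lambda>y. integral {0..1} (\<lambda>u. g (u, y))) has_derivative (\<lambda>v. \<Sum>b\<in>Basis. (v \<bullet> b) *\<^sub>R integral {0..1} (\<lambda>u. pd [(0, b)] g (u, y)))) (at y)" for y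
      proof (rule has_derivative_continuous_partials[of UNIV y _ "\<lambda>b y. integral {0..1} (\<lambda>u. pd [(0, b)] g (u, y))"])
        show "continuous_on UNIV (\<lambda>y. integral {0..1} (\<lambda>u. pd [(0, b)] g (u, y)))" for b
          by (intro ci Cinf_on_pd g)
        fix b y :: 'a
        have "((\<lambda>h. integral (cbox 0 1) (\<lambda>u. g (u, y + h *\<^sub>R b))) has_vector_derivative
           integral (cbox 0 1) (\<lambda>u. pd [(0, b)] g (u, y + 0 *\<^sub>R b))) (at 0 within UNIV)"
        proof (rule leibniz_rule_vector_derivative[where fx = "\<lambda>h u. pd [(0, b)] g (u, y + h *\<^sub>R b)"])
          fix h u :: real
          have "((\<lambda>r. g ((u, y + h *\<^sub>R b) + r *\<^sub>R (0, b))) has_vector_derivative pd [(0, b)] g (u, y + h *\<^sub>R b)) (at 0)"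
            by (rule Cinf_on_dir[OF g]) simp
          then have "((\<lambda>r. g ((u, y + h *\<^sub>R b) + (r - h) *\<^sub>R (0, b))) has_vector_derivative 1 *\<^sub>R pd [(0, b)] g (u, y + h *\<^sub>R b)) (at h)"
            by (intro vector_diff_chain_at[of "\<lambda>r. r - h" 1 h "\<lambda>r. g ((u, y + h *\<^sub>R b) + r *\<^sub>R (0, b))", unfolded o_def])
              (auto intro!: derivative_eq_intros)
          then show "((\<lambda>h. g (u, y + h *\<^sub>R b)) has_vector_derivative pd [(0, b)] g (u, y + h *\<^sub>R b)) (at h within UNIV)"
            by (simp add: algebra_simps)
        next
          show "(\<lambda>u. g (u, y + h *\<^sub>R b)) integrable_on cbox 0 1" for h
            by (intro integrable_continuous continuous_on_compose2[OF Cinf_on_imp_continuous_on[OF g]] continuous_intros) auto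
          show "continuous_on (UNIV \<times> cbox 0 1) (\<lambda>(h, u). pd [(0, b)] g (u, y + h *\<^sub>R b))"
            unfolding split_beta
            by (intro continuous_on_compose2[OF Cinf_on_imp_continuous_on[OF Cinf_on_pd[OF g]]] continuous_intros) auto
        qed auto
        then show "((\<lambda>h. integral {0..1} (\<lambda>u. g (u, y + h *\<^sub>R b))) has_vector_derivative
           integral {0..1} (\<lambda>u. pd [(0, b)] g (u, y))) (at 0)" by simp
      qed auto
      show "Ck n UNIV (\<lambda>y. \<Sum>b\<in>Basis. (v \<bullet> b) *\<^sub>R integral {0..1} (\<lambda>u. pd [(0, b)] g (u, y)))" for v
        by (intro Ck_sum Ck_bounded_linear_compose[OF bounded_linear_scaleR_right] Suc.IH Cinf_on_pd g)
    qed
  qed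
qed simp

section \<open>Cutoff functions and smooth series\<close>

text \<open>The pole orders k make the family closed under differentiation: the derivative of
  \<open>flat k\<close> is a combination of \<open>flat (k + 2)\<close> and
  \<open>flat (k + 1)\<close>, so one induction shows that all members are smooth.\<close>

definition flat :: "nat \<Rightarrow> real \<Rightarrow> real" where
  "flat k x = (if x > 0 then exp (- 1 / x) / x ^ k else 0)"

lemma flat_limit: "((\<lambda>x. flat k x) \<longlongrightarrow> 0) (at_right 0)"
proof -
  have "((\<lambda>y::real. y ^ k / exp y) \<longlongrightarrow> 0) at_top" by (rule tendsto_power_div_exp_0)
  then have "((\<lambda>x. inverse x ^ k / exp (inverse x)) \<longlongrightarrow> 0) (at_right (0::real))"
    by (rule filterlim_compose) (rule filterlim_inverse_at_top_right)
  moreover have "eventually (\<lambda>x::real. inverse x ^ k / exp (inverse x) = flat k x) (at_right 0)"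
    by (auto simp: eventually_at_filter flat_def exp_minus divide_simps power_inverse)
  ultimately show ?thesis by (rule Lim_transform_eventually)
qed

lemma flat_deriv: "(flat k has_vector_derivative (flat (k + 2) x - real k * flat (k + 1) x)) (at x)"
proof -
  consider "x > 0" | "x < 0" | "x = 0" by linarith
  then show ?thesis
  proof cases
    case 1
    have "((\<lambda>x. exp (- 1 / x) / x ^ k) has_real_derivative
       (exp (- 1 / x) * (1 / x^2) * x ^ k - exp (- 1 / x) * (real k * x ^ (k - 1))) / (x ^ k)^2) (at x)"
      using 1 by (auto intro!: derivative_eq_intros simp: power2_eq_square)
    also have "(exp (- 1 / x) * (1 / x^2) * x ^ k - exp (- 1 / x) * (real k * x ^ (k - 1))) / (x ^ k)^2
       = flat (k + 2) x - real k * flat (k + 1) x"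
      using 1 by (cases k) (auto simp: flat_def field_simps power2_eq_square)
    finally have "((\<lambda>x. exp (- 1 / x) / x ^ k) has_vector_derivative (flat (k + 2) x - real k * flat (k + 1) x)) (at x)"
      by (simp add: has_real_derivative_iff_has_vector_derivative)
    then show ?thesis
      by (rule has_vector_derivative_transform_within_open[of _ _ _ "{0<..}"]) (use 1 in \<open>auto simp: flat_def\<close>)
  next
    case 2
    have "((\<lambda>x. 0::real) has_vector_derivative 0) (at x)" by simp
    then have "(flat k has_vector_derivative 0) (at x)"
      by (rule has_vector_derivative_transform_within_open[of _ _ _ "{..<0}"]) (use 2 in \<open>auto simp: flat_def\<close>)
    then show ?thesis using 2 by (simp add: flat_def)
  next
    case 3
    \<comment> \<open>To the right of 0 the difference quotient of \<open>flat k\<close> is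
      \<open>flat (Suc k)\<close>, so the limit already computed applies.\<close>
    have r: "((\<lambda>h. flat k h / h) \<longlongrightarrow> 0) (at_right 0)"
      by (rule Lim_transform_eventually[OF flat_limit[of "Suc k"]])
        (auto simp: eventually_at_filter flat_def mult.commute)
    have l: "((\<lambda>h. flat k h / h) \<longlongrightarrow> 0) (at_left 0)"
      by (rule Lim_transform_eventually[OF tendsto_const]) (auto simp: eventually_at_filter flat_def)
    have "((\<lambda>h. flat k h / h) \<longlongrightarrow> 0) (at 0)" using r l filterlim_at_split by blast
    then have "(flat k has_real_derivative 0) (at 0)"
      by (simp add: has_field_derivative_iff flat_def)
    then show ?thesis using 3 by (simp add: flat_def has_real_derivative_iff_has_vector_derivative)
  qed
qed

lemma Cinf_flat: "smooth (flat k)"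
proof (rule Cinf_onI)
  show "Ck n UNIV (flat k)" for n
  proof (induction n arbitrary: k)
    case 0 show ?case using flat_deriv[of k] 
      by (auto intro!: continuous_at_imp_continuous_on has_vector_derivative_continuous)
  next
    case (Suc n)
    show ?case
    proof (rule Ck_SucI)
      show "(flat k has_derivative (\<lambda>h. h *\<^sub>R (flat (k + 2) x - real k * flat (k + 1) x))) (at x)" for x
        using flat_deriv[of k x] by (simp add: has_vector_derivative_def)
      have "Ck n UNIV (\<lambda>x. flat (k + 2) x + (- real k) *\<^sub>R flat (k + 1) x)"
        by (intro Ck_add Ck_bounded_linear_compose[OF bounded_linear_scaleR_right] Suc)
      then show "Ck n UNIV (\<lambda>x. v *\<^sub>R (flat (k + 2) x - real k * flat (k + 1) x))" for v
        by (intro Ck_bounded_linear_compose[OF bounded_linear_scaleR_right]) simp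
    qed
  qed
qed simp

lemma Cinf_on_inverse: "Cinf_on (-{0}) (inverse :: real \<Rightarrow> real)"
proof (rule Cinf_onI)
  show "Ck n (-{0}) (inverse :: real \<Rightarrow> real)" for n
  proof (induction n)
    case 0 then show ?case by (auto intro!: continuous_intros)
  next
    case (Suc n)
    show ?case
      by (rule Ck_SucI[of _ _ "\<lambda>x h. - (inverse x * h * inverse x)"])
        (auto intro!: has_derivative_inverse' Ck_bounded_linear_compose[OF bounded_linear_minus[OF bounded_linear_ident]]
          Ck_bilinear[OF bounded_bilinear_mult] Suc Ck_const)
  qed
qed auto

text \<open>The usual quotient of flat functions. The two arguments add up to 1, so one of them is
  positive and the denominator never vanishes; the numerator is 0 once 4 t^2 is at least 2. All
  later windows are computed from the value 1 for |t| \<le> 1/2 and 0 for |t| \<ge> 3/4.\<close>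

definition cutoff :: "real \<Rightarrow> real" where
  "cutoff t = flat 0 (2 - 4 * t^2) * inverse (flat 0 (2 - 4 * t^2) + flat 0 (4 * t^2 - 1))"

lemma flat_pos: "x > 0 \<Longrightarrow> flat k x > 0" and flat_nonneg: "flat k x \<ge> 0"
  by (auto simp: flat_def)

lemma flat_denom: "flat 0 (2 - 4 * t^2) + flat 0 (4 * t^2 - 1) > 0"
proof (cases "2 - 4 * t^2 > 0")
  case True then show ?thesis using flat_pos[of "2 - 4 * t^2" 0] flat_nonneg[of 0 "4 * t^2 - 1"] by linarith
next
  case False then show ?thesis using flat_pos[of "4 * t^2 - 1" 0] flat_nonneg[of 0 "2 - 4 * t^2"] by linarith
qed

lemma Cinf_cutoff: "smooth cutoff"
proof -
  have q: "smooth (\<lambda>t::real. 2 - 4 * t^2)" "smooth (\<lambda>t::real. 4 * t^2 - 1)"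
    by (intro Cinf_intros Cinf_on_pow open_UNIV)+
  have f: "smooth (\<lambda>t. flat 0 (2 - 4 * t^2))" "smooth (\<lambda>t. flat 0 (4 * t^2 - 1))"
    using q[THEN Cinf_on_compose, OF Cinf_flat] by auto
  have "smooth (\<lambda>t. inverse (flat 0 (2 - 4 * t^2) + flat 0 (4 * t^2 - 1)))"
    by (rule Cinf_on_compose[OF Cinf_on_add[OF f] Cinf_on_inverse]) (use flat_denom in \<open>simp add: less_imp_neq[symmetric]\<close>)
  from Cinf_on_mult[OF f(1) this] show ?thesis unfolding cutoff_def .
qed

lemma cutoff_eq_1: "\<bar>t\<bar> \<le> 1/2 \<Longrightarrow> cutoff t = 1"
proof -
  assume "\<bar>t\<bar> \<le> 1/2"
  then have "\<bar>t\<bar>^2 \<le> (1/2)^2" by (intro power_mono) auto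
  then have "4 * t^2 \<le> 1" by (simp add: power2_eq_square)
  then have "flat 0 (4 * t^2 - 1) = 0" "flat 0 (2 - 4 * t^2) > 0" by (auto simp: flat_def)
  then show ?thesis by (simp add: cutoff_def)
qed

lemma cutoff_eq_0: "\<bar>t\<bar> \<ge> 3/4 \<Longrightarrow> cutoff t = 0"
proof -
  assume "\<bar>t\<bar> \<ge> 3/4"
  then have "(3/4)^2 \<le> \<bar>t\<bar>^2" by (intro power_mono) auto
  then have "2 - 4 * t^2 \<le> 0" by (simp add: power2_eq_square)
  then show ?thesis by (simp add: cutoff_def flat_def)
qed

lemma cutoff_nonneg: "0 \<le> cutoff t" and cutoff_le_1: "cutoff t \<le> 1"
  using flat_denom[of t] flat_nonneg[of 0] by (auto simp: cutoff_def field_simps)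

lemma Cinf_on_bounded_derivs:
  fixes f :: "real \<Rightarrow> real"
  assumes f: "smooth f" and supp: "\<And>t. \<bar>t\<bar> \<ge> 3/4 \<Longrightarrow> f t = 0"
  shows "\<exists>C. \<forall>t. \<bar>pd vs f t\<bar> \<le> C"
proof -
  have "compact (pd vs f ` {-1..1})"
    by (intro compact_continuous_image continuous_on_subset[OF Cinf_on_imp_continuous_on[OF Cinf_on_pd[OF f]]]) auto
  then obtain C where C: "\<And>t. t \<in> {-1..1} \<Longrightarrow> norm (pd vs f t) \<le> C"
    by (meson bounded_iff compact_imp_bounded imageI)
  have z: "pd vs f t = 0" if "\<bar>t\<bar> > 3/4" for t
  proof -
    have "pd vs f t = pd vs (\<lambda>t. 0) t"
    proof (rule pd_cong_on[of "{t. \<bar>t\<bar> > 3/4}"])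
      show "open {t::real. \<bar>t\<bar> > 3/4}" by (intro open_Collect_less continuous_intros)
    qed (use that supp in auto)
    also have "pd vs (\<lambda>t::real. 0::real) = (\<lambda>t. 0)" by (induction vs) auto
    finally show ?thesis by simp
  qed
  have "\<bar>pd vs f t\<bar> \<le> max C 0" for t
    using C[of t] z[of t] by (cases "t \<in> {-1..1}") auto
  then show ?thesis by blast
qed

text \<open>The Weierstrass test is applied separately to every order of differentiation; g k m
  stands for the m-th derivative of the k-th summand.\<close>

lemma Cinf_on_series:
  fixes g :: "nat \<Rightarrow> nat \<Rightarrow> real \<Rightarrow> real"
  assumes d: "\<And>k m t. (g k m has_real_derivative g k (Suc m) t) (at t)"
    and M: "\<And>k m t. \<bar>g k m t\<bar> \<le> M m k" and s: "\<And>m. summable (M m)"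
  shows "smooth (\<lambda>t. \<Sum>k. g k m t)"
proof (rule Cinf_onI)
  have D: "((\<lambda>t. \<Sum>k. g k m t) has_real_derivative (\<Sum>k. g k (Suc m) t)) (at t)" for m t
  proof (rule has_field_derivative_series'(2)[of UNIV "\<lambda>k. g k m"])
    show "uniformly_convergent_on UNIV (\<lambda>n x. \<Sum>i<n. g i (Suc m) x)"
      by (rule Weierstrass_m_test'[of _ _ "M (Suc m)"]) (use M s in auto)
    show "summable (\<lambda>n. g n m 0)"
      by (rule summable_comparison_test'[OF s[of m]]) (use M in auto)
  qed (use d in auto)
  show "Ck n UNIV (\<lambda>t. \<Sum>k. g k m t)" for n
  proof (induction n arbitrary: m)
    case 0 show ?case using D[of m] by (auto intro!: DERIV_continuous_on)
  next
    case (Suc n)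
    show ?case
      by (rule Ck_SucI[of _ _ "\<lambda>t h. (\<Sum>k. g k (Suc m) t) * h"])
        (use D[of m] Suc in \<open>auto simp: has_field_derivative_def intro!: Ck_bilinear[OF bounded_bilinear_mult] Ck_const\<close>)
  qed
qed simp

section \<open>Boman's theorem in the plane\<close>

abbreviation (input) derivative_sequence :: "(nat \<Rightarrow> real \<Rightarrow> real) \<Rightarrow> bool" where
  "derivative_sequence g \<equiv> \<forall>m t. (g m has_real_derivative g (Suc m) t) (at t)"

text \<open>Each outer third of the interval contains a point where the k-th derivative is small.
  The two points are at least delta / 3 apart, so the mean value theorem between them costs a factor
  3 / delta, and the difference of the two values a factor 2; this is the recursion for the
  constant.\<close>

lemma mvt_abs_point:
  "\<exists>C>0. \<forall>(g::nat \<Rightarrow> real \<Rightarrow> real) a \<delta> A. \<delta> > 0 \<longrightarrow> derivative_sequence g \<longrightarrow>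
     (\<forall>t\<in>{a..a+\<delta>}. \<bar>g 0 t\<bar> \<le> A) \<longrightarrow> (\<exists>\<xi>\<in>{a..a+\<delta>}. \<bar>g k \<xi>\<bar> \<le> C * A / \<delta> ^ k)"
proof (induction k)
  case 0 
  show ?case by (rule exI[of _ 1]) (auto intro!: bexI[of _ a for a])
next
  case (Suc k)
  then obtain C where C: "C > 0" and IH: "\<And>(g::nat \<Rightarrow> real \<Rightarrow> real) a \<delta> A. \<delta> > 0 \<Longrightarrow> derivative_sequence g \<Longrightarrow>
     (\<forall>t\<in>{a..a+\<delta>}. \<bar>g 0 t\<bar> \<le> A) \<Longrightarrow> (\<exists>\<xi>\<in>{a..a+\<delta>}. \<bar>g k \<xi>\<bar> \<le> C * A / \<delta> ^ k)" by blast
  show ?case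
  proof (rule exI[of _ "2 * C * 3 ^ Suc k"], intro conjI allI impI)
    show "0 < 2 * C * 3 ^ Suc k" using C by simp
    fix g :: "nat \<Rightarrow> real \<Rightarrow> real" and a \<delta> A :: real
    assume d: "\<delta> > 0" and g: "derivative_sequence g" and A: "\<forall>t\<in>{a..a+\<delta>}. \<bar>g 0 t\<bar> \<le> A"
    have "\<exists>\<xi>\<in>{a..a+\<delta>/3}. \<bar>g k \<xi>\<bar> \<le> C * A / (\<delta>/3) ^ k" by (rule IH) (use d g A in auto)
    then obtain x where x: "x \<in> {a..a+\<delta>/3}" "\<bar>g k x\<bar> \<le> C * A / (\<delta>/3) ^ k" by blast
    have "\<exists>\<xi>\<in>{a+2*\<delta>/3..a+2*\<delta>/3+\<delta>/3}. \<bar>g k \<xi>\<bar> \<le> C * A / (\<delta>/3) ^ k" by (rule IH) (use d g A in auto)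
    then obtain y where y: "y \<in> {a+2*\<delta>/3..a+2*\<delta>/3+\<delta>/3}" "\<bar>g k y\<bar> \<le> C * A / (\<delta>/3) ^ k" by blast
    have xy: "x < y" "y - x \<ge> \<delta> / 3" using x y d by auto
    obtain z where z: "x < z" "z < y" "g k y - g k x = (y - x) * g (Suc k) z"
      using MVT2[OF xy(1), of "g k" "g (Suc k)"] g by blast
    have "\<bar>g k y - g k x\<bar> \<le> 2 * C * A / (\<delta>/3) ^ k" using x y by linarith
    then have "(y - x) * \<bar>g (Suc k) z\<bar> \<le> 2 * C * A / (\<delta>/3) ^ k" using z(3) xy by (simp add: abs_mult)
    moreover have "\<delta> / 3 * \<bar>g (Suc k) z\<bar> \<le> (y - x) * \<bar>g (Suc k) z\<bar>" using xy by (intro mult_right_mono) auto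
    ultimately have "\<delta> / 3 * \<bar>g (Suc k) z\<bar> \<le> 2 * C * A / (\<delta>/3) ^ k" by linarith
    then have "\<bar>g (Suc k) z\<bar> \<le> 2 * C * A / (\<delta>/3) ^ k / (\<delta>/3)" using d by (simp add: field_simps)
    also have "\<dots> = 2 * C * 3 ^ Suc k * A / \<delta> ^ Suc k" using d by (simp add: field_simps power_divide)
    finally show "\<exists>\<xi>\<in>{a..a+\<delta>}. \<bar>g (Suc k) \<xi>\<bar> \<le> 2 * C * 3 ^ Suc k * A / \<delta> ^ Suc k"
      using z x y by (intro bexI[of _ z]) auto
  qed
qed

text \<open>\<open>mvt_abs_point\<close> gives one point where the n-th derivative is at most C1 A /
  delta^n, and the bound B on the next derivative spreads this over the interval with an error B
  delta. The induction hypothesis then handles the lower orders.\<close>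

lemma landau_inequality:
  "\<exists>C>0. \<forall>(g::nat \<Rightarrow> real \<Rightarrow> real) a \<delta> A B. \<delta> > 0 \<longrightarrow> derivative_sequence g \<longrightarrow>
     (\<forall>t\<in>{a..a+\<delta>}. \<bar>g 0 t\<bar> \<le> A) \<longrightarrow> (\<forall>t\<in>{a..a+\<delta>}. \<bar>g n t\<bar> \<le> B) \<longrightarrow>
     (\<forall>j\<le>n. \<forall>t\<in>{a..a+\<delta>}. \<bar>g j t\<bar> \<le> C * (A / \<delta> ^ j + B * \<delta> ^ (n - j)))"
proof (induction n)
  case 0
  show ?case
  proof (rule exI[of _ 1], intro conjI allI impI ballI)
    fix g :: "nat \<Rightarrow> real \<Rightarrow> real" and a \<delta> A B t :: real and j :: nat
    assume A: "\<forall>t\<in>{a..a+\<delta>}. \<bar>g 0 t\<bar> \<le> A" and B: "\<forall>t\<in>{a..a+\<delta>}. \<bar>g 0 t\<bar> \<le> B" and j: "j \<le> 0"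
      and t: "t \<in> {a..a+\<delta>}"
    have "\<bar>g 0 t\<bar> \<le> A" "\<bar>g 0 t\<bar> \<le> B" using A B t by blast+
    then have "\<bar>g 0 t\<bar> \<le> A + B" by linarith
    with j show "\<bar>g j t\<bar> \<le> 1 * (A / \<delta> ^ j + B * \<delta> ^ (0 - j))" by simp
  qed simp
next
  case (Suc n)
  obtain C1 where C1: "C1 > 0" and pt: "\<And>(g::nat \<Rightarrow> real \<Rightarrow> real) a \<delta> A. \<delta> > 0 \<Longrightarrow> derivative_sequence g \<Longrightarrow>
     (\<forall>t\<in>{a..a+\<delta>}. \<bar>g 0 t\<bar> \<le> A) \<Longrightarrow> (\<exists>\<xi>\<in>{a..a+\<delta>}. \<bar>g n \<xi>\<bar> \<le> C1 * A / \<delta> ^ n)"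
    using mvt_abs_point[of n] by blast
  from Suc obtain C where C: "C > 0" and IH: "\<And>(g::nat \<Rightarrow> real \<Rightarrow> real) a \<delta> A B j t. \<delta> > 0 \<Longrightarrow> derivative_sequence g \<Longrightarrow>
     (\<forall>t\<in>{a..a+\<delta>}. \<bar>g 0 t\<bar> \<le> A) \<Longrightarrow> (\<forall>t\<in>{a..a+\<delta>}. \<bar>g n t\<bar> \<le> B) \<Longrightarrow> j \<le> n \<Longrightarrow> t \<in> {a..a+\<delta>} \<Longrightarrow>
      \<bar>g j t\<bar> \<le> C * (A / \<delta> ^ j + B * \<delta> ^ (n - j))" by blast
  show ?case
  proof (rule exI[of _ "C * (1 + C1) + 1"], intro conjI allI impI ballI)
    show "0 < C * (1 + C1) + 1" using C C1 by (simp add: add_pos_pos)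
    fix g :: "nat \<Rightarrow> real \<Rightarrow> real" and a \<delta> A B t :: real and j :: nat
    assume d: "\<delta> > 0" and g: "derivative_sequence g" and A: "\<forall>t\<in>{a..a+\<delta>}. \<bar>g 0 t\<bar> \<le> A"
      and B: "\<forall>t\<in>{a..a+\<delta>}. \<bar>g (Suc n) t\<bar> \<le> B" and j: "j \<le> Suc n" and t: "t \<in> {a..a+\<delta>}"
    have A0: "A \<ge> 0" using A[rule_format, of a] d by auto
    have B0: "B \<ge> 0" using B[rule_format, of a] d by auto
    obtain \<xi> where xi: "\<xi> \<in> {a..a+\<delta>}" "\<bar>g n \<xi>\<bar> \<le> C1 * A / \<delta> ^ n" using pt[OF d g A] by blast
    have B': "\<bar>g n s\<bar> \<le> C1 * A / \<delta> ^ n + B * \<delta>" if s: "s \<in> {a..a+\<delta>}" for s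
    proof -
      have "norm (g n s - g n \<xi>) \<le> B * norm (s - \<xi>)"
        by (rule field_differentiable_bound[of "{a..a+\<delta>}" "g n" "g (Suc n)"])
          (use g B s xi in \<open>auto intro: has_field_derivative_at_within\<close>)
      also have "\<dots> \<le> B * \<delta>" using s xi B0 by (intro mult_left_mono) auto
      finally show ?thesis using xi by simp
    qed
    show "\<bar>g j t\<bar> \<le> (C * (1 + C1) + 1) * (A / \<delta> ^ j + B * \<delta> ^ (Suc n - j))"
    proof (cases "j = Suc n")
      case True
      have p: "0 \<le> A / \<delta> ^ j" using A0 d by simp
      have "\<bar>g j t\<bar> \<le> B" using B t True by auto
      also have "B \<le> 1 * (A / \<delta> ^ j + B * \<delta> ^ (Suc n - j))" using True p by simp
      also have "\<dots> \<le> (C * (1 + C1) + 1) * (A / \<delta> ^ j + B * \<delta> ^ (Suc n - j))"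
        using C C1 p B0 d by (intro mult_right_mono) auto
      finally show ?thesis .
    next
      case False
      then have jn: "j \<le> n" using j by simp
      have "\<bar>g j t\<bar> \<le> C * (A / \<delta> ^ j + (C1 * A / \<delta> ^ n + B * \<delta>) * \<delta> ^ (n - j))"
        by (rule IH[OF d g A _ jn t]) (use B' in auto)
      also have "(C1 * A / \<delta> ^ n + B * \<delta>) * \<delta> ^ (n - j) = C1 * (A / \<delta> ^ j) + B * \<delta> ^ (Suc n - j)"
        using d jn by (simp add: algebra_simps Suc_diff_le power_diff)
      also have "C * (A / \<delta> ^ j + (C1 * (A / \<delta> ^ j) + B * \<delta> ^ (Suc n - j)))
          = C * (1 + C1) * (A / \<delta> ^ j) + C * (B * \<delta> ^ (Suc n - j))" by (simp add: algebra_simps add_divide_distrib)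
      also have "\<dots> \<le> (C * (1 + C1) + 1) * (A / \<delta> ^ j) + (C * (1 + C1) + 1) * (B * \<delta> ^ (Suc n - j))"
        using C C1 A0 B0 d by (intro add_mono mult_right_mono) (auto simp: algebra_simps)
      finally show ?thesis by (simp only: distrib_left)
    qed
  qed
qed

section \<open>Functions of two variables whose pure derivatives are bounded on squares\<close>

definition box_bounded :: "(real \<Rightarrow> real \<Rightarrow> real) \<Rightarrow> bool" where
  "box_bounded p \<longleftrightarrow> (\<forall>r. \<exists>C. \<forall>a b. \<bar>a\<bar> \<le> r \<longrightarrow> \<bar>b\<bar> \<le> r \<longrightarrow> \<bar>p a b\<bar> \<le> C)"

text \<open>p n and q n are the n-th derivatives of F in the first and in the second variable.\<close>

definition pure_smooth :: "(real \<Rightarrow> real \<Rightarrow> real) \<Rightarrow> (nat \<Rightarrow> real \<Rightarrow> real \<Rightarrow> real) \<Rightarrow> (nat \<Rightarrow> real \<Rightarrow> real \<Rightarrow> real) \<Rightarrow> bool" where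
  "pure_smooth F p q \<longleftrightarrow> p 0 = F \<and> q 0 = F \<and>
     (\<forall>n a b. ((\<lambda>a. p n a b) has_real_derivative p (Suc n) a b) (at a)) \<and>
     (\<forall>n a b. ((\<lambda>b. q n a b) has_real_derivative q (Suc n) a b) (at b)) \<and>
     (\<forall>n. box_bounded (p n) \<and> box_bounded (q n))"

lemma box_bounded_swap: "box_bounded p \<Longrightarrow> box_bounded (\<lambda>b a. p a b)"
  unfolding box_bounded_def by blast

lemma pure_smooth_swap: "pure_smooth F p q \<Longrightarrow> pure_smooth (\<lambda>b a. F a b) (\<lambda>n b a. q n a b) (\<lambda>n b a. p n a b)"
  unfolding pure_smooth_def using box_bounded_swap by auto

text \<open>The dyadic difference quotients of \<open>p n\<close> in the second variable converge geometrically: their increments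
  are second differences, of size \<open>O(h^2)\<close> for n = 0 and with bounded derivatives of all orders,
  so the Landau inequality gives \<open>O(h^(3/2))\<close> for every derivative.\<close>

lemma pure_smooth_second_difference:
  assumes F: "pure_smooth F p q"
  shows "\<exists>C. \<forall>a b h. \<bar>a\<bar> \<le> r \<longrightarrow> \<bar>b\<bar> \<le> r \<longrightarrow> 0 < h \<longrightarrow> h \<le> 1 \<longrightarrow>
     \<bar>p n a (b + 2 * h) - 2 * p n a (b + h) + p n a b\<bar> \<le> C * h * sqrt h"
proof -
  \<comment> \<open>With h = delta^(2n+2) both terms of the Landau inequality, h^2 / delta^n and
    delta^(N-n), equal delta^(3n+4) up to constants; this balance fixes N. The result is at most
    delta^(3n+3) = h sqrt h, since delta is at most 1.\<close>
  define N where "N = 4 * n + 4"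
  obtain C where C: "C > 0" and L: "\<And>(g::nat \<Rightarrow> real \<Rightarrow> real) a \<delta> A B j t. \<delta> > 0 \<Longrightarrow> derivative_sequence g \<Longrightarrow>
     (\<forall>t\<in>{a..a+\<delta>}. \<bar>g 0 t\<bar> \<le> A) \<Longrightarrow> (\<forall>t\<in>{a..a+\<delta>}. \<bar>g N t\<bar> \<le> B) \<Longrightarrow> j \<le> N \<Longrightarrow> t \<in> {a..a+\<delta>} \<Longrightarrow>
      \<bar>g j t\<bar> \<le> C * (A / \<delta> ^ j + B * \<delta> ^ (N - j))" using landau_inequality[of N] by blast
  \<comment> \<open>The radius r + 2 accommodates the points b + 2h and a + delta with h and delta
    at most 1.\<close>
  obtain C2 where C2: "\<And>a b. \<bar>a\<bar> \<le> r + 2 \<Longrightarrow> \<bar>b\<bar> \<le> r + 2 \<Longrightarrow> \<bar>q 2 a b\<bar> \<le> C2"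
    using F unfolding pure_smooth_def box_bounded_def by meson
  obtain CN where CN: "\<And>a b. \<bar>a\<bar> \<le> r + 2 \<Longrightarrow> \<bar>b\<bar> \<le> r + 2 \<Longrightarrow> \<bar>p N a b\<bar> \<le> CN"
    using F unfolding pure_smooth_def box_bounded_def by meson
  have dp: "((\<lambda>a. p m a b) has_real_derivative p (Suc m) a b) (at a)" for m a b
    using F by (auto simp: pure_smooth_def)
  have dq: "((\<lambda>b. q m a b) has_real_derivative q (Suc m) a b) (at b)" for m a b
    using F by (auto simp: pure_smooth_def)
  have F0: "p 0 = F" "q 0 = F" using F by (auto simp: pure_smooth_def)
  \<comment> \<open>Two mean value inequalities: one for \<open>q 1\<close> over a step h, one for
    the first difference of F.\<close>
  have u0: "\<bar>F a (b + 2 * h) - 2 * F a (b + h) + F a b\<bar> \<le> C2 * h ^ 2"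
    if a: "\<bar>a\<bar> \<le> r + 2" and b: "\<bar>b\<bar> \<le> r" and h: "0 < h" "h \<le> 1" for a b h
  proof -
    have d1: "\<bar>q 1 a (t + h) - q 1 a t\<bar> \<le> C2 * h" if t: "t \<in> {b..b+h}" for t
    proof -
      have "norm (q 1 a (t + h) - q 1 a t) \<le> C2 * norm (t + h - t)"
      proof (rule field_differentiable_bound[of "{b..b+2*h}"])
        show "(q 1 a has_field_derivative q 2 a z) (at z within {b..b+2*h})" for z
          using dq[of 1 a z] by (simp add: numeral_2_eq_2 has_field_derivative_at_within)
        show "norm (q 2 a z) \<le> C2" if "z \<in> {b..b+2*h}" for z
          using C2[OF a, of z] that b h by auto
      qed (use t h in auto)
      then show ?thesis using h by simp
    qed
    have "norm ((q 0 a (b + h + h) - q 0 a (b + h)) - (q 0 a (b + h) - q 0 a b)) \<le> C2 * h * norm (b + h - b)"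
    proof (rule field_differentiable_bound[of "{b..b+h}" "\<lambda>t. q 0 a (t + h) - q 0 a t" "\<lambda>t. q 1 a (t + h) - q 1 a t"])
      fix z
      have "((\<lambda>t. q 0 a (t + h)) has_real_derivative q 1 a (z + h)) (at z)"
        using dq[of 0 a "z + h"] by (simp add: DERIV_shift)
      then show "((\<lambda>t. q 0 a (t + h) - q 0 a t) has_real_derivative q 1 a (z + h) - q 1 a z) (at z within {b..b+h})"
        using dq[of 0 a z] by (auto intro!: DERIV_diff intro: has_field_derivative_at_within)
    qed (use d1 h in auto)
    then show ?thesis using h by (simp add: F0 algebra_simps power2_eq_square)
  qed
  show ?thesis
  proof (rule exI[of _ "C * (C2 + 4 * CN)"], intro allI impI)
    fix a b h :: real assume a: "\<bar>a\<bar> \<le> r" and b: "\<bar>b\<bar> \<le> r" and h: "0 < h" "h \<le> 1"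
    define \<delta> where "\<delta> = root (2 * n + 2) h"
    have \<delta>: "0 < \<delta>" "\<delta> \<le> 1" using h by (auto simp: \<delta>_def real_root_le_1_iff)
    have \<delta>3: "\<delta> ^ (2 * n + 2) = h" unfolding \<delta>_def by (rule real_root_pow_pos) (use h in auto)
    note \<delta> = \<delta> \<delta>3
    define u where "u m t = p m t (b + 2 * h) - 2 * p m t (b + h) + p m t b" for m t
    have "\<bar>u n a\<bar> \<le> C * (C2 * h ^ 2 / \<delta> ^ n + 4 * CN * \<delta> ^ (N - n))"
    proof (rule L[of \<delta> u a "C2 * h ^ 2" "4 * CN" n a])
      show "\<forall>m t. (u m has_real_derivative u (Suc m) t) (at t)"
        unfolding u_def by (intro allI DERIV_add DERIV_diff DERIV_cmult dp)
      show "\<forall>t\<in>{a..a+\<delta>}. \<bar>u 0 t\<bar> \<le> C2 * h ^ 2" 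
        unfolding u_def F0 by (intro ballI u0) (use a b h \<delta> in auto)
      show "\<forall>t\<in>{a..a+\<delta>}. \<bar>u N t\<bar> \<le> 4 * CN"
      proof
        fix t assume "t \<in> {a..a+\<delta>}"
        then have t: "\<bar>t\<bar> \<le> r + 2" using a \<delta> by auto
        have "\<bar>p N t (b + 2 * h)\<bar> \<le> CN" "\<bar>p N t (b + h)\<bar> \<le> CN" "\<bar>p N t b\<bar> \<le> CN" by (intro CN t; use b h in linarith)+
        then show "\<bar>u N t\<bar> \<le> 4 * CN" unfolding u_def by linarith
      qed
    qed (use \<delta> N_def in auto)
    also have "h ^ 2 = \<delta> ^ n * \<delta> ^ (3 * n + 4)"
      unfolding \<delta>(3)[symmetric] power_mult[symmetric] power_add[symmetric]
      by (rule arg_cong[of _ _ "\<lambda>k. \<delta> ^ k"]) simp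
    also have "C2 * (\<delta> ^ n * \<delta> ^ (3 * n + 4)) / \<delta> ^ n = C2 * \<delta> ^ (3 * n + 4)" using \<delta> by simp
    also have "N - n = 3 * n + 4" by (simp add: N_def)
    also have "C * (C2 * \<delta> ^ (3 * n + 4) + 4 * CN * \<delta> ^ (3 * n + 4)) = C * (C2 + 4 * CN) * \<delta> ^ (3 * n + 4)"
      by (simp add: algebra_simps)
    also have "\<dots> \<le> C * (C2 + 4 * CN) * (h * sqrt h)"
    proof (rule mult_left_mono)
      have "sqrt h = \<delta> ^ (n + 1)"
      proof (rule real_sqrt_unique)
        have "(\<delta> ^ (n + 1))\<^sup>2 = \<delta> ^ (2 * n + 2)"
          unfolding power_mult[symmetric] by (rule arg_cong[of _ _ "\<lambda>k. \<delta> ^ k"]) simp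
        then show "(\<delta> ^ (n + 1))\<^sup>2 = h" using \<delta>(3) by simp
      qed (use \<delta> in simp)
      then have "h * sqrt h = \<delta> ^ (2 * n + 2 + (n + 1))" using \<delta>(3) by (simp only: power_add)
      moreover have "\<delta> ^ (3 * n + 4) \<le> \<delta> ^ (2 * n + 2 + (n + 1))" using \<delta> by (intro power_decreasing) auto
      ultimately show "\<delta> ^ (3 * n + 4) \<le> h * sqrt h" by simp
      have "0 \<le> CN" "0 \<le> C2" using CN[of a b] C2[of a b] a b by auto
      then show "0 \<le> C * (C2 + 4 * CN)" using C by simp
    qed
    finally show "\<bar>p n a (b + 2 * h) - 2 * p n a (b + h) + p n a b\<bar> \<le> C * (C2 + 4 * CN) * h * sqrt h"
      by (simp add: u_def mult.assoc)
  qed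
qed

text \<open>This is where mixed derivatives arise. The derivatives of \<open>q 1\<close> in the
  first variable are limits of the dyadic difference quotients of \<open>p n\<close>; writing the
  limit as a telescoping series makes termwise differentiation available.\<close>

lemma pure_smooth_partial:
  assumes F: "pure_smooth F p q"
  shows "\<exists>P. pure_smooth (q 1) P (\<lambda>n. q (Suc n))"
proof -
  have dp: "((\<lambda>a. p m a b) has_real_derivative p (Suc m) a b) (at a)" for m a b
    using F by (auto simp: pure_smooth_def)
  have dq: "((\<lambda>b. q m a b) has_real_derivative q (Suc m) a b) (at b)" for m a b
    using F by (auto simp: pure_smooth_def)
  have F0: "p 0 = F" "q 0 = F" using F by (auto simp: pure_smooth_def)
  define D where "D i n a b = 2 ^ i * (p n a (b + 1 / 2 ^ i) - p n a b)" for i n :: nat and a b :: real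
  define f where "f i n a b = D (Suc i) n a b - D i n a b" for i n :: nat and a b :: real
  define P where "P n a b = D 0 n a b + (\<Sum>i. f i n a b)" for n a b
  have dD: "((\<lambda>a. D i n a b) has_real_derivative D i (Suc n) a b) (at a)" for i n a b
    unfolding D_def by (intro DERIV_cmult DERIV_diff dp)
  have df: "((\<lambda>a. f i n a b) has_real_derivative f i (Suc n) a b) (at a)" for i n a b
    unfolding f_def by (intro DERIV_diff dD)
  have M: "\<exists>C. \<forall>a b i. \<bar>a\<bar> \<le> r \<longrightarrow> \<bar>b\<bar> \<le> r \<longrightarrow> \<bar>f i n a b\<bar> \<le> C * sqrt (1/2) ^ i" for n r
  proof -
    obtain C where C: "\<And>a b h. \<bar>a\<bar> \<le> r \<Longrightarrow> \<bar>b\<bar> \<le> r \<Longrightarrow> 0 < h \<Longrightarrow> h \<le> 1 \<Longrightarrow>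
       \<bar>p n a (b + 2 * h) - 2 * p n a (b + h) + p n a b\<bar> \<le> C * h * sqrt h"
      using pure_smooth_second_difference[OF F, of r n] by blast
    show ?thesis
    proof (rule exI[of _ "C / 2 * sqrt (1/2)"], intro allI impI)
      fix a b :: real and i assume ab: "\<bar>a\<bar> \<le> r" "\<bar>b\<bar> \<le> r"
      \<comment> \<open>Halving the step 2h = 1 / 2^i changes the difference quotient by a second
        difference of step h. The prefactor 2^i cancels h up to 1/2, and sqrt h remains as the
        geometric factor.\<close>
      define h :: real where "h = 1 / 2 ^ Suc i"
      have "(1::real) \<le> 2 ^ Suc i" by (rule one_le_power) simp
      then have h: "0 < h" "h \<le> 1" "1 / 2 ^ i = 2 * h" "2 ^ i * h = 1 / 2" by (auto simp: h_def field_simps)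
      have "f i n a b = - (2 ^ i * (p n a (b + 2 * h) - 2 * p n a (b + h) + p n a b))"
        unfolding f_def D_def h(3) h_def[symmetric] by (simp add: algebra_simps)
      then have "\<bar>f i n a b\<bar> = 2 ^ i * \<bar>p n a (b + 2 * h) - 2 * p n a (b + h) + p n a b\<bar>" by (simp add: abs_mult)
      also have "\<dots> \<le> 2 ^ i * (C * h * sqrt h)" using C[OF ab h(1,2)] by simp
      also have "\<dots> = C / 2 * sqrt h" using h(4) by (simp add: algebra_simps)
      also have "sqrt h = sqrt (1/2) * sqrt (1/2) ^ i"
        by (simp add: h_def real_sqrt_divide real_sqrt_mult real_sqrt_power power_divide)
      finally show "\<bar>f i n a b\<bar> \<le> C / 2 * sqrt (1/2) * sqrt (1/2) ^ i" by simp
    qed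
  qed
  have geo: "summable (\<lambda>i. C * sqrt (1/2) ^ i)" for C :: real
    by (intro summable_mult summable_geometric) (simp add: real_sqrt_lt_1_iff)
  have summ: "summable (\<lambda>i. f i n a b)" for n a b
  proof -
    obtain C where "\<And>i. \<bar>f i n a b\<bar> \<le> C * sqrt (1/2) ^ i" using M[of "max \<bar>a\<bar> \<bar>b\<bar>" n] by (meson max.cobounded1 max.cobounded2)
    then show ?thesis by (intro summable_comparison_test'[OF geo[of C]]) auto
  qed
  have dP: "((\<lambda>a. P n a b) has_real_derivative P (Suc n) a b) (at a)" for n a b
  proof -
    define r where "r = max \<bar>a\<bar> \<bar>b\<bar> + 1"
    obtain C where C: "\<And>a b i. \<bar>a\<bar> \<le> r \<Longrightarrow> \<bar>b\<bar> \<le> r \<Longrightarrow> \<bar>f i (Suc n) a b\<bar> \<le> C * sqrt (1/2) ^ i" using M[of r "Suc n"] by blast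
    have bb: "\<bar>b\<bar> \<le> r" by (auto simp: r_def)
    have "((\<lambda>a. \<Sum>i. f i n a b) has_real_derivative (\<Sum>i. f i (Suc n) a b)) (at a)"
    proof (rule has_field_derivative_series'(2)[of "{-r..r}" "\<lambda>i a. f i n a b" "\<lambda>i a. f i (Suc n) a b"])
      show "uniformly_convergent_on {-r..r} (\<lambda>n' x. \<Sum>i<n'. f i (Suc n) x b)"
        by (rule Weierstrass_m_test'[of _ _ "\<lambda>i. C * sqrt (1/2) ^ i"]) (use C[OF _ bb] geo in \<open>auto simp: abs_le_iff\<close>)
      show "a \<in> interior {-r..r}" by (auto simp: r_def)
      show "a \<in> {-r..r}" by (auto simp: r_def)
    qed (use df summ in \<open>auto intro: has_field_derivative_at_within\<close>)
    then show ?thesis unfolding P_def by (intro DERIV_add dD)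
  qed
  have P0: "P 0 = q 1"
  proof (intro ext)
    fix a b
    have "(\<lambda>m. (F a (b + 1 / 2 ^ m) - F a b) / (1 / 2 ^ m)) \<longlonglongrightarrow> q 1 a b"
    proof (rule filterlim_compose[of "\<lambda>h. (F a (b + h) - F a b) / h" _ "at 0"])
      show "((\<lambda>h. (F a (b + h) - F a b) / h) \<longlongrightarrow> q 1 a b) (at 0)" using dq[of 0 a b] by (simp add: F0 DERIV_def)
      have "(\<lambda>m. (1/2::real) ^ m) \<longlonglongrightarrow> 0" by (rule LIMSEQ_realpow_zero) auto
      then show "filterlim (\<lambda>m. 1 / 2 ^ m :: real) (at 0) sequentially" by (auto simp: filterlim_at power_divide)
    qed
    then have 1: "(\<lambda>m. D m 0 a b) \<longlonglongrightarrow> q 1 a b" by (simp add: D_def F0 mult.commute)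
    have "(\<Sum>i<m. f i 0 a b) = D m 0 a b - D 0 0 a b" for m unfolding f_def by (rule sum_lessThan_telescope)
    then have "(\<lambda>m. D m 0 a b) \<longlonglongrightarrow> (\<Sum>i. f i 0 a b) + D 0 0 a b"
      using tendsto_add[OF summable_LIMSEQ[OF summ[of 0 a b]] tendsto_const[of "D 0 0 a b"]] by simp
    from LIMSEQ_unique[OF 1 this] show "P 0 a b = q 1 a b" by (simp add: P_def)
  qed
  have bP: "box_bounded (P n)" for n
    unfolding box_bounded_def
  proof
    fix r
    obtain C where C: "\<And>a b i. \<bar>a\<bar> \<le> r \<Longrightarrow> \<bar>b\<bar> \<le> r \<Longrightarrow> \<bar>f i n a b\<bar> \<le> C * sqrt (1/2) ^ i" using M[of r n] by blast
    obtain C1 where C1: "\<And>a b. \<bar>a\<bar> \<le> r + 1 \<Longrightarrow> \<bar>b\<bar> \<le> r + 1 \<Longrightarrow> \<bar>p n a b\<bar> \<le> C1"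
      using F unfolding pure_smooth_def box_bounded_def by meson
    show "\<exists>C. \<forall>a b. \<bar>a\<bar> \<le> r \<longrightarrow> \<bar>b\<bar> \<le> r \<longrightarrow> \<bar>P n a b\<bar> \<le> C"
    proof (rule exI[of _ "2 * C1 + (\<Sum>i. C * sqrt (1/2) ^ i)"], intro allI impI)
      fix a b assume ab: "\<bar>a\<bar> \<le> r" "\<bar>b\<bar> \<le> r"
      have "norm (\<Sum>i. f i n a b) \<le> (\<Sum>i. C * sqrt (1/2) ^ i)"
        by (rule norm_suminf_le) (use C[OF ab] geo in auto)
      moreover have "\<bar>p n a (b + 1)\<bar> \<le> C1" "\<bar>p n a b\<bar> \<le> C1" by (intro C1; use ab in linarith)+
      ultimately show "\<bar>P n a b\<bar> \<le> 2 * C1 + (\<Sum>i. C * sqrt (1/2) ^ i)"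
        unfolding P_def D_def by simp
    qed
  qed
  show ?thesis
    by (rule exI[of _ P]) (use F P0 dP bP dq in \<open>auto simp: pure_smooth_def\<close>)
qed

text \<open>\<open>pure_smooth\<close> asks for no joint continuity; it follows because bounded
  first derivatives make F Lipschitz in each variable on every square.\<close>

lemma pure_smooth_continuous:
  assumes F: "pure_smooth F p q"
  shows "continuous_on UNIV (\<lambda>(a, b). F a b)"
proof (rule continuous_at_imp_continuous_on, rule ballI)
  fix x :: "real \<times> real"
  obtain a0 b0 where x: "x = (a0, b0)" by (cases x)
  define r where "r = max \<bar>a0\<bar> \<bar>b0\<bar> + 1"
  have r0: "\<bar>a0\<bar> \<le> r" "\<bar>b0\<bar> \<le> r" by (auto simp: r_def)
  obtain C where C: "\<And>a b. \<bar>a\<bar> \<le> r \<Longrightarrow> \<bar>b\<bar> \<le> r \<Longrightarrow> \<bar>p 1 a b\<bar> \<le> C"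
    using F unfolding pure_smooth_def box_bounded_def by meson
  obtain C' where C': "\<And>a b. \<bar>a\<bar> \<le> r \<Longrightarrow> \<bar>b\<bar> \<le> r \<Longrightarrow> \<bar>q 1 a b\<bar> \<le> C'"
    using F unfolding pure_smooth_def box_bounded_def by meson
  have dp: "((\<lambda>a. F a b) has_real_derivative p 1 a b) (at a)" "((\<lambda>b. F a b) has_real_derivative q 1 a b) (at b)" for a b
    using F[unfolded pure_smooth_def] by (auto dest: spec[of _ 0])
  have est: "norm (F a b - F a0 b0) \<le> C * \<bar>a - a0\<bar> + C' * \<bar>b - b0\<bar>" if ab: "\<bar>a\<bar> \<le> r" "\<bar>b\<bar> \<le> r" for a b
  proof -
    have "norm (F a b - F a0 b) \<le> C * norm (a - a0)"
    proof (rule field_differentiable_bound[of "{-r..r}" "\<lambda>a. F a b" "\<lambda>a. p 1 a b"])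
      show "((\<lambda>a. F a b) has_field_derivative p 1 t b) (at t within {-r..r})" for t
        by (rule has_field_derivative_at_within[OF dp(1)])
      show "norm (p 1 t b) \<le> C" if "t \<in> {-r..r}" for t
        using C[of t b] ab that by (simp add: abs_le_iff)
    qed (use ab r0 in \<open>auto simp: abs_le_iff\<close>)
    moreover have "norm (F a0 b - F a0 b0) \<le> C' * norm (b - b0)"
    proof (rule field_differentiable_bound[of "{-r..r}" "\<lambda>b. F a0 b" "\<lambda>b. q 1 a0 b"])
      show "((\<lambda>b. F a0 b) has_field_derivative q 1 a0 t) (at t within {-r..r})" for t
        by (rule has_field_derivative_at_within[OF dp(2)])
      show "norm (q 1 a0 t) \<le> C'" if "t \<in> {-r..r}" for t
        using C'[of a0 t] r0 that by (simp add: abs_le_iff)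
    qed (use ab r0 in \<open>auto simp: abs_le_iff\<close>)
    ultimately show ?thesis by simp
  qed
  have "((\<lambda>y. F (fst y) (snd y) - F a0 b0) \<longlongrightarrow> 0) (at x)"
  proof (rule Lim_null_comparison)
    have "open {y :: real \<times> real. \<bar>fst y\<bar> < r \<and> \<bar>snd y\<bar> < r}"
      by (intro open_Collect_conj open_Collect_less continuous_intros)
    then have "eventually (\<lambda>y. y \<in> {y :: real \<times> real. \<bar>fst y\<bar> < r \<and> \<bar>snd y\<bar> < r}) (at x)"
      by (rule eventually_at_topological[THEN iffD2, OF exI, OF conjI]) (auto simp: x r_def)
    then show "eventually (\<lambda>y. norm (F (fst y) (snd y) - F a0 b0) \<le> C * \<bar>fst y - a0\<bar> + C' * \<bar>snd y - b0\<bar>) (at x)"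
      by eventually_elim (use est in auto)
    have "((\<lambda>y. C * \<bar>fst y - a0\<bar> + C' * \<bar>snd y - b0\<bar>) \<longlongrightarrow> C * \<bar>fst x - a0\<bar> + C' * \<bar>snd x - b0\<bar>) (at x)"
      by (intro tendsto_intros)
    then show "((\<lambda>y. C * \<bar>fst y - a0\<bar> + C' * \<bar>snd y - b0\<bar>) \<longlongrightarrow> 0) (at x)" by (simp add: x)
  qed
  then have "((\<lambda>y. F (fst y) (snd y)) \<longlongrightarrow> F a0 b0) (at x)" by (simp only: LIM_zero_iff)
  moreover have "(\<lambda>(a, b). F a b) = (\<lambda>y. F (fst y) (snd y))" by auto
  ultimately show "isCont (\<lambda>(a, b). F a b) x" unfolding isCont_def by (simp only: x fst_conv snd_conv)
qed

text \<open>By \<open>pure_smooth_partial\<close>, applied directly and with the variables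
  exchanged, both first partials are again \<open>pure_smooth\<close>. They are therefore
  continuous, F is totally differentiable, and the induction continues with them.\<close>

lemma pure_smooth_Ck: "pure_smooth F p q \<Longrightarrow> Ck n UNIV (\<lambda>(a, b). F a b)"
proof (induction n arbitrary: F p q)
  case 0 then show ?case by (simp add: pure_smooth_continuous)
next
  case (Suc n)
  obtain P where P: "pure_smooth (q 1) P (\<lambda>n. q (Suc n))" using pure_smooth_partial[OF Suc.prems] by blast
  obtain Q where "pure_smooth (\<lambda>b a. p 1 a b) Q (\<lambda>n b a. p (Suc n) a b)"
    using pure_smooth_partial[OF pure_smooth_swap[OF Suc.prems]] by auto
  from pure_smooth_swap[OF this] have Q: "pure_smooth (p 1) (\<lambda>n. p (Suc n)) (\<lambda>n b a. Q n a b)" by simp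
  define g :: "real \<times> real \<Rightarrow> real \<times> real \<Rightarrow> real" where
    "g = (\<lambda>v (a, b). if v = (1, 0) then p 1 a b else q 1 a b)"
  have Basis: "Basis = {(1::real, 0::real), (0, 1)}" by (auto simp: Basis_prod_def)
  have gC: "Ck n UNIV (g v)" "continuous_on UNIV (g v)" for v
    using Suc.IH[OF P] Suc.IH[OF Q] pure_smooth_continuous[OF P] pure_smooth_continuous[OF Q]
    by (cases "v = (1, 0)"; simp add: g_def)+
  have dp: "((\<lambda>a. F a b) has_real_derivative p 1 a b) (at a)" "((\<lambda>b. F a b) has_real_derivative q 1 a b) (at b)" for a b
    using Suc.prems[unfolded pure_smooth_def] by (auto dest: spec[of _ 0])
  show ?case
  proof (rule Ck_SucI[of UNIV _ "\<lambda>x v. \<Sum>b\<in>Basis. (v \<bullet> b) *\<^sub>R g b x"])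
    show "((\<lambda>(a, b). F a b) has_derivative (\<lambda>v. \<Sum>b\<in>Basis. (v \<bullet> b) *\<^sub>R g b x)) (at x)" for x
    proof (rule has_derivative_continuous_partials[of UNIV])
      fix v y :: "real \<times> real" assume v: "v \<in> Basis"
      obtain a b where y: "y = (a, b)" by (cases y)
      have "((\<lambda>h. F (a + h) b) has_vector_derivative p 1 a b) (at 0)" "((\<lambda>h. F a (b + h)) has_vector_derivative q 1 a b) (at 0)"
        using dp(1)[of b a] dp(2)[of a b] DERIV_shift[of "\<lambda>a. F a b" _ 0 a] DERIV_shift[of "\<lambda>b. F a b" _ 0 b]
        by (simp_all add: add.commute has_real_derivative_iff_has_vector_derivative)
      then show "((\<lambda>h. case y + h *\<^sub>R v of (a, b) \<Rightarrow> F a b) has_vector_derivative g v y) (at 0)"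
        using v by (auto simp: Basis g_def y)
    qed (use gC in auto)
    show "Ck n UNIV (\<lambda>x. \<Sum>b\<in>Basis. (v \<bullet> b) *\<^sub>R g b x)" for v
      by (intro Ck_sum Ck_bounded_linear_compose[OF bounded_linear_scaleR_right] gC)
  qed
qed

text \<open>One smooth curve through prescribed line segments near the points \<open>1/2^k\<close>; the factorials beat all
  powers of \<open>2^k\<close> coming from the rescaled cutoffs.\<close>

lemma special_curve:
  fixes A B :: "nat \<Rightarrow> real"
  assumes A: "\<And>k. \<bar>A k\<bar> \<le> 1 / fact k" and B: "\<And>k. \<bar>B k\<bar> \<le> 1 / fact k"
  shows "\<exists>\<Gamma>. smooth \<Gamma> \<and> (\<forall>k t. \<bar>t - 1 / 2 ^ k\<bar> \<le> 1 / 2 ^ (k + 3) \<longrightarrow> \<Gamma> t = A k + B k * ((t - 1 / 2 ^ k) * 2 ^ (k + 2)))"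
proof -
  \<comment> \<open>Multiplying the cutoff by its variable produces the linear term of the
    prescribed segment.\<close>
  define Q :: "real \<Rightarrow> real" where "Q = (\<lambda>\<tau>. \<tau> * cutoff \<tau>)"
  have CQ: "smooth Q" unfolding Q_def by (intro Cinf_intros Cinf_cutoff open_UNIV)
  define dn :: "nat \<Rightarrow> (real \<Rightarrow> real) \<Rightarrow> real \<Rightarrow> real" where "dn m f = pd (replicate m 1) f" for m f
  have dn: "(dn m f has_real_derivative dn (Suc m) f t) (at t)" if "smooth f" for m f t
    using Cinf_on_has_vector_derivative[OF Cinf_on_pd[OF that, of "replicate m 1"], of t]
    unfolding dn_def has_real_derivative_iff_has_vector_derivative by simp
  \<comment> \<open>The window |s k t| \<le> 1/2 is |t - 1/2^k| \<le> 1/2^(k+3), and the bump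
    vanishes beyond 3/16 of 1/2^k. Neighbouring centres differ by a factor 2, so the supports are
    disjoint.\<close>
  define s where "s k t = (t - 1 / 2 ^ k) * 2 ^ (k + 2)" for k :: nat and t :: real
  define g where "g k m t = (2 ^ (k + 2)) ^ m * (A k * dn m cutoff (s k t) + B k * dn m Q (s k t))" for k m t
  have "\<forall>m. \<exists>C. \<forall>t. \<bar>dn m cutoff t\<bar> \<le> C" "\<forall>m. \<exists>C. \<forall>t. \<bar>dn m Q t\<bar> \<le> C"
    unfolding dn_def by (intro allI Cinf_on_bounded_derivs CQ Cinf_cutoff; simp add: Q_def cutoff_eq_0)+
  then obtain C1 C2 where C: "\<And>m t. \<bar>dn m cutoff t\<bar> \<le> C1 m" "\<And>m t. \<bar>dn m Q t\<bar> \<le> C2 m" by metis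
  have dg: "(g k m has_real_derivative g k (Suc m) t) (at t)" for k m t
  proof -
    have ds: "(s k has_real_derivative 2 ^ (k + 2)) (at t)" unfolding s_def by (auto intro!: derivative_eq_intros)
    have "((\<lambda>t. dn m f (s k t)) has_real_derivative dn (Suc m) f (s k t) * 2 ^ (k + 2)) (at t)" if "smooth f" for f
      by (rule DERIV_chain2[OF dn[OF that] ds])
    from this[OF CQ] this[OF Cinf_cutoff] show ?thesis
      unfolding g_def by (auto intro!: derivative_eq_intros simp: algebra_simps)
  qed
  have C0: "smooth (\<lambda>t. \<Sum>k. g k 0 t)"
  \<comment> \<open>Each differentiation contributes a factor 2^(k+2); the majorants sum to a
    multiple of the exponential series at 2^m.\<close>
  proof (rule Cinf_on_series[of g "\<lambda>m k. (C1 m + C2 m) * 4 ^ m * ((2 ^ m) ^ k / fact k)", OF dg])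
    fix k m t
    have "\<bar>A k * dn m cutoff (s k t) + B k * dn m Q (s k t)\<bar> \<le> (1 / fact k) * C1 m + (1 / fact k) * C2 m"
      using mult_mono[OF A C(1)] mult_mono[OF B C(2)] 
      by (intro order_trans[OF abs_triangle_ineq] add_mono) (auto simp: abs_mult)
    then have "\<bar>g k m t\<bar> \<le> (2 ^ (k + 2)) ^ m * ((1 / fact k) * C1 m + (1 / fact k) * C2 m)"
      unfolding g_def abs_mult by (intro mult_mono) auto
    also have "\<dots> = (C1 m + C2 m) * 4 ^ m * ((2 ^ m) ^ k / fact k)"
      by (simp add: field_simps power_add power_mult_distrib flip: power_mult)
    finally show "\<bar>g k m t\<bar> \<le> (C1 m + C2 m) * 4 ^ m * ((2 ^ m) ^ k / fact k)" .
    show "summable (\<lambda>k. (C1 m + C2 m) * 4 ^ m * ((2 ^ m) ^ k / fact k))"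
      using summable_exp[of "2 ^ m :: real"] by (intro summable_mult) (simp add: field_simps)
  qed
  have val: "(\<Sum>k. g k 0 t) = A k + B k * s k t" if t: "\<bar>t - 1 / 2 ^ k\<bar> \<le> 1 / 2 ^ (k + 3)" for k t
  proof -
    have "\<bar>s k t\<bar> = \<bar>t - 1 / 2 ^ k\<bar> * 2 ^ (k + 2)" by (simp add: s_def abs_mult)
    also have "\<dots> \<le> 1 / 2 ^ (k + 3) * 2 ^ (k + 2)" by (intro mult_right_mono t) simp
    finally have "\<bar>s k t\<bar> \<le> 1 / 2" by (simp add: power_add)
    then have 1: "g k 0 t = A k + B k * s k t" by (simp add: g_def dn_def Q_def cutoff_eq_1)
    have 2: "g i 0 t = 0" if "i \<noteq> k" for i
    proof -
      have tk: "\<bar>t - 1 / 2 ^ k\<bar> \<le> (1 / 2 ^ k) / 8" using t by (simp add: power_add)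
      have "\<bar>t - 1 / 2 ^ i\<bar> * 2 ^ (i + 2) \<ge> 3 / 4"
      proof (cases "i < k")
        case True
        then have "(1 / 2 ^ k :: real) \<le> 1 / 2 ^ Suc i" by (intro divide_left_mono power_increasing) auto
        then have k: "(1 / 2 ^ k :: real) \<le> (1 / 2 ^ i) / 2" by simp
        define u :: real where "u = 1 / 2 ^ i"
        have u: "u > 0" "u * 2 ^ (i + 2) = 4" by (auto simp: u_def power_add)
        define w :: real where "w = 1 / 2 ^ k"
        have "\<bar>t - u\<bar> \<ge> 7 / 16 * u" using tk k unfolding u_def[symmetric] w_def[symmetric] by linarith
        then have "\<bar>t - u\<bar> * 2 ^ (i + 2) \<ge> 7 / 16 * u * 2 ^ (i + 2)" by (intro mult_right_mono) auto
        with u show ?thesis by (simp add: u_def mult.assoc)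
      next
        case False
        then have "(1 / 2 ^ i :: real) \<le> 1 / 2 ^ Suc k" using that by (intro divide_left_mono power_increasing) auto
        then have k: "(1 / 2 ^ i :: real) * 2 \<le> 1 / 2 ^ k" by simp
        define u :: real where "u = 1 / 2 ^ i"
        have u: "u > 0" "u * 2 ^ (i + 2) = 4" by (auto simp: u_def power_add)
        define w :: real where "w = 1 / 2 ^ k"
        have "\<bar>t - u\<bar> \<ge> 3 / 4 * u" using tk k u unfolding u_def[symmetric] w_def[symmetric] by linarith
        then have "\<bar>t - u\<bar> * 2 ^ (i + 2) \<ge> 3 / 4 * u * 2 ^ (i + 2)" by (intro mult_right_mono) auto
        with u show ?thesis by (simp add: u_def mult.assoc)
      qed
      then have "\<bar>s i t\<bar> \<ge> 3 / 4" by (simp add: s_def abs_mult)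
      then show ?thesis by (simp add: g_def dn_def Q_def cutoff_eq_0)
    qed
    have "(\<Sum>i. g i 0 t) = (\<Sum>i\<in>{k}. g i 0 t)" by (rule suminf_finite) (use 2 in auto)
    with 1 show ?thesis by simp
  qed
  show ?thesis using C0 val unfolding s_def by blast
qed

section \<open>From smoothness along curves to smoothness in the plane\<close>

lemma pd_affine:
  fixes g :: "real \<Rightarrow> real"
  assumes g: "smooth g"
  shows "pd (replicate n 1) (\<lambda>t. g (\<alpha> + \<mu> * (t - t0))) t = \<mu> ^ n * pd (replicate n 1) g (\<alpha> + \<mu> * (t - t0))"
proof (induction n arbitrary: t)
  case 0 then show ?case by simp
next
  case (Suc n)
  define G where "G = pd (replicate n 1) g"
  have "(G has_vector_derivative pd [1] G z) (at z)" for z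
    unfolding G_def by (rule Cinf_on_has_vector_derivative[OF Cinf_on_pd[OF g]]) simp
  then have G: "(G has_real_derivative pd [1] G z) (at z)" for z
    by (simp only: has_real_derivative_iff_has_vector_derivative)
  have "((\<lambda>h. \<mu> ^ n * G (\<alpha> + \<mu> * (t + h * 1 - t0))) has_real_derivative \<mu> ^ n * (pd [1] G (\<alpha> + \<mu> * (t + 0 * 1 - t0)) * \<mu>)) (at 0)"
    by (intro DERIV_cmult DERIV_chain2[OF G]) (auto intro!: derivative_eq_intros)
  then have "((\<lambda>h. \<mu> ^ n * G (\<alpha> + \<mu> * (t + h * 1 - t0))) has_vector_derivative \<mu> ^ Suc n * pd [1] G (\<alpha> + \<mu> * (t - t0))) (at 0)"
    by (simp add: has_real_derivative_iff_has_vector_derivative algebra_simps del: pd.simps)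
  then have "pd [1] (\<lambda>t. \<mu> ^ n * G (\<alpha> + \<mu> * (t - t0))) t = \<mu> ^ Suc n * pd [1] G (\<alpha> + \<mu> * (t - t0))"
    by (simp add: vector_derivative_at del: power_Suc)
  then show ?case using Suc.IH by (simp add: G_def)
qed

definition curve_smooth :: "(real \<times> real \<Rightarrow> real) \<Rightarrow> bool" where
  "curve_smooth f \<longleftrightarrow> (\<forall>\<gamma>::real \<Rightarrow> real \<times> real. smooth \<gamma> \<longrightarrow> smooth (\<lambda>t. f (\<gamma> t)))"

text \<open>If the n-th pure derivative p were unbounded on a square, there would be points z k
  within 1/k! of some l with |p (z k)| > k (k!)^n. A smooth curve passing z k at time 1/2^k
  horizontally with speed 1/k! makes the n-th derivative of f along it equal to (1/k!)^n p (z k)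
  there. This exceeds k in modulus although the times converge to 0, against continuity.\<close>

lemma curve_smooth_box_bounded:
  assumes f: "curve_smooth f"
  shows "box_bounded (\<lambda>a b. pd (replicate n 1) (\<lambda>t. f (t, b)) a)"
proof (rule ccontr)
  define p where "p z = pd (replicate n 1) (\<lambda>t. f (t, snd z)) (fst z)" for z
  assume "\<not> ?thesis"
  then obtain r where "\<And>C. \<exists>a b. \<bar>a\<bar> \<le> r \<and> \<bar>b\<bar> \<le> r \<and> \<bar>p (a, b)\<bar> > C"
    unfolding box_bounded_def p_def by (auto simp: not_le)
  then have "\<forall>k::nat. \<exists>z. z \<in> {-r..r} \<times> {-r..r} \<and> \<bar>p z\<bar> > real k"
    by (metis (no_types, lifting) abs_le_iff atLeastAtMost_iff mem_Sigma_iff minus_le_iff)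
  then obtain x where x: "\<And>k::nat. x k \<in> {-r..r} \<times> {-r..r}" "\<And>k. \<bar>p (x k)\<bar> > real k" by metis
  have "compact ({-r..r} \<times> {-r..r})" by (intro compact_Times) auto
  then obtain l \<sigma> where l: "strict_mono \<sigma>" "(x \<circ> \<sigma>) \<longlonglongrightarrow> l" using x(1) unfolding compact_def by metis
  have "\<exists>z. dist z l \<le> (1 / fact k) \<and> \<bar>p z\<bar> > real k * fact k ^ n" for k
  proof -
    have "eventually (\<lambda>j. dist ((x \<circ> \<sigma>) j) l < 1 / fact k) sequentially"
      by (rule tendstoD[OF l(2)]) simp
    moreover have "eventually (\<lambda>j. real j > real k * fact k ^ n) sequentially"
      by (rule eventually_sequentiallyI[of "Suc (k * fact k ^ n)"])
        (metis (no_types, lifting) Suc_le_eq of_nat_fact of_nat_less_iff of_nat_mult of_nat_power)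
    ultimately have "eventually (\<lambda>j. dist ((x \<circ> \<sigma>) j) l < 1 / fact k \<and> real j > real k * fact k ^ n) sequentially"
      by (rule eventually_conj)
    then obtain j where j: "dist ((x \<circ> \<sigma>) j) l < 1 / fact k" "real j > real k * fact k ^ n"
      using eventually_happens by force
    have "real j \<le> real (\<sigma> j)" using seq_suble[OF l(1), of j] by simp
    with x(2)[of "\<sigma> j"] j show ?thesis by (intro exI[of _ "x (\<sigma> j)"]) auto
  qed
  then obtain z where z: "\<And>k. dist (z k) l \<le> 1 / fact k" "\<And>k. \<bar>p (z k)\<bar> > real k * fact k ^ n" by metis
  have z1: "\<bar>fst (z k) - fst l\<bar> \<le> 1 / fact k" "\<bar>snd (z k) - snd l\<bar> \<le> 1 / fact k" for k
    using z(1)[of k] dist_fst_le[of "z k" l] dist_snd_le[of "z k" l] by (auto simp: dist_real_def)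
  have B: "\<bar>(1 / fact k) / 2 ^ (k + 2)\<bar> \<le> (1 / fact k :: real)" for k :: nat
  proof -
    have "(1::real) \<le> 2 ^ (k + 2)" by (rule one_le_power) simp
    then show ?thesis by (simp add: field_simps)
  qed
  \<comment> \<open>The slope 1/k! is divided by 2^(k+2) because \<open>special_curve\<close>
    measures time in the rescaled variable.\<close>
  obtain \<gamma>1 where g1: "smooth \<gamma>1" "\<And>k t. \<bar>t - 1 / 2 ^ k\<bar> \<le> 1 / 2 ^ (k + 3) \<Longrightarrow>
      \<gamma>1 t = (fst (z k) - fst l) + (1 / fact k) / 2 ^ (k + 2) * ((t - 1 / 2 ^ k) * 2 ^ (k + 2))"
    using special_curve[OF z1(1) B] by blast
  obtain \<gamma>2 where g2: "smooth \<gamma>2" "\<And>k t. \<bar>t - 1 / 2 ^ k\<bar> \<le> 1 / 2 ^ (k + 3) \<Longrightarrow>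
      \<gamma>2 t = (snd (z k) - snd l) + 0 * ((t - 1 / 2 ^ k) * 2 ^ (k + 2))"
    using special_curve[OF z1(2), of "\<lambda>_. 0"] by fastforce
  define h where "h t = f (fst l + \<gamma>1 t, snd l + \<gamma>2 t)" for t
  have h: "smooth h"
    unfolding h_def by (rule f[unfolded curve_smooth_def, rule_format]) (intro Cinf_intros g1 g2 open_UNIV)
  have "pd (replicate n 1) h (1 / 2 ^ k) = (1 / fact k) ^ n * p (z k)" for k
  proof -
    define S where "S = {t::real. \<bar>t - 1 / 2 ^ k\<bar> < 1 / 2 ^ (k + 3)}"
    have S: "open S" "1 / 2 ^ k \<in> S" unfolding S_def by (auto intro!: open_Collect_less continuous_intros)
    have "pd (replicate n 1) h (1 / 2 ^ k) = pd (replicate n 1) (\<lambda>t. f (fst (z k) + (1 / fact k) * (t - 1 / 2 ^ k), snd (z k))) (1 / 2 ^ k)"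
      by (rule pd_cong_on[OF S(1) _ S(2)]) (auto simp: h_def S_def g1(2)[of _ k] g2(2)[of _ k])
    also have "\<dots> = (1 / fact k) ^ n * pd (replicate n 1) (\<lambda>t. f (t, snd (z k))) (fst (z k) + (1 / fact k) * (1 / 2 ^ k - 1 / 2 ^ k))"
      by (rule pd_affine, rule f[unfolded curve_smooth_def, rule_format]) (intro Cinf_intros open_UNIV)
    finally show ?thesis by (simp add: p_def)
  qed
  note val = this
  have big: "\<bar>pd (replicate n 1) h (1 / 2 ^ k)\<bar> > real k" for k
  proof -
    have "\<bar>pd (replicate n 1) h (1 / 2 ^ k)\<bar> = \<bar>p (z k)\<bar> / fact k ^ n"
      unfolding val by (simp add: abs_mult power_divide)
    then show ?thesis using z(2)[of k] by (simp add: pos_less_divide_eq)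
  qed
  have "(\<lambda>k. (1/2::real) ^ k) \<longlonglongrightarrow> 0" by (rule LIMSEQ_realpow_zero) auto
  then have "(\<lambda>k. 1 / 2 ^ k :: real) \<longlonglongrightarrow> 0" by (simp add: power_divide)
  then have lim: "(\<lambda>k. 1 / 2 ^ k :: real) \<longlonglongrightarrow> 0" .
  have cont: "isCont (pd (replicate n 1) h) 0"
    using Cinf_on_imp_continuous_on[OF Cinf_on_pd[OF h]] by (simp add: continuous_on_eq_continuous_at)
  have "(\<lambda>k. pd (replicate n 1) h (1 / 2 ^ k)) \<longlonglongrightarrow> pd (replicate n 1) h 0"
    by (rule isCont_tendsto_compose[OF cont lim])
  then have "Bseq (\<lambda>k. pd (replicate n 1) h (1 / 2 ^ k))" by (rule convergent_imp_Bseq[OF convergentI])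
  then obtain K where K: "\<And>k. norm (pd (replicate n 1) h (1 / 2 ^ k)) \<le> K" unfolding Bseq_def by blast
  obtain k :: nat where "real k > K" using reals_Archimedean2 by blast
  with K[of k] big[of k] show False by simp
qed

text \<open>Coordinate lines are smooth curves, so the pure derivatives exist at once; only their
  boundedness on squares needs the special curves. The second variable is reduced to the first by
  exchanging coordinates.\<close>

theorem Boman_plane_real:
  assumes f: "curve_smooth f"
  shows "smooth f"
proof -
  define p where "p n a b = pd (replicate n 1) (\<lambda>t. f (t, b)) a" for n a b
  define q where "q n a b = pd (replicate n 1) (\<lambda>t. f (a, t)) b" for n a b
  have sw: "curve_smooth (\<lambda>(a, b). f (b, a))"
    unfolding curve_smooth_def
  proof (intro allI impI)
    fix \<gamma> :: "real \<Rightarrow> real \<times> real" assume g: "smooth \<gamma>"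
    have "smooth (\<lambda>t. f (snd (\<gamma> t), fst (\<gamma> t)))"
      by (rule f[unfolded curve_smooth_def, rule_format]) (intro Cinf_intros g)
    then show "smooth (\<lambda>t. case \<gamma> t of (a, b) \<Rightarrow> f (b, a))" by (simp add: split_beta)
  qed
  have "((\<lambda>t. pd (replicate n 1) g t) has_real_derivative pd (replicate (Suc n) 1) g t) (at t)" if "smooth g" for g :: "real \<Rightarrow> real" and t n
    using Cinf_on_has_vector_derivative[OF Cinf_on_pd[OF that, of "replicate n 1"], of t]
    by (simp add: has_real_derivative_iff_has_vector_derivative)
  moreover have "smooth (\<lambda>t. f (t, b))" "smooth (\<lambda>t. f (a, t))" for a b
    by (rule f[unfolded curve_smooth_def, rule_format], intro Cinf_intros open_UNIV)+
  moreover have "box_bounded (p n)" for n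
    unfolding p_def using curve_smooth_box_bounded[OF f] .
  moreover have "box_bounded (q n)" for n
    unfolding q_def using box_bounded_swap[OF curve_smooth_box_bounded[OF sw, of n]] by simp
  ultimately have "pure_smooth (\<lambda>a b. f (a, b)) p q"
    unfolding pure_smooth_def p_def q_def by auto
  from pure_smooth_Ck[OF this] show ?thesis by (intro Cinf_onI) auto
qed

theorem Boman_plane:
  fixes f :: "real \<times> real \<Rightarrow> complex"
  assumes f: "\<And>\<gamma>::real \<Rightarrow> real \<times> real. smooth \<gamma> \<Longrightarrow> smooth (\<lambda>t. f (\<gamma> t))"
  shows "smooth f"
proof -
  have "smooth (\<lambda>x. Re (f x))" "smooth (\<lambda>x. Im (f x))"
    by (rule Boman_plane_real, simp add: curve_smooth_def f Cinf_on_linear_compose[OF bounded_linear_Re] Cinf_on_linear_compose[OF bounded_linear_Im])+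
  then have "smooth (\<lambda>x. of_real (Re (f x)) + \<i> * of_real (Im (f x)))"
    by (intro Cinf_intros open_UNIV)
  then show ?thesis by (simp flip: complex_eq)
qed

section \<open>Differential calculus along smooth curves of test functions\<close>

text \<open>A pair is either a point, i.e. a test function with a position, or a direction at such a point.\<close>

definition padd :: "('a::real_vector \<Rightarrow> complex) \<times> 'a \<Rightarrow> real \<Rightarrow> ('a \<Rightarrow> complex) \<times> 'a \<Rightarrow> ('a \<Rightarrow> complex) \<times> 'a" where
  "padd p s w = (\<lambda>\<xi>. fst p \<xi> + complex_of_real s * fst w \<xi>, snd p + s *\<^sub>R snd w)"

text \<open>Only joint smoothness is recorded. The common compact support that a smooth curve of
  test functions needs comes from membership of all values in \<open>UL L\<close> or
  \<open>WL L\<close>.\<close>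

definition plot :: "('p::euclidean_space \<Rightarrow> ('a::euclidean_space \<Rightarrow> complex) \<times> 'a) \<Rightarrow> bool" where
  "plot c \<longleftrightarrow> smooth (\<lambda>(p, \<xi>). fst (c p) \<xi>) \<and> smooth (\<lambda>p. snd (c p))"

text \<open>A common form of \<open>pd\<close> and \<open>d1\<close>: directions (0, v) give
  derivatives in the position, directions (psi, 0) differentials in the test function. Having both
  in one list makes their symmetry a single statement.\<close>

fun DD :: "(('a::real_vector \<Rightarrow> complex) \<times> 'a \<Rightarrow> complex) \<Rightarrow> (('a \<Rightarrow> complex) \<times> 'a) list \<Rightarrow> ('a \<Rightarrow> complex) \<times> 'a \<Rightarrow> complex" where
  "DD G [] p = G p"
| "DD G (w # ws) p = vector_derivative (\<lambda>s::real. DD G ws (padd p s w)) (at 0)"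

lemma padd_commute: "padd (padd p t w') s w = padd (padd p s w) t w'"
  by (auto simp: padd_def algebra_simps)

lemma padd_assoc: "padd p s (padd w a w') = padd (padd p s w) (s * a) w'"
  by (auto simp: padd_def algebra_simps)

lemma padd_0: "padd p 0 w = p" and padd_zero: "padd p s ((\<lambda>_. 0), 0) = p"
  by (auto simp: padd_def)

lemma plotI: "smooth (\<lambda>(p, \<xi>). f p \<xi>) \<Longrightarrow> smooth g \<Longrightarrow> plot (\<lambda>p. (f p, g p))"
  by (simp add: plot_def)

lemma plot_compose:
  assumes c: "plot c" and g: "smooth \<gamma>"
  shows "plot (\<lambda>x. c (\<gamma> x))"
proof -
  have "smooth (\<lambda>z. \<gamma> (fst z))" by (rule Cinf_on_compose[OF Cinf_on_linear[OF bounded_linear_fst open_UNIV] g]) simp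
  then have "smooth (\<lambda>z. (\<gamma> (fst z), snd z))" by (intro Cinf_intros open_UNIV)
  from Cinf_on_compose[OF this, of UNIV "\<lambda>(p, \<xi>). fst (c p) \<xi>"] Cinf_on_compose[OF g, of UNIV "\<lambda>p. snd (c p)"] c
  show ?thesis by (simp add: plot_def split_def)
qed

lemma plot_padd:
  assumes c: "plot c" and w: "plot w" and s: "smooth s"
  shows "plot (\<lambda>p. padd (c p) (s p) (w p))"
proof -
  have "smooth (\<lambda>z. s (fst z))" by (rule Cinf_on_compose[OF Cinf_on_linear[OF bounded_linear_fst open_UNIV] s]) simp
  with assms show ?thesis unfolding plot_def padd_def split_def fst_conv snd_conv
    by (intro conjI Cinf_intros) auto
qed

lemma plot_const:
  assumes "smooth (fst p)"
  shows "plot (\<lambda>_. p)"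
  unfolding plot_def split_def
  by (intro conjI Cinf_intros open_UNIV Cinf_on_compose[OF _ assms]) auto

definition dcurve :: "(real \<Rightarrow> ('a::real_normed_vector \<Rightarrow> complex) \<times> 'a) \<Rightarrow> real \<Rightarrow> ('a \<Rightarrow> complex) \<times> 'a" where
  "dcurve c t = (\<lambda>\<xi>. vector_derivative (\<lambda>s. fst (c s) \<xi>) (at t), vector_derivative (\<lambda>s. snd (c s)) (at t))"

abbreviation (input) off :: "'a set \<Rightarrow> ('a \<Rightarrow> complex) \<Rightarrow> bool" where
  "off L \<phi> \<equiv> \<forall>\<xi>. \<xi> \<notin> L \<longrightarrow> \<phi> \<xi> = 0"

text \<open>The affine space of admissible points with support in L, and its space of directions.\<close>

definition UL :: "'a::euclidean_space set \<Rightarrow> (('a \<Rightarrow> complex) \<times> 'a) set" where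
  "UL L = {p. fst p \<in> A0 \<and> off L (fst p)}"

definition WL :: "'a::euclidean_space set \<Rightarrow> (('a \<Rightarrow> complex) \<times> 'a) set" where
  "WL L = {p. fst p \<in> A00 \<and> off L (fst p)}"

section \<open>Test functions supported in a fixed compact set\<close>

lemma vanish_tsupp: "compact L \<Longrightarrow> off L \<phi> \<longleftrightarrow> tsupp \<phi> \<subseteq> L"
  unfolding tsupp_def using closure_minimal[of "{\<xi>. \<phi> \<xi> \<noteq> 0}" L] closure_subset[of "{\<xi>. \<phi> \<xi> \<noteq> 0}"] compact_imp_closed
  by blast

lemma test_funI:
  assumes "compact L" "smooth \<phi>" "off L \<phi>"
  shows "test_fun \<phi>"
  using assms vanish_tsupp[of L \<phi>] unfolding test_fun_def
  by (metis closed_closure compact_Int_closed inf.absorb_iff2 tsupp_def)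

lemma test_integral:
  fixes \<phi> :: "'a::euclidean_space \<Rightarrow> complex"
  assumes "continuous_on UNIV \<phi>" "\<forall>\<xi>. \<xi> \<notin> cbox a b \<longrightarrow> \<phi> \<xi> = 0"
  shows "(\<phi> has_integral integral (cbox a b) \<phi>) UNIV"
proof -
  have "\<phi> integrable_on cbox a b"
    by (rule integrable_continuous) (use assms continuous_on_subset in blast)
  then have "(\<phi> has_integral integral (cbox a b) \<phi>) (cbox a b)" by (rule integrable_integral)
  then show ?thesis by (rule has_integral_on_superset) (use assms in auto)
qed

lemma compact_subset_cbox:
  assumes "compact (L :: 'a::euclidean_space set)"
  obtains a b where "L \<subseteq> cbox a b"
  using bounded_subset_cbox_symmetric[OF compact_imp_bounded[OF assms]] by blast

lemma Cinf_on_slice: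
  assumes "smooth (\<lambda>(p, \<xi>). f p \<xi>)"
  shows "smooth (f p)"
proof -
  have "smooth (\<lambda>\<xi>. (\<lambda>(p, \<xi>). f p \<xi>) (p, \<xi>))"
    by (rule Cinf_on_compose[OF _ assms]) (auto intro!: Cinf_intros)
  then show ?thesis by simp
qed

lemma Cinf_on_slice':
  assumes "smooth (\<lambda>(p, \<xi>). f p \<xi>)"
  shows "smooth (\<lambda>p. f p \<xi>)"
proof -
  have "smooth (\<lambda>p. (\<lambda>(p, \<xi>). f p \<xi>) (p, \<xi>))"
    by (rule Cinf_on_compose[OF _ assms]) (auto intro!: Cinf_intros)
  then show ?thesis by simp
qed

lemma test_fun_integrable:
  fixes \<phi> :: "'a::euclidean_space \<Rightarrow> complex"
  assumes "compact L" "test_fun \<phi>" "off L \<phi>"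
  shows "\<phi> integrable_on UNIV"
proof -
  obtain a b where "L \<subseteq> cbox a b" using compact_subset_cbox[OF assms(1)] .
  moreover have "continuous_on UNIV \<phi>" using assms(2) by (simp add: test_fun_def Cinf_on_imp_continuous_on)
  ultimately show ?thesis using test_integral[of \<phi> a b] assms(3) by blast
qed

lemma test_fun_comb:
  fixes f g :: "'a::euclidean_space \<Rightarrow> complex"
  assumes L: "compact L" and f: "test_fun f" "off L f" and g: "test_fun g" "off L g"
  shows "test_fun (\<lambda>\<xi>. f \<xi> + complex_of_real s * g \<xi>)"
    and "integral UNIV (\<lambda>\<xi>. f \<xi> + complex_of_real s * g \<xi>) = integral UNIV f + complex_of_real s * integral UNIV g"
proof -
  have "smooth f" "smooth g" using f g by (auto simp: test_fun_def)
  then have "smooth (\<lambda>\<xi>. f \<xi> + complex_of_real s * g \<xi>)" by (intro Cinf_intros open_UNIV)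
  then show "test_fun (\<lambda>\<xi>. f \<xi> + complex_of_real s * g \<xi>)"
    by (rule test_funI[OF L]) (use f g in simp)
  show "integral UNIV (\<lambda>\<xi>. f \<xi> + complex_of_real s * g \<xi>) = integral UNIV f + complex_of_real s * integral UNIV g"
    using test_fun_integrable[OF L f] test_fun_integrable[OF L g]
    by (simp add: integral_add integrable_on_mult_right)
qed

lemma UL_padd:
  assumes L: "compact L" and p: "p \<in> UL L" and w: "w \<in> WL L"
  shows "padd p s w \<in> UL L"
  using test_fun_comb[OF L, of "fst p" "fst w" s] p w by (simp add: UL_def WL_def padd_def A0_def A00_def)

lemma WL_padd:
  assumes L: "compact L" and p: "p \<in> WL L" and w: "w \<in> WL L"
  shows "padd p s w \<in> WL L"
  using test_fun_comb[OF L, of "fst p" "fst w" s] p w by (simp add: WL_def padd_def A00_def)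

lemma UL_plot_const: "p \<in> UL L \<Longrightarrow> plot (\<lambda>_. p)" and WL_plot_const: "p \<in> WL L \<Longrightarrow> plot (\<lambda>_. p)"
  by (rule plot_const, simp add: UL_def WL_def A0_def A00_def test_fun_def)+

lemma WL_zero: "compact L \<Longrightarrow> ((\<lambda>_. 0), x) \<in> WL L"
  unfolding WL_def A00_def by (auto intro!: test_funI Cinf_on_const)

text \<open>Hadamard's lemma: q h is the mean velocity between t0 and t0 + h, the integral of c'(t0
  + u h) over u in [0, 1]. The quotient is thus smooth at h = 0 too, which turns motion along a
  curve into motion along a smoothly varying direction.\<close>

lemma plot_hadamard:
  fixes c :: "real \<Rightarrow> ('a::euclidean_space \<Rightarrow> complex) \<times> 'a"
  assumes c: "plot c"
  shows "\<exists>q. plot q \<and> (\<forall>h::real. c (t0 + h) = padd (c t0) h (q h)) \<and> q 0 = dcurve c t0"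
proof -
  define f where "f z = fst (c (fst z)) (snd z)" for z :: "real \<times> 'a"
  define g where "g t = snd (c t)" for t
  have f: "smooth f" and g: "smooth g" using c by (auto simp: plot_def f_def[abs_def] g_def[abs_def] split_def)
  have df: "((\<lambda>s. f (s, \<xi>)) has_vector_derivative pd [(1, 0)] f (t, \<xi>)) (at t)" for t \<xi>
  proof -
    have "smooth (\<lambda>s. f (s, \<xi>))" by (rule Cinf_on_compose[OF _ f]) (auto intro!: Cinf_intros)
    from Cinf_on_has_vector_derivative[OF this, of t] show ?thesis by simp
  qed
  have dg: "(g has_vector_derivative pd [1] g t) (at t)" for t
    by (rule Cinf_on_has_vector_derivative[OF g]) simp
  define q where "q h = ((\<lambda>\<xi>. integral {0..1} (\<lambda>u. pd [(1, 0)] f (t0 + u * h, \<xi>))), integral {0..1} (\<lambda>u. pd [1] g (t0 + u * h)))" for h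
  have "smooth (\<lambda>z::real \<times> real \<times> 'a. pd [(1, 0)] f (t0 + fst z * fst (snd z), snd (snd z)))"
    by (rule Cinf_on_compose[OF _ Cinf_on_pd[OF f]]) (auto intro!: Cinf_intros)
  from Cinf_on_integral[OF this] have q1: "smooth (\<lambda>z. fst (q (fst z)) (snd z))" by (simp add: q_def)
  have "smooth (\<lambda>z::real \<times> real. pd [1] g (t0 + fst z * snd z))"
    by (rule Cinf_on_compose[OF _ Cinf_on_pd[OF g]]) (auto intro!: Cinf_intros)
  from Cinf_on_integral[OF this] have q2: "smooth (\<lambda>h. snd (q h))" by (simp add: q_def)
  have ftc: "k (t0 + h) = k t0 + h *\<^sub>R integral {0..1} (\<lambda>u. k' (t0 + u * h))"
    if k: "\<And>t. (k has_vector_derivative k' t) (at t)" for k k' :: "real \<Rightarrow> 'c::euclidean_space" and h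
  proof -
    have "((\<lambda>u. t0 + u * h) has_vector_derivative h) (at u)" for u
      by (auto intro!: derivative_eq_intros)
    from vector_diff_chain_at[OF this k]
    have "((\<lambda>u. k (t0 + u * h)) has_vector_derivative h *\<^sub>R k' (t0 + u * h)) (at u within {0..1})" for u
      by (simp add: o_def has_vector_derivative_at_within)
    then have "((\<lambda>u. h *\<^sub>R k' (t0 + u * h)) has_integral k (t0 + 1 * h) - k (t0 + 0 * h)) {0..1}"
      by (intro fundamental_theorem_of_calculus) auto
    from integral_unique[OF this]
    have "h *\<^sub>R integral {0..1} (\<lambda>u. k' (t0 + u * h)) = k (t0 + h) - k t0" by simp
    then show ?thesis by (simp add: algebra_simps)
  qed
  have "c (t0 + h) = padd (c t0) h (q h)" for h
  proof (rule prod_eqI)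
    show "fst (c (t0 + h)) = fst (padd (c t0) h (q h))"
    proof
      fix \<xi>
      have "f (t0 + h, \<xi>) = f (t0, \<xi>) + h *\<^sub>R integral {0..1} (\<lambda>u. pd [(1, 0)] f (t0 + u * h, \<xi>))" by (rule ftc[OF df])
      then show "fst (c (t0 + h)) \<xi> = fst (padd (c t0) h (q h)) \<xi>"
        by (simp add: f_def padd_def q_def scaleR_conv_of_real del: pd.simps)
    qed
    show "snd (c (t0 + h)) = snd (padd (c t0) h (q h))"
      using ftc[OF dg, of h] by (simp add: g_def padd_def q_def del: pd.simps)
  qed
  moreover have "q 0 = dcurve c t0"
  proof -
    have "vector_derivative (\<lambda>s. fst (c s) \<xi>) (at t0) = pd [(1, 0)] f (t0, \<xi>)" for \<xi>
      using vector_derivative_at[OF df[of \<xi> t0]] by (simp only: f_def[abs_def] fst_conv snd_conv)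
    moreover have "vector_derivative (\<lambda>s. snd (c s)) (at t0) = pd [1] g t0"
      using vector_derivative_at[OF dg[of t0]] by (simp only: g_def[abs_def])
    ultimately show ?thesis by (simp add: q_def dcurve_def del: pd.simps)
  qed
  ultimately show ?thesis using q1 q2 by (intro exI[of _ q]) (auto simp: plot_def split_def)
qed

text \<open>For nonzero h the quotient is a scaled difference of two points of the same affine
  space, so it vanishes off L and has integral 0; both properties pass to h = 0 by continuity.
  Curves of points and curves of directions are treated together because the Leibniz rule
  differentiates both.\<close>

lemma hadamard_WL:
  assumes L: "compact L" and c: "plot c" and cU: "(\<forall>t. c t \<in> UL L) \<or> (\<forall>t. c t \<in> WL L)"
    and q: "plot q" "\<And>h::real. c (t0 + h) = padd (c t0) h (q h)"
  shows "q h \<in> WL L"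
proof -
  obtain a b where ab: "L \<subseteq> cbox a b" using compact_subset_cbox[OF L] .
  have C: "smooth (fst (c t))" "smooth (fst (q t))" for t
    using c q Cinf_on_slice[of "\<lambda>t. fst (c t)"] Cinf_on_slice[of "\<lambda>t. fst (q t)"] unfolding plot_def by auto
  have cv: "fst (c t) \<xi> = 0" if "\<xi> \<notin> L" for t \<xi> using cU that by (auto simp: UL_def WL_def)
  have e: "fst (c (t0 + h)) \<xi> = fst (c t0) \<xi> + complex_of_real h * fst (q h) \<xi>" for h \<xi>
    using q(2)[of h] by (simp add: padd_def)
  have qv: "fst (q h) \<xi> = 0" if x: "\<xi> \<notin> L" for h \<xi>
  proof -
    have k: "fst (q h) \<xi> = 0" if "h \<noteq> 0" for h using e[of h \<xi>] cv[OF x] that by simp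
    have "smooth (\<lambda>h. fst (q h) \<xi>)" using q(1) Cinf_on_slice'[of "\<lambda>t. fst (q t)"] by (simp add: plot_def)
    then have "isCont (\<lambda>h. fst (q h) \<xi>) 0"
      using Cinf_on_imp_continuous_on continuous_on_eq_continuous_at open_UNIV by blast
    moreover have "((\<lambda>h. fst (q h) \<xi>) \<longlongrightarrow> 0) (at 0)"
      by (rule Lim_transform_eventually[OF tendsto_const]) (auto simp: k eventually_at_filter)
    ultimately have "fst (q 0) \<xi> = 0" unfolding isCont_def using LIM_unique by blast
    with k show ?thesis by (cases "h = 0") auto
  qed
  have hi: "(fst (c t) has_integral integral (cbox a b) (fst (c t))) UNIV" "(fst (q t) has_integral integral (cbox a b) (fst (q t))) UNIV" for t
    by (rule test_integral[OF Cinf_on_imp_continuous_on[OF C(1)]], use cv ab in blast)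
       (rule test_integral[OF Cinf_on_imp_continuous_on[OF C(2)]], use qv ab in blast)
  have ci: "integral (cbox a b) (fst (c t)) = integral (cbox a b) (fst (c t0))" for t
    using hi(1)[THEN integral_unique] cU unfolding UL_def WL_def A0_def A00_def by auto
  have q0: "integral (cbox a b) (fst (q h)) = 0" if "h \<noteq> 0" for h
  proof -
    have eq: "fst (q h) = (\<lambda>\<xi>. (fst (c (t0 + h)) \<xi> - fst (c t0) \<xi>) / complex_of_real h)"
      using e[of h] that by auto
    have hi': "(fst (c (t0 + h)) has_integral integral (cbox a b) (fst (c t0))) UNIV"
      by (rule hi(1)[of "t0 + h", unfolded ci[of "t0 + h"]])
    have i: "(fst (q h) has_integral (integral (cbox a b) (fst (c t0)) - integral (cbox a b) (fst (c t0))) / complex_of_real h) UNIV"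
      unfolding eq by (rule has_integral_divide[OF has_integral_diff[OF hi' hi(1)[of t0]]])
    from has_integral_unique[OF hi(2)[of h] i] show ?thesis by simp
  qed
  have "continuous_on UNIV (\<lambda>h. integral (cbox a b) (fst (q h)))"
  proof (rule integral_continuous_on_param)
    show "continuous_on (UNIV \<times> cbox a b) (\<lambda>(x, t). fst (q x) t)"
      using q(1) Cinf_on_imp_continuous_on continuous_on_subset unfolding plot_def by blast
  qed
  then have "isCont (\<lambda>h. integral (cbox a b) (fst (q h))) 0" by (simp add: continuous_on_eq_continuous_at)
  moreover have "((\<lambda>h. integral (cbox a b) (fst (q h))) \<longlongrightarrow> 0) (at 0)"
    by (rule Lim_transform_eventually[OF tendsto_const]) (auto simp: q0 eventually_at_filter)
  ultimately have "integral (cbox a b) (fst (q 0)) = 0" unfolding isCont_def using LIM_unique by blast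
  with q0 have "integral (cbox a b) (fst (q h)) = 0" by (cases "h = 0") auto
  with integral_unique[OF hi(2)[of h]] have "integral UNIV (fst (q h)) = 0" by simp
  with qv C show ?thesis unfolding WL_def A00_def using test_funI[OF L] by blast
qed

lemma dcurve_WL:
  assumes L: "compact L" and c: "plot c" and cU: "(\<forall>t. c t \<in> UL L) \<or> (\<forall>t. c t \<in> WL L)"
  shows "dcurve c t0 \<in> WL L"
  using plot_hadamard[OF c, of t0] hadamard_WL[OF L c cU] by metis

text \<open>All that is used of R, of the scaling and of theta: a function on \<open>UL L\<close>,
  whose second component is unrestricted, that is smooth along plots. This set is invariant under
  adding directions from \<open>WL L\<close>, so no domain condition accompanies a
  derivative.\<close>

locale curve_functional =
  fixes L :: "'a::euclidean_space set" and G :: "('a \<Rightarrow> complex) \<times> 'a \<Rightarrow> complex"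
  assumes L: "compact L"
    and G: "\<And>c::real \<Rightarrow> _. plot c \<Longrightarrow> (\<And>t. c t \<in> UL L) \<Longrightarrow> smooth (\<lambda>t. G (c t))"
begin

text \<open>The outermost derivative is the partial derivative in s, at s = 0, of a function H of
  (t, s). Along any smooth plane curve H is an instance of the statement with one direction fewer,
  so \<open>Boman_plane\<close> makes H smooth. The induction is over the length, since the
  directions are reparametrised along that curve.\<close>

lemma DD_curve:
  fixes c :: "real \<Rightarrow> _"
  assumes "plot c" "\<And>t. c t \<in> UL L" "\<And>w. w \<in> set ws \<Longrightarrow> plot w" "\<And>w t. w \<in> set ws \<Longrightarrow> w t \<in> WL L"
  shows "smooth (\<lambda>t. DD G (map (\<lambda>w. w t) ws) (c t))"
  using assms
proof (induction "length ws" arbitrary: c ws)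
  case 0 then show ?case using G by simp
next
  case (Suc n)
  then obtain w vs where ws: "ws = w # vs" "length vs = n" by (metis length_Suc_conv)
  have w: "plot w" "\<And>t. w t \<in> WL L" using Suc.prems ws by auto
  define H where "H z = DD G (map (\<lambda>v. v (fst z)) vs) (padd (c (fst z)) (snd z) (w (fst z)))" for z :: "real \<times> real"
  have "smooth H"
  proof (rule Boman_plane)
    fix \<gamma> :: "real \<Rightarrow> real \<times> real" assume g: "smooth \<gamma>"
    have g1: "smooth (\<lambda>r. fst (\<gamma> r))" "smooth (\<lambda>r. snd (\<gamma> r))" using g by (intro Cinf_intros; simp)+
    have "smooth (\<lambda>r. DD G (map (\<lambda>v. v r) (map (\<lambda>v r. v (fst (\<gamma> r))) vs)) (padd (c (fst (\<gamma> r))) (snd (\<gamma> r)) (w (fst (\<gamma> r)))))"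
    proof (rule Suc.hyps(1))
      show "plot (\<lambda>r. padd (c (fst (\<gamma> r))) (snd (\<gamma> r)) (w (fst (\<gamma> r))))"
        by (intro plot_padd plot_compose[OF Suc.prems(1)] plot_compose[OF w(1)] g1)
      show "padd (c (fst (\<gamma> r))) (snd (\<gamma> r)) (w (fst (\<gamma> r))) \<in> UL L" for r
        by (intro UL_padd L Suc.prems w)
    next
      fix v assume "v \<in> set (map (\<lambda>v r. v (fst (\<gamma> r))) vs)"
      then obtain u where u: "u \<in> set vs" "v = (\<lambda>r. u (fst (\<gamma> r)))" by auto
      with Suc.prems(3,4) ws show "plot v" "\<And>t. v t \<in> WL L" by (auto intro: plot_compose g1)
    qed (simp add: ws)
    then show "smooth (\<lambda>r. H (\<gamma> r))" by (simp add: H_def comp_def)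
  qed
  from Cinf_on_pd[OF this, of "[(0, 1)]"]
  have "smooth (\<lambda>t. pd [(0, 1)] H (t, 0))"
    by (rule Cinf_on_compose[rotated]) (auto intro!: Cinf_intros)
  then show ?case by (simp add: ws H_def)
qed

lemma DD_plane:
  fixes c :: "real \<times> real \<Rightarrow> _"
  assumes "plot c" "\<And>t. c t \<in> UL L" "\<And>w. w \<in> set ws \<Longrightarrow> plot w" "\<And>w t. w \<in> set ws \<Longrightarrow> w t \<in> WL L"
  shows "smooth (\<lambda>t. DD G (map (\<lambda>w. w t) ws) (c t))"
proof (rule Boman_plane)
  fix \<gamma> :: "real \<Rightarrow> real \<times> real" assume g: "smooth \<gamma>"
  have "smooth (\<lambda>r. DD G (map (\<lambda>v. v r) (map (\<lambda>v r. v (\<gamma> r)) ws)) (c (\<gamma> r)))"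
  proof (rule DD_curve)
    fix v assume "v \<in> set (map (\<lambda>v r. v (\<gamma> r)) ws)"
    then obtain u where u: "u \<in> set ws" "v = (\<lambda>r. u (\<gamma> r))" by auto
    show "plot v" unfolding u(2) by (rule plot_compose[OF assms(3)[OF u(1)] g])
    show "v t \<in> WL L" for t unfolding u(2) by (rule assms(4)[OF u(1)])
  qed (use assms in \<open>auto intro: plot_compose g\<close>)
  then show "smooth (\<lambda>r. DD G (map (\<lambda>w. w (\<gamma> r)) ws) (c (\<gamma> r)))" by (simp add: comp_def)
qed

lemma DD_plane_const:
  fixes c :: "real \<times> real \<Rightarrow> _"
  assumes "plot c" "\<And>t. c t \<in> UL L" "set ws \<subseteq> WL L"
  shows "smooth (\<lambda>t. DD G ws (c t))"
  using DD_plane[OF assms(1,2), of "map (\<lambda>w _. w) ws"] assms(3)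
  by (auto simp: comp_def intro: WL_plot_const)

text \<open>Both sides are mixed second derivatives at the origin of one smooth function of two real
  parameters.\<close>

lemma DD_swap:
  assumes p: "p \<in> UL L" and w: "w \<in> WL L" "w' \<in> WL L" and vs: "set vs \<subseteq> WL L"
  shows "DD G (w # w' # vs) p = DD G (w' # w # vs) p"
proof -
  define H where "H z = DD G vs (padd (padd p (fst z) w) (snd z) w')" for z :: "real \<times> real"
  have "smooth H" unfolding H_def
    by (intro DD_plane_const vs UL_padd L p w plot_padd UL_plot_const[OF p] WL_plot_const[OF w(1)] WL_plot_const[OF w(2)] Cinf_on_linear
      bounded_linear_fst bounded_linear_snd open_UNIV)
  from pd_commute[OF this, of "(1, 0)" "(0, 1)" "(0, 0)"] show ?thesis
    by (simp add: H_def padd_commute[of p _ w' _ w])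
qed

lemma DD_move:
  assumes "p \<in> UL L" "w \<in> WL L" "set us \<subseteq> WL L" "set vs \<subseteq> WL L"
  shows "DD G (us @ w # vs) p = DD G (w # us @ vs) p"
  using assms
proof (induction us arbitrary: p)
  case (Cons u us)
  have "(\<lambda>s. DD G (us @ w # vs) (padd p s u)) = (\<lambda>s. DD G (w # us @ vs) (padd p s u))"
    by (intro ext Cons.IH UL_padd L) (use Cons.prems in auto)
  then have "DD G ((u # us) @ w # vs) p = DD G (u # w # us @ vs) p" by simp
  also have "\<dots> = DD G (w # u # us @ vs) p" by (rule DD_swap) (use Cons.prems in auto)
  finally show ?case by simp
qed simp

lemma DD_perm:
  assumes "mset xs = mset ys" "set xs \<subseteq> WL L" "p \<in> UL L"
  shows "DD G xs p = DD G ys p"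
  using assms
proof (induction xs arbitrary: ys p)
  case (Cons x xs)
  have "x \<in> set ys" using Cons.prems(1) by (metis list.set_intros(1) set_mset_mset)
  then obtain us vs where ys: "ys = us @ x # vs" by (meson split_list)
  have s: "set ys \<subseteq> WL L" using Cons.prems by (metis set_mset_mset)
  have m: "mset xs = mset (us @ vs)" using Cons.prems(1) ys by simp
  have "(\<lambda>s. DD G xs (padd p s x)) = (\<lambda>s. DD G (us @ vs) (padd p s x))"
    by (intro ext Cons.IH m UL_padd L) (use Cons.prems in auto)
  then have "DD G (x # xs) p = DD G (x # us @ vs) p" by simp
  also have "\<dots> = DD G ys p" unfolding ys by (rule DD_move[symmetric]) (use Cons.prems s ys in auto)
  finally show ?case .
qed simp

text \<open>The left side is the derivative of a smooth plane function in the direction (1, a), and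
  a total derivative is linear in the direction.\<close>

lemma DD_linear:
  assumes p: "p \<in> UL L" and w: "w \<in> WL L" "w' \<in> WL L" and vs: "set vs \<subseteq> WL L"
  shows "DD G (padd w a w' # vs) p = DD G (w # vs) p + complex_of_real a * DD G (w' # vs) p"
proof -
  define H where "H z = DD G vs (padd (padd p (fst z) w) (snd z) w')" for z :: "real \<times> real"
  have "smooth H" unfolding H_def
    by (intro DD_plane_const vs UL_padd L p w plot_padd UL_plot_const[OF p] WL_plot_const[OF w(1)] WL_plot_const[OF w(2)] Cinf_on_linear
      bounded_linear_fst bounded_linear_snd open_UNIV)
  then have "(H has_derivative (\<lambda>v. pd [v] H (0, 0))) (at (0, 0))" by (rule Cinf_on_has_derivative) simp
  then have lin: "linear (\<lambda>v. pd [v] H (0, 0))" by (rule has_derivative_linear)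
  have "((1, a) :: real \<times> real) = (1, 0) + a *\<^sub>R (0, 1)" by simp
  then have "pd [(1, a)] H (0, 0) = pd [(1, 0)] H (0, 0) + a *\<^sub>R pd [(0, 1)] H (0, 0)"
    using linear_add[OF lin] linear_cmul[OF lin] by metis
  then show ?thesis by (simp add: H_def padd_assoc padd_0 scaleR_conv_of_real)
qed

lemma DD_linear_mid:
  assumes p: "p \<in> UL L" and w: "w \<in> WL L" "w' \<in> WL L" and vs: "set us \<subseteq> WL L" "set vs \<subseteq> WL L"
  shows "DD G (us @ padd w a w' # vs) p = DD G (us @ w # vs) p + complex_of_real a * DD G (us @ w' # vs) p"
  using DD_linear[OF p w, of "us @ vs" a] vs p w WL_padd[OF L w(1,2)] by (simp add: DD_move)

text \<open>With the Hadamard quotient q, the curve is the diagonal of H (a, b), the value at c t0 +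
  b q a. The derivative along (1, 1) is the sum of the partials; the first vanishes because H does
  not depend on a for b = 0, the second is the derivative in direction q 0.\<close>

lemma DD_chain:
  assumes c: "plot c" "\<And>t. c t \<in> UL L" and us: "set us \<subseteq> WL L"
  shows "((\<lambda>t. DD G us (c t)) has_vector_derivative DD G (dcurve c t0 # us) (c t0)) (at t0)"
proof -
  obtain q where q: "plot q" "\<And>h::real. c (t0 + h) = padd (c t0) h (q h)" "q 0 = dcurve c t0"
    using plot_hadamard[OF c(1), of t0] by blast
  have qW: "q h \<in> WL L" for h using hadamard_WL[OF L c(1) _ q(1,2)] c(2) by blast
  define H where "H z = DD G us (padd (c t0) (snd z) (q (fst z)))" for z :: "real \<times> real"
  have H: "smooth H" unfolding H_def
    by (intro DD_plane_const us UL_padd L c qW plot_padd UL_plot_const[OF c(2)] plot_compose[OF q(1)] Cinf_on_linear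
      bounded_linear_fst bounded_linear_snd open_UNIV)
  then have "(H has_derivative (\<lambda>v. pd [v] H (0, 0))) (at (0, 0))" by (rule Cinf_on_has_derivative) simp
  then have lin: "linear (\<lambda>v. pd [v] H (0, 0))" by (rule has_derivative_linear)
  have "((1, 1) :: real \<times> real) = (1, 0) + (0, 1)" by simp
  then have "pd [(1, 1)] H (0, 0) = pd [(1, 0)] H (0, 0) + pd [(0, 1)] H (0, 0)"
    using linear_add[OF lin] by metis
  also have "pd [(1, 0)] H (0, 0) = 0" by (simp add: H_def padd_0 vector_derivative_const_at)
  also have "pd [(0, 1)] H (0, 0) = DD G (dcurve c t0 # us) (c t0)" by (simp add: H_def q)
  finally have "((\<lambda>h. H ((0, 0) + h *\<^sub>R (1, 1))) has_vector_derivative DD G (dcurve c t0 # us) (c t0)) (at 0)"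
    using Cinf_on_dir[OF H, of "(0, 0)" "(1, 1)"] by simp
  then have "((\<lambda>h. DD G us (c (t0 + h))) has_vector_derivative DD G (dcurve c t0 # us) (c t0)) (at 0)"
    by (simp add: H_def q(2))
  then show ?thesis by (simp only: has_vector_derivative_shift[of "\<lambda>t. DD G us (c t)"])
qed

text \<open>Linearity in the slot turns the increment into h times a function f smooth in h; its
  derivative at h = 0 is f 0, the value with q 0 = \<open>dcurve w t0\<close> in the slot.\<close>

lemma DD_slot:
  assumes p: "p \<in> UL L" and w: "plot w" "\<And>t. w t \<in> WL L" and us: "set us \<subseteq> WL L" "set vs \<subseteq> WL L"
  shows "((\<lambda>t. DD G (us @ w t # vs) p) has_vector_derivative DD G (us @ dcurve w t0 # vs) p) (at t0)"
proof -
  obtain q where q: "plot q" "\<And>h::real. w (t0 + h) = padd (w t0) h (q h)" "q 0 = dcurve w t0"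
    using plot_hadamard[OF w(1), of t0] by blast
  have qW: "q h \<in> WL L" for h using hadamard_WL[OF L w(1) _ q(1,2)] w(2) by blast
  define f where "f h = DD G (us @ q h # vs) p" for h
  have "smooth (\<lambda>h. DD G (map (\<lambda>w. w h) (map (\<lambda>w _. w) us @ q # map (\<lambda>w _. w) vs)) p)"
    by (rule DD_curve) (use p w us q(1) qW in \<open>auto intro: UL_plot_const WL_plot_const\<close>)
  then have f: "smooth f" by (simp add: f_def[abs_def] comp_def)
  have "((\<lambda>h. complex_of_real h * f h) has_vector_derivative complex_of_real 0 * pd [1] f 0 + complex_of_real 1 * f 0) (at 0)"
    by (intro has_vector_derivative_mult has_vector_derivative_of_real has_vector_derivative_id
      Cinf_on_has_vector_derivative[OF f]) auto
  then have "((\<lambda>h. DD G (us @ w t0 # vs) p + complex_of_real h * f h) has_vector_derivative 0 + f 0) (at 0)"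
    by (intro has_vector_derivative_add has_vector_derivative_const) simp
  then have "((\<lambda>h. DD G (us @ w (t0 + h) # vs) p) has_vector_derivative f 0) (at 0)"
    unfolding q(2) f_def using DD_linear_mid[OF p w(2) qW us] by simp
  then show ?thesis
    unfolding has_vector_derivative_shift[of "\<lambda>t. DD G (us @ w t # vs) p"] by (simp add: f_def q)
qed

text \<open>The first moving direction gets its own time variable, everything else a second one; on
  the diagonal of this plane function \<open>DD_slot\<close> and the induction hypothesis supply the
  two partials. The prefix us collects the directions already frozen.\<close>

lemma DD_Leibniz:
  assumes c: "plot c" "\<And>t. c t \<in> UL L" and ws: "\<And>w. w \<in> set ws \<Longrightarrow> plot w" "\<And>w t. w \<in> set ws \<Longrightarrow> w t \<in> WL L"
    and us: "set us \<subseteq> WL L"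
  shows "((\<lambda>t. DD G (us @ map (\<lambda>w. w t) ws) (c t)) has_vector_derivative
      DD G (dcurve c t0 # us @ map (\<lambda>w. w t0) ws) (c t0) +
      (\<Sum>i<length ws. DD G (us @ (map (\<lambda>w. w t0) ws)[i := dcurve (ws ! i) t0]) (c t0))) (at t0)"
  using ws us
proof (induction ws arbitrary: us)
  case Nil then show ?case using DD_chain[OF c] by simp
next
  case (Cons w ws)
  define K where "K z = DD G (us @ w (fst z) # map (\<lambda>v. v (snd z)) ws) (c (snd z))" for z :: "real \<times> real"
  have "smooth (\<lambda>z. DD G (map (\<lambda>v. v z) (map (\<lambda>w _. w) us @ (\<lambda>z. w (fst z)) # map (\<lambda>v z. v (snd z)) ws)) (c (snd z)))"
  proof (rule DD_plane)
    fix v :: "real \<times> real \<Rightarrow> ('a \<Rightarrow> complex) \<times> 'a"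
    assume v: "v \<in> set (map (\<lambda>w _. w) us @ (\<lambda>z. w (fst z)) # map (\<lambda>v z. v (snd z)) ws)"
    have L2: "smooth (fst :: real \<times> real \<Rightarrow> real)" "smooth (snd :: real \<times> real \<Rightarrow> real)"
      by (intro Cinf_on_linear bounded_linear_fst bounded_linear_snd open_UNIV)+
    show "plot v" using v Cons.prems by (auto intro!: WL_plot_const plot_compose[of _ fst] plot_compose[of _ snd] L2)
    show "v t \<in> WL L" for t using v Cons.prems by auto
  qed (use c in \<open>auto intro!: plot_compose[of c snd] Cinf_on_linear bounded_linear_snd\<close>)
  then have K: "smooth K" by (simp add: K_def[abs_def] comp_def)
  then have "(K has_derivative (\<lambda>v. pd [v] K (t0, t0))) (at (t0, t0))" by (rule Cinf_on_has_derivative) simp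
  then have lin: "linear (\<lambda>v. pd [v] K (t0, t0))" by (rule has_derivative_linear)
  have "((1, 1) :: real \<times> real) = (1, 0) + (0, 1)" by simp
  then have d: "pd [(1, 1)] K (t0, t0) = pd [(1, 0)] K (t0, t0) + pd [(0, 1)] K (t0, t0)"
    using linear_add[OF lin] by metis
  have shift: "vector_derivative (\<lambda>h. f (t0 + h)) (at 0) = D" if "(f has_vector_derivative D) (at t0)" for f :: "real \<Rightarrow> complex" and D
    using that by (simp add: has_vector_derivative_shift vector_derivative_at)
  have "((\<lambda>t. DD G (us @ w t # map (\<lambda>v. v t0) ws) (c t0)) has_vector_derivative
      DD G (us @ dcurve w t0 # map (\<lambda>v. v t0) ws) (c t0)) (at t0)"
    by (rule DD_slot) (use c Cons.prems in auto)
  from shift[OF this] have p1: "pd [(1, 0)] K (t0, t0) = DD G (us @ dcurve w t0 # map (\<lambda>v. v t0) ws) (c t0)"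
    by (simp add: K_def)
  have "((\<lambda>t. DD G ((us @ [w t0]) @ map (\<lambda>w. w t) ws) (c t)) has_vector_derivative
      DD G (dcurve c t0 # (us @ [w t0]) @ map (\<lambda>w. w t0) ws) (c t0) +
      (\<Sum>i<length ws. DD G ((us @ [w t0]) @ (map (\<lambda>w. w t0) ws)[i := dcurve (ws ! i) t0]) (c t0))) (at t0)"
    by (rule Cons.IH) (use Cons.prems in auto)
  from shift[OF this] have p2: "pd [(0, 1)] K (t0, t0) = DD G (dcurve c t0 # us @ map (\<lambda>w. w t0) (w # ws)) (c t0) +
      (\<Sum>i<length ws. DD G (us @ w t0 # (map (\<lambda>w. w t0) ws)[i := dcurve (ws ! i) t0]) (c t0))"
    by (simp add: K_def)
  have Kt: "((\<lambda>h. K ((t0, t0) + h *\<^sub>R (1, 1))) has_vector_derivative pd [(1, 1)] K (t0, t0)) (at 0)"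
    by (rule Cinf_on_dir[OF K]) simp
  have "((\<lambda>t. K ((t0, t0) + (t - t0) *\<^sub>R (1, 1))) has_vector_derivative 1 *\<^sub>R pd [(1, 1)] K (t0, t0)) (at t0)"
    by (intro vector_diff_chain_at[of "\<lambda>t. t - t0" 1 t0 "\<lambda>h. K ((t0, t0) + h *\<^sub>R (1, 1))", unfolded o_def])
      (use Kt in \<open>auto intro!: derivative_eq_intros simp del: pd.simps\<close>)
  then have "((\<lambda>t. DD G (us @ map (\<lambda>w. w t) (w # ws)) (c t)) has_vector_derivative pd [(1, 1)] K (t0, t0)) (at t0)"
    by (simp add: K_def del: pd.simps)
  then show ?case
    unfolding d p1 p2 by (simp add: sum.lessThan_Suc_shift algebra_simps del: sum.lessThan_Suc)
qed

end

section \<open>The functionals obtained from R by scaling\<close>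

text \<open>The cutoff is applied to the squared distance, which is smooth also at x0. Points of the
  ball are contracted towards x0 and all others are sent to x0; near x0 nothing moves, so composing
  with theta preserves all derivatives there.\<close>

lemma localizer:
  fixes x0 :: "'a::euclidean_space"
  assumes r: "r > 0"
  obtains \<theta> where "smooth \<theta>" "\<And>y. \<theta> y \<in> ball x0 r" "\<And>y. y \<in> ball x0 (r/2) \<Longrightarrow> \<theta> y = y"
proof -
  define s where "s y = (1 / r^2) *\<^sub>R ((y - x0) \<bullet> (y - x0))" for y
  define \<theta> where "\<theta> y = x0 + cutoff (s y) *\<^sub>R (y - x0)" for y
  have id: "smooth (\<lambda>y::'a. y - x0)" by (intro Cinf_intros open_UNIV)
  have s: "smooth s" unfolding s_def by (intro Cinf_on_scaleR Cinf_on_inner id Cinf_on_const open_UNIV)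
  have C: "smooth \<theta>" unfolding \<theta>_def
    by (intro Cinf_on_add Cinf_on_scaleR id Cinf_on_const open_UNIV Cinf_on_compose[OF s Cinf_cutoff]) auto
  have sn: "s y = (norm (y - x0) / r) ^ 2" for y by (simp add: s_def power_divide dot_square_norm)
  have "\<theta> y \<in> ball x0 r" for y
  proof (cases "norm (y - x0) < r")
    case True
    have "norm (\<theta> y - x0) = cutoff (s y) * norm (y - x0)" using cutoff_nonneg[of "s y"] by (simp add: \<theta>_def)
    also have "\<dots> \<le> 1 * norm (y - x0)" by (intro mult_right_mono cutoff_le_1) simp
    finally show ?thesis using True by (simp add: dist_norm norm_minus_commute)
  next
    case False
    then have "1 \<le> (norm (y - x0) / r) ^ 2" using r by (intro one_le_power) simp
    then have "cutoff (s y) = 0" by (intro cutoff_eq_0) (simp add: sn)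
    then show ?thesis using r by (simp add: \<theta>_def)
  qed
  moreover have "\<theta> y = y" if "y \<in> ball x0 (r/2)" for y
  proof -
    have "norm (y - x0) / r \<le> 1/2" using that r by (simp add: dist_norm norm_minus_commute field_simps)
    then have "(norm (y - x0) / r) ^ 2 \<le> (1/2) ^ 2" using r by (intro power_mono) auto
    then have "s y \<le> 1/4" by (simp only: sn) (simp add: power2_eq_square)
    moreover have "0 \<le> s y" by (simp add: sn)
    ultimately have "\<bar>s y\<bar> \<le> 1/2" by simp
    then have "cutoff (s y) = 1" by (rule cutoff_eq_1)
    then show ?thesis by (simp add: \<theta>_def)
  qed
  ultimately show thesis using that C by blast
qed

section \<open>Scaling of test functions and the domain U(Omega)\<close>

lemma Seps_support:
  assumes e: "\<epsilon> > 0" and v: "off L \<phi>"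
  shows "\<forall>\<xi>. \<xi> \<notin> (\<lambda>\<xi>. \<epsilon> *\<^sub>R \<xi>) ` L \<longrightarrow> Seps \<epsilon> \<phi> \<xi> = 0"
proof (intro allI impI)
  fix \<xi> assume x: "\<xi> \<notin> (\<lambda>\<xi>. \<epsilon> *\<^sub>R \<xi>) ` L"
  have "inverse \<epsilon> *\<^sub>R \<xi> \<notin> L"
  proof
    assume "inverse \<epsilon> *\<^sub>R \<xi> \<in> L"
    then have "\<epsilon> *\<^sub>R (inverse \<epsilon> *\<^sub>R \<xi>) \<in> (\<lambda>\<xi>. \<epsilon> *\<^sub>R \<xi>) ` L" by (rule imageI)
    with x e show False by simp
  qed
  with v show "Seps \<epsilon> \<phi> \<xi> = 0" by (simp add: Seps_def)
qed

lemma Seps_A0: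
  assumes e: "\<epsilon> > 0" and L: "compact L" and p: "\<phi> \<in> A0" "off L \<phi>"
  shows "Seps \<epsilon> \<phi> \<in> A0"
proof -
  have C: "smooth \<phi>" using p by (auto simp: A0_def test_fun_def)
  have lin: "smooth (\<lambda>\<xi>::'a. inverse \<epsilon> *\<^sub>R \<xi>)" by (intro Cinf_on_linear bounded_linear_scaleR_right open_UNIV)
  have CS: "smooth (Seps \<epsilon> \<phi>)" unfolding Seps_def
    by (intro Cinf_on_mult Cinf_on_const open_UNIV Cinf_on_compose[OF lin C]) auto
  have t: "test_fun (Seps \<epsilon> \<phi>)"
    by (rule test_funI[OF _ CS Seps_support[OF e p(2)]]) (intro compact_scaling L)
  obtain a b where ab: "L \<subseteq> cbox a b" using compact_subset_cbox[OF L] .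
  have "(\<phi> has_integral integral (cbox a b) \<phi>) UNIV"
    by (rule test_integral[OF Cinf_on_imp_continuous_on[OF C]]) (use p ab in blast)
  from integral_unique[OF this] have I1: "integral (cbox a b) \<phi> = 1" using p by (auto simp: A0_def)
  have "\<phi> integrable_on cbox a b"
    by (rule integrable_continuous) (rule Cinf_on_imp_continuous_on[OF C, THEN continuous_on_subset], simp)
  then have "(\<phi> has_integral 1) (cbox a b)" using I1 by (metis integrable_integral)
  from has_integral_affinity[OF this, of "inverse \<epsilon>" 0] e
  have "((\<lambda>\<xi>. \<phi> (inverse \<epsilon> *\<^sub>R \<xi>)) has_integral (\<epsilon> ^ DIM('a)) *\<^sub>R 1) ((\<lambda>x. \<epsilon> *\<^sub>R x) ` cbox a b)"
    by (simp add: power_inverse inverse_eq_divide[symmetric])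
  then have "(Seps \<epsilon> \<phi> has_integral complex_of_real (inverse (\<epsilon> ^ DIM('a))) * ((\<epsilon> ^ DIM('a)) *\<^sub>R 1)) ((\<lambda>x. \<epsilon> *\<^sub>R x) ` cbox a b)"
    unfolding Seps_def by (rule has_integral_mult_right)
  then have "(Seps \<epsilon> \<phi> has_integral 1) ((\<lambda>x. \<epsilon> *\<^sub>R x) ` cbox a b)"
    using e by (simp add: scaleR_conv_of_real)
  then have "(Seps \<epsilon> \<phi> has_integral 1) UNIV"
    by (rule has_integral_on_superset) (use Seps_support[OF e p(2)] ab in auto)
  with t show ?thesis by (simp add: A0_def integral_unique)
qed

lemma Seps_UOm:
  assumes e: "\<epsilon> > 0" and L: "compact L" and p: "\<phi> \<in> A0" "off L \<phi>"
    and x: "x \<in> \<Omega>" "\<And>\<xi>. \<xi> \<in> L \<Longrightarrow> x + \<epsilon> *\<^sub>R \<xi> \<in> \<Omega>"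
  shows "(Seps \<epsilon> \<phi>, x) \<in> UOm \<Omega>"
proof -
  have "tsupp (Seps \<epsilon> \<phi>) \<subseteq> (\<lambda>\<xi>. \<epsilon> *\<^sub>R \<xi>) ` L"
    using vanish_tsupp[OF compact_scaling[OF L]] Seps_support[OF e p(2)] by blast
  also have "\<dots> \<subseteq> (\<lambda>y. y - x) ` \<Omega>"
  proof
    fix z assume "z \<in> (\<lambda>\<xi>. \<epsilon> *\<^sub>R \<xi>) ` L"
    then have "x + z \<in> \<Omega>" using x(2) by auto
    then show "z \<in> (\<lambda>y. y - x) ` \<Omega>" by (intro image_eqI[of _ _ "x + z"]) auto
  qed
  finally show ?thesis using Seps_A0[OF e L p] x by (simp add: UOm_def)
qed

text \<open>The whole scaled curve is supported in the fixed compact set of all eps xi with xi in L,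
  so it is a smooth curve of test functions to which \<open>Ed\<close> applies.\<close>

lemma curve_functional_Seps:
  fixes R :: "('a::euclidean_space \<Rightarrow> complex) \<times> 'a \<Rightarrow> complex"
  assumes R: "Ed \<Omega> R" and e: "\<epsilon> > 0" and L: "compact L" and \<theta>: "smooth \<theta>"
    and x: "\<And>y. \<theta> y \<in> \<Omega>" "\<And>y \<xi>. \<xi> \<in> L \<Longrightarrow> \<theta> y + \<epsilon> *\<^sub>R \<xi> \<in> \<Omega>"
  shows "curve_functional L (\<lambda>(\<phi>, y). R (Seps \<epsilon> \<phi>, \<theta> y))"
proof
  show "compact L" by fact
  fix c :: "real \<Rightarrow> ('a \<Rightarrow> complex) \<times> 'a"
  assume c: "plot c" and cU: "\<And>t. c t \<in> UL L"
  define c1 where "c1 t = Seps \<epsilon> (fst (c t))" for t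
  define c2 where "c2 t = \<theta> (snd (c t))" for t
  have v: "fst (c t) \<in> A0" "off L (fst (c t))" for t using cU by (auto simp: UL_def)
  have "smooth_D_on UNIV c1"
    unfolding smooth_D_on_def
  proof (intro conjI ballI allI impI)
    show "test_fun (c1 t)" for t using Seps_A0[OF e L v, of t] by (simp add: c1_def A0_def)
    have l: "smooth (\<lambda>z::real \<times> 'a. (fst z, inverse \<epsilon> *\<^sub>R snd z))"
      by (intro Cinf_intros open_UNIV)
    have "smooth (\<lambda>(t, \<xi>). fst (c t) \<xi>)" using c by (simp add: plot_def)
    from Cinf_on_compose[OF l this] have "smooth (\<lambda>z. fst (c (fst z)) (inverse \<epsilon> *\<^sub>R snd z))" by simp
    then have "smooth (\<lambda>z. complex_of_real (inverse (\<epsilon> ^ DIM('a))) * fst (c (fst z)) (inverse \<epsilon> *\<^sub>R snd z))"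
      by (intro Cinf_on_mult Cinf_on_const open_UNIV)
    then show "Cinf_on (UNIV \<times> UNIV) (\<lambda>(t, \<xi>). c1 t \<xi>)" by (simp add: c1_def Seps_def split_def)
    fix M :: "real set"
    show "\<exists>K. compact K \<and> (\<forall>p\<in>M. tsupp (c1 p) \<subseteq> K)"
      using vanish_tsupp[OF compact_scaling[OF L]] Seps_support[OF e v(2)] compact_scaling[OF L]
      unfolding c1_def by (intro exI[of _ "(\<lambda>\<xi>. \<epsilon> *\<^sub>R \<xi>) ` L"]) blast
  qed simp
  moreover have "smooth c2"
    unfolding c2_def by (rule Cinf_on_compose[OF _ \<theta>]) (use c in \<open>auto simp: plot_def\<close>)
  moreover have "\<forall>t. (c1 t, c2 t) \<in> UOm \<Omega>"
    unfolding c1_def c2_def by (intro allI Seps_UOm[OF e L v] x)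
  ultimately have "smooth (\<lambda>t. R (c1 t, c2 t))" using R unfolding Ed_def by blast
  then show "smooth (\<lambda>t. (\<lambda>(\<phi>, y). R (Seps \<epsilon> \<phi>, \<theta> y)) (c t))" by (simp add: c1_def c2_def split_def)
qed

text \<open>For a point moving affinely the increments D v do not depend on y, so no Leibniz terms
  arise.\<close>

lemma pd_DD_affine:
  assumes "\<And>y h v. c (y + h *\<^sub>R v) = padd (c y) h (D v)"
  shows "pd \<beta> (\<lambda>y. DD G us (c y)) y = DD G (map D \<beta> @ us) (c y)"
  by (induction \<beta> arbitrary: y) (simp_all add: assms)

lemma pd_DD_second:
  "pd \<beta> (\<lambda>y. DD G us (\<phi>, y)) y = DD G (map (\<lambda>v. ((\<lambda>_. 0), v)) \<beta> @ us) (\<phi>, y)"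
  by (rule pd_DD_affine) (simp add: padd_def)

lemma d1_DD: "d1 G \<psi>s \<phi> y = DD G (map (\<lambda>\<psi>. (\<psi>, 0)) \<psi>s) (\<phi>, y)"
  by (induction \<psi>s arbitrary: \<phi>) (simp_all add: padd_def)

abbreviation (input) scaled_diff where
  "scaled_diff R \<epsilon> \<alpha> \<psi>s \<phi> x \<equiv> pd \<alpha> (\<lambda>y. d1 (\<lambda>(\<phi>', y'). R (Seps \<epsilon> \<phi>', y')) \<psi>s \<phi> y) x"

lemma pd_d1_DD:
  assumes "r > 0" "\<And>y. y \<in> ball x0 r \<Longrightarrow> \<theta> y = y"
  shows "scaled_diff R \<epsilon> \<alpha> \<psi>s \<phi> x0
    = DD (\<lambda>(\<phi>, y). R (Seps \<epsilon> \<phi>, \<theta> y)) (map (\<lambda>v. ((\<lambda>_. 0), v)) \<alpha> @ map (\<lambda>\<psi>. (\<psi>, 0)) \<psi>s) (\<phi>, x0)"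
proof -
  have "d1 (\<lambda>(\<phi>', y'). R (Seps \<epsilon> \<phi>', y')) \<psi>s \<phi> y = d1 (\<lambda>(\<phi>, y). R (Seps \<epsilon> \<phi>, \<theta> y)) \<psi>s \<phi> y" if "y \<in> ball x0 r" for y
    using assms(2)[OF that] by (induction \<psi>s arbitrary: \<phi>) simp_all
  then have "scaled_diff R \<epsilon> \<alpha> \<psi>s \<phi> x0 = pd \<alpha> (\<lambda>y. d1 (\<lambda>(\<phi>, y). R (Seps \<epsilon> \<phi>, \<theta> y)) \<psi>s \<phi> y) x0"
    using assms(1) by (intro pd_cong_on[of "ball x0 r"]) auto
  also have "\<dots> = pd \<alpha> (\<lambda>y. DD (\<lambda>(\<phi>, y). R (Seps \<epsilon> \<phi>, \<theta> y)) (map (\<lambda>\<psi>. (\<psi>, 0)) \<psi>s) (\<phi>, y)) x0"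
    by (simp only: d1_DD)
  finally show ?thesis by (simp only: pd_DD_second)
qed

section \<open>Compact neighbourhoods and bounded sets of test functions\<close>

lemma compact_neighbourhood:
  fixes K :: "'a::euclidean_space set"
  assumes "compact K" "open \<Omega>" "K \<subseteq> \<Omega>"
  obtains r K' where "r > 0" "compact K'" "K' \<subseteq> \<Omega>" "\<And>x y. x \<in> K \<Longrightarrow> dist x y \<le> r \<Longrightarrow> y \<in> K'"
proof -
  obtain e where e: "e > 0" "(\<Union>x\<in>K. ball x e) \<subseteq> \<Omega>"
    using compact_subset_open_imp_ball_epsilon_subset[OF assms] by blast
  define K' where "K' = (\<lambda>(x, z). x + z) ` (K \<times> cball 0 (e/2))"
  have "compact K'" unfolding K'_def split_def
    by (intro compact_continuous_image compact_Times assms compact_cball continuous_intros)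
  moreover have "K' \<subseteq> \<Omega>"
  proof
    fix y assume "y \<in> K'"
    then obtain x z where "x \<in> K" "norm z \<le> e/2" "y = x + z" by (auto simp: K'_def)
    then have "y \<in> ball x e" using e by (simp add: dist_norm)
    with \<open>x \<in> K\<close> e show "y \<in> \<Omega>" by blast
  qed
  moreover have "y \<in> K'" if "x \<in> K" "dist x y \<le> e/2" for x y
    unfolding K'_def by (rule image_eqI[of _ _ "(x, y - x)"]) (use that in \<open>auto simp: dist_norm norm_minus_commute\<close>)
  ultimately show thesis using that e(1) half_gt_zero by blast
qed

lemma small_support:
  assumes "compact L" "r > 0"
  obtains e where "e \<in> {0<..1}" "\<And>\<epsilon> \<xi>. 0 < \<epsilon> \<Longrightarrow> \<epsilon> < e \<Longrightarrow> \<xi> \<in> L \<Longrightarrow> norm (\<epsilon> *\<^sub>R \<xi>) \<le> r"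
proof -
  obtain b where b: "b > 0" "\<And>\<xi>. \<xi> \<in> L \<Longrightarrow> norm \<xi> \<le> b" using compact_imp_bounded[OF assms(1)] bounded_pos by blast
  show thesis
  proof (rule that[of "min 1 (r / b)"])
    fix \<epsilon> \<xi> assume *: "0 < \<epsilon>" "\<epsilon> < min 1 (r / b)" "\<xi> \<in> L"
    have "norm (\<epsilon> *\<^sub>R \<xi>) = \<epsilon> * norm \<xi>" using * by simp
    also have "\<dots> \<le> r / b * b" using * b by (intro mult_mono) auto
    finally show "norm (\<epsilon> *\<^sub>R \<xi>) \<le> r" using b by simp
  qed (use assms b in auto)
qed

lemma pd_linear_comb:
  fixes f g :: "'a::euclidean_space \<Rightarrow> complex"
  assumes "smooth f" "smooth g"
  shows "pd vs (\<lambda>\<xi>. f \<xi> + complex_of_real a * g \<xi>) = (\<lambda>\<xi>. pd vs f \<xi> + complex_of_real a * pd vs g \<xi>)"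
proof (induction vs)
  case (Cons v vs)
  show ?case
  proof
    fix \<xi>
    have "((\<lambda>h. pd vs f (\<xi> + h *\<^sub>R v) + complex_of_real a * pd vs g (\<xi> + h *\<^sub>R v)) has_vector_derivative
        pd [v] (pd vs f) \<xi> + complex_of_real a * pd [v] (pd vs g) \<xi>) (at 0)"
      by (intro has_vector_derivative_add has_vector_derivative_mult_right Cinf_on_dir[of UNIV] Cinf_on_pd assms) auto
    then show "pd (v # vs) (\<lambda>\<xi>. f \<xi> + complex_of_real a * g \<xi>) \<xi> = pd (v # vs) f \<xi> + complex_of_real a * pd (v # vs) g \<xi>"
      by (simp add: Cons.IH vector_derivative_at)
  qed
qed simp

abbreviation (input) combs :: "('a \<Rightarrow> complex) set \<Rightarrow> ('a \<Rightarrow> complex) set \<Rightarrow> real \<Rightarrow> ('a \<Rightarrow> complex) set" where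
  "combs A B D \<equiv> {\<lambda>\<xi>. f \<xi> + complex_of_real l * g \<xi> | f g l. f \<in> A \<and> g \<in> B \<and> \<bar>l\<bar> \<le> D}"

lemma bounded_D_comb:
  assumes A: "bounded_D A" and B: "bounded_D B"
  shows "bounded_D (combs A B D)"
proof -
  obtain K1 where K1: "compact K1" "\<forall>\<phi>\<in>A. tsupp \<phi> \<subseteq> K1" using A by (auto simp: bounded_D_def)
  obtain K2 where K2: "compact K2" "\<forall>\<phi>\<in>B. tsupp \<phi> \<subseteq> K2" using B by (auto simp: bounded_D_def)
  have K: "compact (K1 \<union> K2)" using K1 K2 by (intro compact_Un)
  have C: "smooth f" if "f \<in> A \<union> B" for f using that A B by (auto simp: bounded_D_def test_fun_def)
  have v: "\<forall>\<xi>. \<xi> \<notin> K1 \<union> K2 \<longrightarrow> f \<xi> = 0" if "f \<in> A \<union> B" for f using that K1 K2 vanish_tsupp[OF K, of f] by auto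
  show ?thesis
    unfolding bounded_D_def
  proof (intro conjI ballI allI impI)
    fix \<phi> assume "\<phi> \<in> combs A B D"
    then obtain f g l where f: "f \<in> A" "g \<in> B" "\<bar>l\<bar> \<le> D" "\<phi> = (\<lambda>\<xi>. f \<xi> + complex_of_real l * g \<xi>)" by blast
    show "test_fun \<phi>" unfolding f(4)
    proof (rule test_funI[OF K])
      have "smooth f" "smooth g" using f(1,2) by (simp_all add: C)
      then show "smooth (\<lambda>\<xi>. f \<xi> + complex_of_real l * g \<xi>)" by (intro Cinf_intros open_UNIV)
      show "\<forall>\<xi>. \<xi> \<notin> K1 \<union> K2 \<longrightarrow> f \<xi> + complex_of_real l * g \<xi> = 0"
        using f(1,2) v[of f] v[of g] by simp
    qed
  next
    show "\<exists>K. compact K \<and> (\<forall>\<phi>\<in>combs A B D. tsupp \<phi> \<subseteq> K)"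
    proof (rule exI[of _ "K1 \<union> K2"], intro conjI ballI K)
      fix \<phi> assume "\<phi> \<in> combs A B D"
      then obtain f g l where f: "f \<in> A" "g \<in> B" "\<phi> = (\<lambda>\<xi>. f \<xi> + complex_of_real l * g \<xi>)" by blast
      show "tsupp \<phi> \<subseteq> K1 \<union> K2" unfolding vanish_tsupp[OF K, symmetric] using f v[of f] v[of g] by auto
    qed
    fix vs :: "'a list" assume vs: "set vs \<subseteq> Basis"
    obtain C1 where C1: "\<forall>\<phi>\<in>A. \<forall>\<xi>. norm (pd vs \<phi> \<xi>) \<le> C1" using A vs unfolding bounded_D_def by blast
    obtain C2 where C2: "\<forall>\<phi>\<in>B. \<forall>\<xi>. norm (pd vs \<phi> \<xi>) \<le> C2" using B vs unfolding bounded_D_def by blast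
    show "\<exists>C. \<forall>\<phi>\<in>combs A B D. \<forall>\<xi>. norm (pd vs \<phi> \<xi>) \<le> C"
    proof (rule exI[of _ "C1 + D * C2"], intro ballI allI)
      fix \<phi> \<xi> assume "\<phi> \<in> combs A B D"
      then obtain f g l where f: "f \<in> A" "g \<in> B" "\<bar>l\<bar> \<le> D" "\<phi> = (\<lambda>\<xi>. f \<xi> + complex_of_real l * g \<xi>)" by blast
      have "norm (pd vs \<phi> \<xi>) \<le> norm (pd vs f \<xi>) + \<bar>l\<bar> * norm (pd vs g \<xi>)"
        unfolding f(4) using f by (subst pd_linear_comb) (auto intro!: C norm_triangle_le simp: norm_mult)
      also have "\<dots> \<le> C1 + D * C2" using C1 C2 f by (intro add_mono mult_mono) auto
      finally show "norm (pd vs \<phi> \<xi>) \<le> C1 + D * C2" .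
    qed
  qed
qed

lemma pd_const: "us \<noteq> [] \<Longrightarrow> pd us (\<lambda>_. c) = (\<lambda>_. 0)"
proof (induction us)
  case (Cons v us) then show ?case by (cases "us = []") (simp_all add: vector_derivative_const_at)
qed simp

lemma bounded_D_zero: "bounded_D {\<lambda>_::'a::euclidean_space. 0::complex}"
  unfolding bounded_D_def
proof (intro conjI allI impI)
  show "\<forall>\<phi>\<in>{\<lambda>_::'a. 0::complex}. test_fun \<phi>" using test_funI[of "{}" "\<lambda>_::'a. 0::complex"] by (auto intro: Cinf_on_const)
  show "\<exists>K. compact K \<and> (\<forall>\<phi>\<in>{\<lambda>_::'a. 0::complex}. tsupp \<phi> \<subseteq> K)" by (intro exI[of _ "{}"]) (simp add: tsupp_def)
  have "pd us (\<lambda>_::'a. 0::complex) = (\<lambda>_. 0)" for us by (cases "us = []") (simp_all add: pd_const)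
  then show "\<exists>C. \<forall>\<phi>\<in>{\<lambda>_::'a. 0::complex}. \<forall>\<xi>. norm (pd us \<phi> \<xi>) \<le> C" for us by auto
qed

lemma bounded_D_subset: "bounded_D B \<Longrightarrow> A \<subseteq> B \<Longrightarrow> bounded_D A"
  unfolding bounded_D_def by (meson subsetD)

lemma bounded_D_UN:
  fixes B :: "'i \<Rightarrow> ('a::euclidean_space \<Rightarrow> complex) set"
  assumes "finite I" "\<And>i. i \<in> I \<Longrightarrow> bounded_D (B i)"
  shows "bounded_D (\<Union>i\<in>I. B i)"
  using assms
proof (induction I rule: finite_induct)
  case empty then show ?case by (auto simp: bounded_D_def intro: exI[of _ "{}"])
next
  case (insert i I)
  then have A: "bounded_D (B i)" and B: "bounded_D (\<Union>i\<in>I. B i)" by auto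
  obtain K1 where K1: "compact K1" "\<forall>\<phi>\<in>B i. tsupp \<phi> \<subseteq> K1" using A by (auto simp: bounded_D_def)
  obtain K2 where K2: "compact K2" "\<forall>\<phi>\<in>(\<Union>i\<in>I. B i). tsupp \<phi> \<subseteq> K2" using B unfolding bounded_D_def by blast
  show ?case unfolding bounded_D_def
  proof (intro conjI allI impI)
    show "\<forall>\<phi>\<in>\<Union> (B ` insert i I). test_fun \<phi>" using A B by (auto simp: bounded_D_def)
    show "\<exists>K. compact K \<and> (\<forall>\<phi>\<in>\<Union> (B ` insert i I). tsupp \<phi> \<subseteq> K)"
      using K1 K2 by (intro exI[of _ "K1 \<union> K2"]) (auto intro: compact_Un)
    fix vs :: "'a list" assume vs: "set vs \<subseteq> Basis"
    obtain C1 where C1: "\<forall>\<phi>\<in>B i. \<forall>\<xi>. norm (pd vs \<phi> \<xi>) \<le> C1" using A vs unfolding bounded_D_def by blast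
    obtain C2 where C2: "\<forall>\<phi>\<in>(\<Union>i\<in>I. B i). \<forall>\<xi>. norm (pd vs \<phi> \<xi>) \<le> C2" using B vs unfolding bounded_D_def by blast
    show "\<exists>C. \<forall>\<phi>\<in>\<Union> (B ` insert i I). \<forall>\<xi>. norm (pd vs \<phi> \<xi>) \<le> C"
      using C1 C2 by (intro exI[of _ "max C1 C2"]) (fastforce simp: le_max_iff_disj)
  qed
qed

lemma bounded_D_support:
  assumes "bounded_D B"
  obtains L where "compact L" "\<And>\<phi>. \<phi> \<in> B \<Longrightarrow> off L \<phi>"
  using assms vanish_tsupp unfolding bounded_D_def by metis

section \<open>From the differential estimate to moderateness\<close>

declare DD.simps(2) [simp del]

text \<open>A pair of \<open>\<beta>\<close> and \<open>\<Gamma>\<close> stands for the summand in which the x-derivatives along \<open>\<beta>\<close> fall on the second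
  argument of G and the entries of \<open>\<Gamma>\<close> are the derivatives of the first argument that are inserted as directions.\<close>

fun chain_terms :: "'v list \<Rightarrow> ('v list \<times> 'v list list) list" where
  "chain_terms [] = [([], [])]"
| "chain_terms (v # \<alpha>) = concat (map (\<lambda>(\<beta>, \<Gamma>). (v # \<beta>, \<Gamma>) # (\<beta>, [v] # \<Gamma>) #
      map (\<lambda>i. (\<beta>, \<Gamma>[i := v # \<Gamma> ! i])) [0..<length \<Gamma>]) (chain_terms \<alpha>))"

text \<open>Nonemptiness is what matters: a derivative of positive order of an
  \<open>A0\<close>-valued map has integral 0 and so qualifies as a direction. The length bound
  leaves only finitely many multi-indices to control.\<close>

lemma chain_terms_props:
  "(\<beta>, \<Gamma>) \<in> set (chain_terms \<alpha>) \<Longrightarrow> set \<beta> \<subseteq> set \<alpha> \<and> (\<forall>\<gamma>\<in>set \<Gamma>. \<gamma> \<noteq> [] \<and> set \<gamma> \<subseteq> set \<alpha> \<and> length \<gamma> \<le> length \<alpha>)"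
proof (induction \<alpha> arbitrary: \<beta> \<Gamma>)
  case (Cons v \<alpha>)
  from Cons.prems obtain t where t: "t \<in> set (chain_terms \<alpha>)"
    and mt: "(\<beta>, \<Gamma>) \<in> set ((\<lambda>(\<beta>, \<Gamma>). (v # \<beta>, \<Gamma>) # (\<beta>, [v] # \<Gamma>) #
      map (\<lambda>i. (\<beta>, \<Gamma>[i := v # \<Gamma> ! i])) [0..<length \<Gamma>]) t)"
    by (simp only: chain_terms.simps set_concat set_map UN_iff image_iff) blast
  obtain \<beta>' \<Gamma>' where t': "t = (\<beta>', \<Gamma>')" by (cases t)
  have m: "(\<beta>, \<Gamma>) = (v # \<beta>', \<Gamma>') \<or> (\<beta>, \<Gamma>) = (\<beta>', [v] # \<Gamma>') \<or> (\<exists>i<length \<Gamma>'. (\<beta>, \<Gamma>) = (\<beta>', \<Gamma>'[i := v # \<Gamma>' ! i]))"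
    using mt unfolding t' by auto
  note IH = Cons.IH[OF t[unfolded t']]
  have upd: "set (\<Gamma>'[i := v # \<Gamma>' ! i]) \<subseteq> insert (v # \<Gamma>' ! i) (set \<Gamma>')" for i by (rule set_update_subset_insert)
  have \<Gamma>: "\<gamma> = [v] \<or> \<gamma> \<in> set \<Gamma>' \<or> (\<exists>\<gamma>'\<in>set \<Gamma>'. \<gamma> = v # \<gamma>')" if g: "\<gamma> \<in> set \<Gamma>" for \<gamma>
    using m
  proof (elim disjE exE conjE)
    fix i assume i: "i < length \<Gamma>'" "(\<beta>, \<Gamma>) = (\<beta>', \<Gamma>'[i := v # \<Gamma>' ! i])"
    then show ?thesis using g upd[of i] nth_mem[OF i(1)] by blast
  qed (use g in auto)
  have "set \<beta> \<subseteq> set (v # \<alpha>)" using m IH by auto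
  moreover have "\<gamma> \<noteq> [] \<and> set \<gamma> \<subseteq> set (v # \<alpha>) \<and> length \<gamma> \<le> length (v # \<alpha>)" if "\<gamma> \<in> set \<Gamma>" for \<gamma>
    using \<Gamma>[OF that] IH by fastforce
  ultimately show ?case by blast
qed simp

lemma has_vector_derivative_sum_list:
  "(\<And>x. x \<in> set xs \<Longrightarrow> (f x has_vector_derivative f' x) (at t)) \<Longrightarrow>
    ((\<lambda>t. \<Sum>x\<leftarrow>xs. f x t) has_vector_derivative (\<Sum>x\<leftarrow>xs. f' x)) (at t)"
  by (induction xs) (auto intro: has_vector_derivative_add)

lemma sum_list_map_concat: "(\<Sum>x\<leftarrow>concat xss. f x) = (\<Sum>xs\<leftarrow>xss. \<Sum>x\<leftarrow>xs. f x)"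
  by (induction xss) auto

context curve_functional
begin

text \<open>The point (Phi y, y) moves with velocity (d_v Phi, v), which linearity splits into (0,
  v) and (d_v Phi, 0); differentiating an inserted direction lengthens its multi-index by v. These
  are the three kinds of entries generated by \<open>chain_terms\<close>.\<close>

lemma higher_chain_rule:
  fixes \<Phi> :: "'a \<Rightarrow> 'a \<Rightarrow> complex"
  assumes \<Phi>: "smooth (\<lambda>(y, \<xi>). \<Phi> y \<xi>)" and \<Phi>U: "\<And>y. (\<Phi> y, y) \<in> UL L"
  defines "w \<equiv> \<lambda>\<gamma> y. ((\<lambda>\<xi>. pd \<gamma> (\<lambda>y. \<Phi> y \<xi>) y), 0)"
  shows "\<gamma> \<noteq> [] \<Longrightarrow> w \<gamma> y \<in> WL L"
    and "pd \<alpha> (\<lambda>y. G (\<Phi> y, y)) y =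
      (\<Sum>(\<beta>, \<Gamma>)\<leftarrow>chain_terms \<alpha>. DD G (map (\<lambda>v. ((\<lambda>_. 0), v)) \<beta> @ map (\<lambda>\<gamma>. w \<gamma> y) \<Gamma>) (\<Phi> y, y))"
proof -
  have pw: "plot (w \<gamma>)" for \<gamma>
  proof -
    define F where "F z = \<Phi> (fst z) (snd z)" for z :: "'a \<times> 'a"
    have F: "smooth F" using \<Phi> by (simp add: F_def[abs_def] split_def)
    have "pd (map (\<lambda>v. (v, 0)) \<gamma>) F z = pd \<gamma> (\<lambda>y. \<Phi> y (snd z)) (fst z)" for z
      by (induction \<gamma> arbitrary: z) (simp_all add: F_def)
    then have "smooth (\<lambda>z. pd \<gamma> (\<lambda>y. \<Phi> y (snd z)) (fst z))"
      by (intro Cinf_on_cong[OF Cinf_on_pd[OF F, of "map (\<lambda>v. (v, 0)) \<gamma>"]])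
    then show ?thesis unfolding w_def by (intro plotI Cinf_on_const open_UNIV) (simp add: split_def)
  qed
  have line: "smooth (\<lambda>t::real. y + t *\<^sub>R v)" for y v :: 'a by (intro Cinf_intros open_UNIV)
  have pc: "plot (\<lambda>y. (\<Phi> y, y))" by (rule plotI[OF \<Phi> Cinf_on_ident[OF open_UNIV]])
  have dc: "dcurve (\<lambda>t. (\<Phi> (y + t *\<^sub>R v), y + t *\<^sub>R v)) 0 = (fst (w [v] y), v)" for y v
  proof -
    have "((\<lambda>s. y + s *\<^sub>R v) has_vector_derivative v) (at 0)" by (auto intro!: derivative_eq_intros)
    then show ?thesis by (simp add: dcurve_def w_def vector_derivative_at)
  qed
  have dw: "dcurve (\<lambda>t. w \<gamma> (y + t *\<^sub>R v)) 0 = w (v # \<gamma>) y" for \<gamma> y v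
    by (simp add: dcurve_def w_def vector_derivative_const_at)
  show wW: "w \<gamma> y \<in> WL L" if "\<gamma> \<noteq> []" for \<gamma> y
    using that
  proof (induction \<gamma> arbitrary: y)
    case (Cons v \<gamma>)
    show ?case
    proof (cases "\<gamma> = []")
      case True
      have "dcurve (\<lambda>t. (\<Phi> (y + t *\<^sub>R v), y + t *\<^sub>R v)) 0 \<in> WL L"
        by (rule dcurve_WL[OF L plot_compose[OF pc line]]) (use \<Phi>U in simp)
      then show ?thesis unfolding dc True by (simp add: WL_def w_def)
    next
      case False
      then have "dcurve (\<lambda>t. w \<gamma> (y + t *\<^sub>R v)) 0 \<in> WL L"
        by (intro dcurve_WL[OF L plot_compose[OF pw line]]) (use Cons.IH in simp)
      then show ?thesis unfolding dw .
    qed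
  qed simp
  define Tm where "Tm t y = DD G (map (\<lambda>v. ((\<lambda>_. 0), v)) (fst t) @ map (\<lambda>\<gamma>. w \<gamma> y) (snd t)) (\<Phi> y, y)" for t y
  have zW: "((\<lambda>_. 0), v) \<in> WL L" for v by (rule WL_zero[OF L])
  have dT: "((\<lambda>h. Tm (\<beta>, \<Gamma>) (y + h *\<^sub>R v)) has_vector_derivative
      (\<Sum>t\<leftarrow>(v # \<beta>, \<Gamma>) # (\<beta>, [v] # \<Gamma>) # map (\<lambda>i. (\<beta>, \<Gamma>[i := v # \<Gamma> ! i])) [0..<length \<Gamma>]. Tm t y)) (at 0)"
    if ne: "\<forall>\<gamma>\<in>set \<Gamma>. \<gamma> \<noteq> []" for \<beta> \<Gamma> y v
  proof -
    define us where "us = map (\<lambda>v. ((\<lambda>_::'a. 0 :: complex), v :: 'a)) \<beta>"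
    have us: "set us \<subseteq> WL L" unfolding us_def using zW by auto
    define ws where "ws = map (\<lambda>\<gamma> t. w \<gamma> (y + t *\<^sub>R v)) \<Gamma>"
    have wsm: "map (\<lambda>f. f t) ws = map (\<lambda>\<gamma>. w \<gamma> (y + t *\<^sub>R v)) \<Gamma>" for t by (simp add: ws_def)
    have D: "((\<lambda>t. DD G (us @ map (\<lambda>f. f t) ws) (\<Phi> (y + t *\<^sub>R v), y + t *\<^sub>R v)) has_vector_derivative
      DD G (dcurve (\<lambda>t. (\<Phi> (y + t *\<^sub>R v), y + t *\<^sub>R v)) 0 # us @ map (\<lambda>f. f 0) ws) (\<Phi> (y + 0 *\<^sub>R v), y + 0 *\<^sub>R v) +
      (\<Sum>i<length ws. DD G (us @ (map (\<lambda>f. f 0) ws)[i := dcurve (ws ! i) 0]) (\<Phi> (y + 0 *\<^sub>R v), y + 0 *\<^sub>R v))) (at 0)"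
    proof (rule DD_Leibniz)
      show "plot (\<lambda>t. (\<Phi> (y + t *\<^sub>R v), y + t *\<^sub>R v))" by (rule plot_compose[OF pc line])
      show "plot f" if "f \<in> set ws" for f using that unfolding ws_def by (auto intro: plot_compose[OF pw line])
      show "f t \<in> WL L" if "f \<in> set ws" for f t using that ne unfolding ws_def by (auto intro: wW)
    qed (use \<Phi>U us in auto)
    have wsW: "set (map (\<lambda>\<gamma>. w \<gamma> y) \<Gamma>) \<subseteq> WL L" using ne wW by auto
    have "(fst (w [v] y), v) = padd ((\<lambda>_. 0), v) 1 (w [v] y)" by (simp add: padd_def w_def)
    then have "DD G ((fst (w [v] y), v) # us @ map (\<lambda>\<gamma>. w \<gamma> y) \<Gamma>) (\<Phi> y, y)
       = DD G (((\<lambda>_. 0), v) # us @ map (\<lambda>\<gamma>. w \<gamma> y) \<Gamma>) (\<Phi> y, y) + DD G (w [v] y # us @ map (\<lambda>\<gamma>. w \<gamma> y) \<Gamma>) (\<Phi> y, y)"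
      by (simp only:) (subst DD_linear[OF \<Phi>U zW wW[of "[v]"]]; use us wsW in auto)
    also have "DD G (w [v] y # us @ map (\<lambda>\<gamma>. w \<gamma> y) \<Gamma>) (\<Phi> y, y) = Tm (\<beta>, [v] # \<Gamma>) y"
      using DD_move[OF \<Phi>U wW[of "[v]"] us wsW] by (simp add: Tm_def us_def)
    finally have 1: "DD G ((fst (w [v] y), v) # us @ map (\<lambda>\<gamma>. w \<gamma> y) \<Gamma>) (\<Phi> y, y) = Tm (v # \<beta>, \<Gamma>) y + Tm (\<beta>, [v] # \<Gamma>) y"
      by (simp add: Tm_def us_def)
    have 2: "(\<Sum>i<length ws. DD G (us @ (map (\<lambda>f. f 0) ws)[i := dcurve (ws ! i) 0]) (\<Phi> (y + 0 *\<^sub>R v), y + 0 *\<^sub>R v))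
      = (\<Sum>i<length \<Gamma>. Tm (\<beta>, \<Gamma>[i := v # \<Gamma> ! i]) y)"
    proof (rule sum.cong)
      show "{..<length ws} = {..<length \<Gamma>}" by (simp add: ws_def)
      fix i assume "i \<in> {..<length \<Gamma>}"
      then have i: "i < length \<Gamma>" by simp
      have "ws ! i = (\<lambda>t. w (\<Gamma> ! i) (y + t *\<^sub>R v))" using i by (simp add: ws_def)
      then have "dcurve (ws ! i) 0 = w (v # \<Gamma> ! i) y" by (simp only: dw)
      then show "DD G (us @ (map (\<lambda>f. f 0) ws)[i := dcurve (ws ! i) 0]) (\<Phi> (y + 0 *\<^sub>R v), y + 0 *\<^sub>R v) = Tm (\<beta>, \<Gamma>[i := v # \<Gamma> ! i]) y"
        unfolding wsm by (simp add: Tm_def us_def map_update del: DD.simps)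
    qed
    have 3: "(\<Sum>t\<leftarrow>map (\<lambda>i. (\<beta>, \<Gamma>[i := v # \<Gamma> ! i])) [0..<length \<Gamma>]. Tm t y) = (\<Sum>i<length \<Gamma>. Tm (\<beta>, \<Gamma>[i := v # \<Gamma> ! i]) y)"
      by (simp add: comp_def interv_sum_list_conv_sum_set_nat atLeast0LessThan)
    have "(\<lambda>h. Tm (\<beta>, \<Gamma>) (y + h *\<^sub>R v)) = (\<lambda>t. DD G (us @ map (\<lambda>f. f t) ws) (\<Phi> (y + t *\<^sub>R v), y + t *\<^sub>R v))"
      by (simp only: wsm Tm_def fst_conv snd_conv us_def)
    moreover have "DD G (dcurve (\<lambda>t. (\<Phi> (y + t *\<^sub>R v), y + t *\<^sub>R v)) 0 # us @ map (\<lambda>f. f 0) ws) (\<Phi> (y + 0 *\<^sub>R v), y + 0 *\<^sub>R v)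
       = Tm (v # \<beta>, \<Gamma>) y + Tm (\<beta>, [v] # \<Gamma>) y"
      unfolding dc wsm using 1 by simp
    ultimately show ?thesis using D 2 3 by (simp add: add.assoc)
  qed
  have main: "pd \<alpha> (\<lambda>y. G (\<Phi> y, y)) y = (\<Sum>t\<leftarrow>chain_terms \<alpha>. Tm t y)" for \<alpha> y
  proof (induction \<alpha> arbitrary: y)
    case Nil then show ?case by (simp add: Tm_def)
  next
    case (Cons v \<alpha>)
    have "((\<lambda>h. \<Sum>t\<leftarrow>chain_terms \<alpha>. Tm t (y + h *\<^sub>R v)) has_vector_derivative
       (\<Sum>t\<leftarrow>chain_terms \<alpha>. case t of (\<beta>, \<Gamma>) \<Rightarrow> \<Sum>t\<leftarrow>(v # \<beta>, \<Gamma>) # (\<beta>, [v] # \<Gamma>) # map (\<lambda>i. (\<beta>, \<Gamma>[i := v # \<Gamma> ! i])) [0..<length \<Gamma>]. Tm t y)) (at 0)"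
    proof (rule has_vector_derivative_sum_list)
      fix t assume t: "t \<in> set (chain_terms \<alpha>)"
      obtain \<beta> \<Gamma> where bg: "t = (\<beta>, \<Gamma>)" by (cases t)
      have "\<forall>\<gamma>\<in>set \<Gamma>. \<gamma> \<noteq> []" using chain_terms_props t bg by blast
      from dT[OF this, of \<beta> y v] show "((\<lambda>h. Tm t (y + h *\<^sub>R v)) has_vector_derivative
        (case t of (\<beta>, \<Gamma>) \<Rightarrow> \<Sum>t\<leftarrow>(v # \<beta>, \<Gamma>) # (\<beta>, [v] # \<Gamma>) # map (\<lambda>i. (\<beta>, \<Gamma>[i := v # \<Gamma> ! i])) [0..<length \<Gamma>]. Tm t y)) (at 0)"
        unfolding bg by simp
    qed
    then have "pd (v # \<alpha>) (\<lambda>y. G (\<Phi> y, y)) y = (\<Sum>t\<leftarrow>chain_terms \<alpha>. case t of (\<beta>, \<Gamma>) \<Rightarrow> \<Sum>t\<leftarrow>(v # \<beta>, \<Gamma>) # (\<beta>, [v] # \<Gamma>) # map (\<lambda>i. (\<beta>, \<Gamma>[i := v # \<Gamma> ! i])) [0..<length \<Gamma>]. Tm t y)"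
      by (simp only: pd.simps Cons.IH vector_derivative_at)
    also have "\<dots> = (\<Sum>t\<leftarrow>chain_terms (v # \<alpha>). Tm t y)"
      by (simp add: sum_list_map_concat comp_def split_def)
    finally show ?case .
  qed
  show "pd \<alpha> (\<lambda>y. G (\<Phi> y, y)) y =
      (\<Sum>(\<beta>, \<Gamma>)\<leftarrow>chain_terms \<alpha>. DD G (map (\<lambda>v. ((\<lambda>_. 0), v)) \<beta> @ map (\<lambda>\<gamma>. w \<gamma> y) \<Gamma>) (\<Phi> y, y))"
    unfolding main Tm_def split_def ..
qed

end

text \<open>N is a parameter here so that it can be chosen before B; the theorem adds the condition
  N \<ge> 1.\<close>

definition estimate :: "'a::euclidean_space set \<Rightarrow> (('a \<Rightarrow> complex) \<times> 'a \<Rightarrow> complex) \<Rightarrow> 'a set \<Rightarrow> 'a list \<Rightarrow> nat \<Rightarrow> nat \<Rightarrow> bool" where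
  "estimate \<Omega> R K \<alpha> k N \<longleftrightarrow> (\<forall>B. bounded_D B \<longrightarrow>
        (\<exists>\<epsilon>0 C. \<epsilon>0 \<in> {0<..1} \<and> C > 0 \<and>
          (\<forall>\<epsilon>\<in>{0<..<\<epsilon>0}. \<forall>x\<in>K. \<forall>\<phi>\<in>B \<inter> A0. \<forall>\<psi>s.
             length \<psi>s = k \<and> set \<psi>s \<subseteq> B \<inter> A00 \<longrightarrow>
             (Seps \<epsilon> \<phi>, x) \<in> UOm \<Omega> \<and>
             norm (scaled_diff R \<epsilon> \<alpha> \<psi>s \<phi> x)
               \<le> C * \<epsilon> powr (- real N))))"

lemma estimateE:
  assumes "estimate \<Omega> R K \<alpha> k N" "bounded_D B"
  obtains \<epsilon>0 C where "0 < \<epsilon>0" "\<epsilon>0 \<le> 1" "C > 0"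
    "\<And>\<epsilon> x \<phi> \<psi>s. 0 < \<epsilon> \<Longrightarrow> \<epsilon> < \<epsilon>0 \<Longrightarrow> x \<in> K \<Longrightarrow> \<phi> \<in> B \<Longrightarrow> \<phi> \<in> A0 \<Longrightarrow> length \<psi>s = k \<Longrightarrow> set \<psi>s \<subseteq> B \<inter> A00 \<Longrightarrow>
      norm (scaled_diff R \<epsilon> \<alpha> \<psi>s \<phi> x) \<le> C * \<epsilon> powr (- real N)"
proof -
  obtain \<epsilon>0 C where "\<epsilon>0 \<in> {0<..1}" "C > 0" "\<forall>\<epsilon>\<in>{0<..<\<epsilon>0}. \<forall>x\<in>K. \<forall>\<phi>\<in>B \<inter> A0. \<forall>\<psi>s.
             length \<psi>s = k \<and> set \<psi>s \<subseteq> B \<inter> A00 \<longrightarrow>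
             (Seps \<epsilon> \<phi>, x) \<in> UOm \<Omega> \<and>
             norm (scaled_diff R \<epsilon> \<alpha> \<psi>s \<phi> x)
               \<le> C * \<epsilon> powr (- real N)"
    using assms unfolding estimate_def by blast
  then show thesis by (intro that[of \<epsilon>0 C]) auto
qed

lemma norm_sum_list_le: "norm (\<Sum>x\<leftarrow>xs. f x :: 'b::real_normed_vector) \<le> (\<Sum>x\<leftarrow>xs. norm (f x))"
  by (induction xs) (auto intro: norm_triangle_le)

lemma moderateI:
  fixes \<Omega> :: "'a::euclidean_space set"
  assumes \<Omega>: "open \<Omega>" and R: "Ed \<Omega> R"
    and H: "\<And>K \<alpha> k. compact K \<Longrightarrow> K \<subseteq> \<Omega> \<Longrightarrow> set \<alpha> \<subseteq> Basis \<Longrightarrow> \<exists>N. estimate \<Omega> R K \<alpha> k N"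
  shows "moderate \<Omega> R"
  unfolding moderate_def
proof (intro conjI R allI impI)
  fix K :: "'a set" and \<alpha> :: "'a list"
  assume a: "compact K \<and> K \<subseteq> \<Omega> \<and> set \<alpha> \<subseteq> Basis"
  define T where "T = set (chain_terms \<alpha>)"
  have "\<forall>\<beta> k. set \<beta> \<subseteq> Basis \<longrightarrow> (\<exists>N. estimate \<Omega> R K \<beta> k N)" using H a by blast
  then obtain Nf where Nf: "\<And>\<beta> k. set \<beta> \<subseteq> Basis \<Longrightarrow> estimate \<Omega> R K \<beta> k (Nf \<beta> k)" by metis
  \<comment> \<open>A sum serves as upper bound for the finitely many exponents; it depends on K and
    alpha, not on phi.\<close>
  define N where "N = (\<Sum>(\<beta>, \<Gamma>)\<in>T. Nf \<beta> (length \<Gamma>))"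
  have fT: "finite T" by (simp add: T_def)
  have NN: "Nf \<beta> (length \<Gamma>) \<le> N" if "(\<beta>, \<Gamma>) \<in> T" for \<beta> \<Gamma>
    unfolding N_def using member_le_sum[OF that, of "\<lambda>(\<beta>, \<Gamma>). Nf \<beta> (length \<Gamma>)"] fT by auto
  have Tp: "set \<beta> \<subseteq> Basis" "\<And>\<gamma>. \<gamma> \<in> set \<Gamma> \<Longrightarrow> \<gamma> \<noteq> [] \<and> set \<gamma> \<subseteq> Basis \<and> length \<gamma> \<le> length \<alpha>" if "(\<beta>, \<Gamma>) \<in> T" for \<beta> \<Gamma>
    using chain_terms_props[of \<beta> \<Gamma> \<alpha>] that a unfolding T_def by blast+
  show "\<exists>N::nat. \<forall>\<phi>. Cb \<Omega> \<phi> \<longrightarrow> (\<exists>\<epsilon>0 C. \<epsilon>0 \<in> {0<..1} \<and> (\<forall>\<epsilon>\<in>{0<..<\<epsilon>0}. \<forall>x\<in>K.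
      norm (pd \<alpha> (\<lambda>y. R (Seps \<epsilon> (\<phi> \<epsilon> y), y)) x) \<le> C * \<epsilon> powr (- real N)))"
  proof (rule exI[of _ N], intro allI impI)
    fix \<phi> assume Cb: "Cb \<Omega> \<phi>"
    obtain r K' where K': "r > 0" "compact K'" "K' \<subseteq> \<Omega>" "\<And>x y. x \<in> K \<Longrightarrow> dist x y \<le> r \<Longrightarrow> y \<in> K'"
      using compact_neighbourhood[of K \<Omega>] a \<Omega> by blast
    have CbB: "bounded_D {(\<lambda>\<xi>. pd vs (\<lambda>y. \<phi> \<epsilon> y \<xi>) x) | \<epsilon> x. \<epsilon> \<in> {0<..1} \<and> x \<in> K}"
      if "compact K" "K \<subseteq> \<Omega>" "set vs \<subseteq> Basis" for K vs
      using Cb that unfolding Cb_def by blast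
    define I where "I = {\<gamma> :: 'a list. set \<gamma> \<subseteq> Basis \<and> length \<gamma> \<le> length \<alpha>}"
    \<comment> \<open>The bounded set to be inserted into the estimate: phi and its x-derivatives up
      to the order of alpha, for all eps at once. The empty multi-index supplies the base point, the
      others the directions.\<close>
    define B where "B = (\<Union>\<gamma>\<in>I. {(\<lambda>\<xi>. pd \<gamma> (\<lambda>y. \<phi> \<epsilon> y \<xi>) x) | \<epsilon> x. \<epsilon> \<in> {0<..1} \<and> x \<in> K})"
    have "bounded_D B"
      unfolding B_def
    proof (rule bounded_D_UN)
      show "finite I" unfolding I_def by (rule finite_lists_length_le) simp
      show "bounded_D {(\<lambda>\<xi>. pd \<gamma> (\<lambda>y. \<phi> \<epsilon> y \<xi>) x) | \<epsilon> x. \<epsilon> \<in> {0<..1} \<and> x \<in> K}" if "\<gamma> \<in> I" for \<gamma>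
        by (rule CbB) (use a that in \<open>auto simp: I_def\<close>)
    qed
    note bB = this
    have Bmem: "(\<lambda>\<xi>. pd \<gamma> (\<lambda>y. \<phi> \<epsilon> y \<xi>) x) \<in> B" if "set \<gamma> \<subseteq> Basis" "length \<gamma> \<le> length \<alpha>" "0 < \<epsilon>" "\<epsilon> \<le> 1" "x \<in> K" for \<gamma> \<epsilon> x
      unfolding B_def I_def using that by (intro UN_I[of \<gamma>]) auto
    \<comment> \<open>Supports have to be controlled on the neighbourhood K' as well, because phi
      will be evaluated at theta y.\<close>
    have "bounded_D {(\<lambda>\<xi>. pd [] (\<lambda>y. \<phi> \<epsilon> y \<xi>) x) | \<epsilon> x. \<epsilon> \<in> {0<..1} \<and> x \<in> K'}"
      by (rule CbB) (use K' in auto)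
    then obtain L where L: "compact L" and
      Lv': "\<And>f. f \<in> {(\<lambda>\<xi>. pd [] (\<lambda>y. \<phi> \<epsilon> y \<xi>) x) | \<epsilon> x. \<epsilon> \<in> {0<..1} \<and> x \<in> K'} \<Longrightarrow> off L f"
      using bounded_D_support by blast
    have Lv: "\<forall>\<xi>. \<xi> \<notin> L \<longrightarrow> \<phi> \<epsilon> x \<xi> = 0" if "0 < \<epsilon>" "\<epsilon> \<le> 1" "x \<in> K'" for \<epsilon> x
      by (rule Lv') (use that in auto)
    \<comment> \<open>Half of r is spent on theta y, the other half on eps xi.\<close>
    obtain e1 where e1: "e1 \<in> {0<..1}" "\<And>\<epsilon> \<xi>. 0 < \<epsilon> \<Longrightarrow> \<epsilon> < e1 \<Longrightarrow> \<xi> \<in> L \<Longrightarrow> norm (\<epsilon> *\<^sub>R \<xi>) \<le> r/2"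
      using small_support[OF L, of "r/2"] K'(1) by auto
    obtain W \<Phi> where W: "{0<..1} \<times> \<Omega> \<subseteq> W" "smooth_D_on W \<Phi>" "\<forall>\<epsilon>\<in>{0<..1}. \<forall>x\<in>\<Omega>. \<Phi> (\<epsilon>, x) = \<phi> \<epsilon> x"
      using Cb unfolding Cb_def by blast
    have A0: "\<phi> \<epsilon> x \<in> A0" if "0 < \<epsilon>" "\<epsilon> \<le> 1" "x \<in> \<Omega>" for \<epsilon> x using Cb that unfolding Cb_def by auto
    have "\<forall>t\<in>T. \<exists>e C. 0 < e \<and> e \<le> 1 \<and> C > 0 \<and> (\<forall>\<epsilon> x \<phi> \<psi>s. 0 < \<epsilon> \<longrightarrow> \<epsilon> < e \<longrightarrow> x \<in> K \<longrightarrow> \<phi> \<in> B \<longrightarrow> \<phi> \<in> A0 \<longrightarrow>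
        length \<psi>s = length (snd t) \<longrightarrow> set \<psi>s \<subseteq> B \<inter> A00 \<longrightarrow>
        norm (scaled_diff R \<epsilon> (fst t) \<psi>s \<phi> x) \<le> C * \<epsilon> powr (- real (Nf (fst t) (length (snd t)))))"
    proof
      fix t assume "t \<in> T"
      then obtain \<beta> \<Gamma> where t: "t = (\<beta>, \<Gamma>)" "(\<beta>, \<Gamma>) \<in> T" by (cases t) auto
      obtain e C where *: "0 < e" "e \<le> 1" "C > 0"
        "\<And>\<epsilon> x \<phi> \<psi>s. 0 < \<epsilon> \<Longrightarrow> \<epsilon> < e \<Longrightarrow> x \<in> K \<Longrightarrow> \<phi> \<in> B \<Longrightarrow> \<phi> \<in> A0 \<Longrightarrow> length \<psi>s = length \<Gamma> \<Longrightarrow> set \<psi>s \<subseteq> B \<inter> A00 \<Longrightarrow>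
          norm (scaled_diff R \<epsilon> \<beta> \<psi>s \<phi> x) \<le> C * \<epsilon> powr (- real (Nf \<beta> (length \<Gamma>)))"
        by (rule estimateE[OF Nf[OF Tp(1)[OF t(2)], of "length \<Gamma>"] bB]) blast
      show "\<exists>e C. 0 < e \<and> e \<le> 1 \<and> C > 0 \<and> (\<forall>\<epsilon> x \<phi> \<psi>s. 0 < \<epsilon> \<longrightarrow> \<epsilon> < e \<longrightarrow> x \<in> K \<longrightarrow> \<phi> \<in> B \<longrightarrow> \<phi> \<in> A0 \<longrightarrow>
        length \<psi>s = length (snd t) \<longrightarrow> set \<psi>s \<subseteq> B \<inter> A00 \<longrightarrow>
        norm (scaled_diff R \<epsilon> (fst t) \<psi>s \<phi> x) \<le> C * \<epsilon> powr (- real (Nf (fst t) (length (snd t)))))"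
        unfolding t(1) fst_conv snd_conv by (rule exI[of _ e], rule exI[of _ C]) (intro conjI allI impI *)
    qed
    then obtain ef Cf where ef: "\<And>t. t \<in> T \<Longrightarrow> 0 < ef t" "\<And>t. t \<in> T \<Longrightarrow> Cf t > 0"
      and est: "\<And>t \<epsilon> x \<phi> \<psi>s. t \<in> T \<Longrightarrow> 0 < \<epsilon> \<Longrightarrow> \<epsilon> < ef t \<Longrightarrow> x \<in> K \<Longrightarrow> \<phi> \<in> B \<Longrightarrow> \<phi> \<in> A0 \<Longrightarrow>
        length \<psi>s = length (snd t) \<Longrightarrow> set \<psi>s \<subseteq> B \<inter> A00 \<Longrightarrow>
        norm (scaled_diff R \<epsilon> (fst t) \<psi>s \<phi> x) \<le> Cf t * \<epsilon> powr (- real (Nf (fst t) (length (snd t))))"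
      by metis
    define e0 where "e0 = Min (insert e1 (ef ` T))"
    have e0: "0 < e0" "e0 \<le> e1" "\<And>t. t \<in> T \<Longrightarrow> e0 \<le> ef t"
      unfolding e0_def using fT ef e1 by auto
    define C where "C = (\<Sum>t\<leftarrow>chain_terms \<alpha>. Cf t)"
    show "\<exists>\<epsilon>0 C. \<epsilon>0 \<in> {0<..1} \<and> (\<forall>\<epsilon>\<in>{0<..<\<epsilon>0}. \<forall>x\<in>K.
      norm (pd \<alpha> (\<lambda>y. R (Seps \<epsilon> (\<phi> \<epsilon> y), y)) x) \<le> C * \<epsilon> powr (- real N))"
    proof (rule exI[of _ e0], rule exI[of _ C], intro conjI ballI)
      show "e0 \<in> {0<..1}" using e0 e1 by auto
      fix \<epsilon> x assume "\<epsilon> \<in> {0<..<e0}" and x: "x \<in> K"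
      then have e: "0 < \<epsilon>" "\<epsilon> < e0" "\<epsilon> < e1" "\<epsilon> < 1" "\<epsilon> \<le> 1" using e0 e1 by auto
      obtain \<theta> where \<theta>: "smooth \<theta>" "\<And>y. \<theta> y \<in> ball x (r/2)" "\<And>y. y \<in> ball x (r/2/2) \<Longrightarrow> \<theta> y = y"
        using localizer[of "r/2" x] K'(1) by auto
      have r4: "r/2/2 > 0" using K' by simp
      have tK: "\<theta> y \<in> K'" for y using K'(4)[OF x, of "\<theta> y"] \<theta>(2)[of y] K'(1) by auto
      have tO: "\<theta> y \<in> \<Omega>" for y using tK K' by blast
      have tO2: "\<theta> y + \<epsilon> *\<^sub>R \<xi> \<in> \<Omega>" if "\<xi> \<in> L" for y \<xi>
      proof -
        have "dist x (\<theta> y + \<epsilon> *\<^sub>R \<xi>) \<le> dist x (\<theta> y) + norm (\<epsilon> *\<^sub>R \<xi>)"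
          using dist_triangle[of x "\<theta> y + \<epsilon> *\<^sub>R \<xi>" "\<theta> y"] by (simp add: dist_norm)
        also have "\<dots> \<le> r" using \<theta>(2)[of y] e1(2)[OF e(1,3) that] by simp
        finally show ?thesis using K' x by blast
      qed
      define G where "G = (\<lambda>(\<phi>, y). R (Seps \<epsilon> \<phi>, \<theta> y))"
      interpret curve_functional L G
        unfolding G_def by (rule curve_functional_Seps[OF R e(1) L \<theta>(1) tO tO2])
      \<comment> \<open>Composition with theta extends the family to the whole space without
        changing its derivatives at x.\<close>
      define F where "F y = \<phi> \<epsilon> (\<theta> y)" for y
      have PhiC: "Cinf_on (W \<times> UNIV) (\<lambda>(p, \<xi>). \<Phi> p \<xi>)" using W by (simp add: smooth_D_on_def)
      have subC: "smooth (\<lambda>z::'a \<times> 'a. ((\<epsilon>, \<theta> (fst z)), snd z))"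
        by (intro Cinf_intros open_UNIV Cinf_on_compose[OF Cinf_on_linear[OF bounded_linear_fst open_UNIV] \<theta>(1)]) auto
      have "smooth (\<lambda>z::'a \<times> 'a. (\<lambda>(p, \<xi>). \<Phi> p \<xi>) ((\<epsilon>, \<theta> (fst z)), snd z))"
        by (rule Cinf_on_compose[OF subC PhiC]) (use W(1) e tO in auto)
      then have FC: "smooth (\<lambda>(y, \<xi>). F y \<xi>)"
        using W(3) e tO by (simp add: F_def split_def)
      have FU: "(F y, y) \<in> UL L" for y
        using A0[OF e(1,5) tO] Lv[OF e(1,5) tK] by (simp add: UL_def F_def)
      note HC = higher_chain_rule[OF FC FU]
      have Fx: "pd \<gamma> (\<lambda>y. F y \<xi>) x = pd \<gamma> (\<lambda>y. \<phi> \<epsilon> y \<xi>) x" for \<gamma> \<xi>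
        by (rule pd_cong_on[of "ball x (r/2/2)"]) (use \<theta>(3) r4 in \<open>auto simp: F_def\<close>)
      have tx: "\<theta> x = x" using \<theta>(3)[of x] r4 by simp
      have Fxx: "F x = \<phi> \<epsilon> x" by (simp add: F_def tx)
      have key: "scaled_diff R \<epsilon> \<beta> \<psi>s f x
        = DD G (map (\<lambda>v. ((\<lambda>_. 0), v)) \<beta> @ map (\<lambda>\<psi>. (\<psi>, 0)) \<psi>s) (f, x)" for \<beta> \<psi>s f
        unfolding G_def by (rule pd_d1_DD[OF r4 \<theta>(3)])
      have "pd \<alpha> (\<lambda>y. R (Seps \<epsilon> (\<phi> \<epsilon> y), y)) x = pd \<alpha> (\<lambda>y. G (F y, y)) x"
        by (rule pd_cong_on[of "ball x (r/2/2)"]) (use \<theta>(3) r4 in \<open>auto simp: F_def G_def\<close>)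
      also have "\<dots> = (\<Sum>(\<beta>, \<Gamma>)\<leftarrow>chain_terms \<alpha>. DD G (map (\<lambda>v. ((\<lambda>_. 0), v)) \<beta> @ map (\<lambda>\<gamma>. ((\<lambda>\<xi>. pd \<gamma> (\<lambda>y. F y \<xi>) x), 0)) \<Gamma>) (F x, x))"
        by (rule HC(2))
      also have "\<dots> = (\<Sum>t\<leftarrow>chain_terms \<alpha>. scaled_diff R \<epsilon> (fst t) (map (\<lambda>\<gamma> \<xi>. pd \<gamma> (\<lambda>y. \<phi> \<epsilon> y \<xi>) x) (snd t)) (\<phi> \<epsilon> x) x)"
      proof -
        have "(case t of (\<beta>, \<Gamma>) \<Rightarrow> DD G (map (\<lambda>v. ((\<lambda>_. 0), v)) \<beta> @ map (\<lambda>\<gamma>. ((\<lambda>\<xi>. pd \<gamma> (\<lambda>y. F y \<xi>) x), 0)) \<Gamma>) (F x, x))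
          = scaled_diff R \<epsilon> (fst t) (map (\<lambda>\<gamma> \<xi>. pd \<gamma> (\<lambda>y. \<phi> \<epsilon> y \<xi>) x) (snd t)) (\<phi> \<epsilon> x) x" for t
          by (cases t) (simp only: prod.case fst_conv snd_conv key Fx Fxx map_map comp_def)
        from map_cong[OF refl this] show ?thesis by (rule arg_cong[of _ _ sum_list])
      qed
      also have "norm \<dots> \<le> (\<Sum>t\<leftarrow>chain_terms \<alpha>. norm (scaled_diff R \<epsilon> (fst t) (map (\<lambda>\<gamma> \<xi>. pd \<gamma> (\<lambda>y. \<phi> \<epsilon> y \<xi>) x) (snd t)) (\<phi> \<epsilon> x) x))"
        by (rule norm_sum_list_le)
      also have "\<dots> \<le> (\<Sum>t\<leftarrow>chain_terms \<alpha>. Cf t * \<epsilon> powr (- real N))"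
      proof (rule sum_list_mono)
        fix t assume "t \<in> set (chain_terms \<alpha>)"
        then have tT: "t \<in> T" by (simp add: T_def)
        obtain \<beta> \<Gamma> where t: "t = (\<beta>, \<Gamma>)" by (cases t)
        have "norm (scaled_diff R \<epsilon> (fst t) (map (\<lambda>\<gamma> \<xi>. pd \<gamma> (\<lambda>y. \<phi> \<epsilon> y \<xi>) x) (snd t)) (\<phi> \<epsilon> x) x)
          \<le> Cf t * \<epsilon> powr (- real (Nf (fst t) (length (snd t))))"
        proof (rule est[OF tT e(1) _ x])
          show "\<epsilon> < ef t" using e(2) e0(3)[OF tT] by simp
          have "x \<in> \<Omega>" using x a by blast
          then show "\<phi> \<epsilon> x \<in> A0" by (rule A0[OF e(1,5)])
          show "\<phi> \<epsilon> x \<in> B" using Bmem[of "[]" \<epsilon> x] e x by simp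
          show "set (map (\<lambda>\<gamma> \<xi>. pd \<gamma> (\<lambda>y. \<phi> \<epsilon> y \<xi>) x) (snd t)) \<subseteq> B \<inter> A00"
          proof
            fix \<psi> assume "\<psi> \<in> set (map (\<lambda>\<gamma> \<xi>. pd \<gamma> (\<lambda>y. \<phi> \<epsilon> y \<xi>) x) (snd t))"
            then obtain \<gamma> where g: "\<gamma> \<in> set \<Gamma>" "\<psi> = (\<lambda>\<xi>. pd \<gamma> (\<lambda>y. \<phi> \<epsilon> y \<xi>) x)" by (auto simp: t)
            have g': "\<gamma> \<noteq> []" "set \<gamma> \<subseteq> Basis" "length \<gamma> \<le> length \<alpha>" using Tp(2)[of \<beta> \<Gamma> \<gamma>] tT g by (auto simp: t)
            from HC(1)[OF g'(1), of x] have "\<psi> \<in> A00" unfolding g(2) by (simp add: WL_def Fx)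
            moreover have "\<psi> \<in> B" unfolding g(2) by (rule Bmem) (use g' e x in auto)
            ultimately show "\<psi> \<in> B \<inter> A00" by blast
          qed
        qed simp
        also have "\<dots> \<le> Cf t * \<epsilon> powr (- real N)"
          using NN[of \<beta> \<Gamma>] tT e ef(2)[OF tT] by (intro mult_left_mono powr_mono') (auto simp: t)
        finally show "norm (scaled_diff R \<epsilon> (fst t) (map (\<lambda>\<gamma> \<xi>. pd \<gamma> (\<lambda>y. \<phi> \<epsilon> y \<xi>) x) (snd t)) (\<phi> \<epsilon> x) x)
          \<le> Cf t * \<epsilon> powr (- real N)" .
      qed
      also have "\<dots> = C * \<epsilon> powr (- real N)" by (simp add: C_def sum_list_mult_const)
      finally show "norm (pd \<alpha> (\<lambda>y. R (Seps \<epsilon> (\<phi> \<epsilon> y), y)) x) \<le> C * \<epsilon> powr (- real N)" .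
    qed
  qed
qed

section \<open>From moderateness to the differential estimate\<close>

text \<open>Nested so that one summand l psi can be split off at a time, which is how the
  coefficients are extracted.\<close>

fun comb :: "('a \<Rightarrow> complex) list \<Rightarrow> ('a \<Rightarrow> complex) set" where
  "comb [] = {\<lambda>_. 0}"
| "comb (\<psi> # \<psi>s) = {\<lambda>\<xi>. T \<xi> + complex_of_real l * \<psi> \<xi> | T l. T \<in> comb \<psi>s \<and> \<bar>l\<bar> \<le> 1}"

context curve_functional
begin

text \<open>Each of the r equal entries is affine in l with slope u, and symmetry merges the r
  Leibniz terms into one.\<close>

lemma DD_replicate_derivative:
  assumes p: "p \<in> UL L" and X: "X \<in> WL L" "u \<in> WL L" and us: "set us \<subseteq> WL L" "set vs \<subseteq> WL L"
  shows "((\<lambda>l. DD G (us @ replicate r (padd X l u) @ vs) p) has_vector_derivative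
      of_nat r * DD G (us @ u # replicate (r - 1) (padd X l u) @ vs) p) (at l)"
  using us
proof (induction r arbitrary: us)
  case 0 then show ?case by simp
next
  case (Suc r)
  define W where "W l = replicate r (padd X l u) @ vs" for l
  define W' where "W' = replicate (r - 1) (padd X l u) @ vs"
  have WX: "padd X l u \<in> WL L" for l by (rule WL_padd[OF L X])
  have Ws: "set (W l) \<subseteq> WL L" for l using WX Suc.prems by (auto simp: W_def)
  have Ws': "set W' \<subseteq> WL L" using WX Suc.prems by (auto simp: W'_def)
  have eq: "DD G (us @ replicate (Suc r) (padd X l u) @ vs) p
      = DD G ((us @ [X]) @ W l) p + complex_of_real l * DD G ((us @ [u]) @ W l) p" for l
    using DD_linear_mid[OF p X Suc.prems(1) Ws[of l], of l] by (simp add: W_def)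
  have IH: "((\<lambda>l. DD G ((us @ [z]) @ W l) p) has_vector_derivative of_nat r * DD G ((us @ [z]) @ u # W') p) (at l)"
    if "z \<in> WL L" for z unfolding W_def W'_def by (rule Suc.IH) (use Suc.prems that in auto)
  have "((\<lambda>l. DD G ((us @ [X]) @ W l) p + complex_of_real l * DD G ((us @ [u]) @ W l) p) has_vector_derivative
      of_nat r * DD G ((us @ [X]) @ u # W') p +
      (complex_of_real l * (of_nat r * DD G ((us @ [u]) @ u # W') p) + complex_of_real 1 * DD G ((us @ [u]) @ W l) p)) (at l)"
    by (intro has_vector_derivative_add has_vector_derivative_mult has_vector_derivative_of_real DERIV_ident IH X)
  moreover have "of_nat r * DD G ((us @ [X]) @ u # W') p +
      (complex_of_real l * (of_nat r * DD G ((us @ [u]) @ u # W') p) + complex_of_real 1 * DD G ((us @ [u]) @ W l) p)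
      = of_nat (Suc r) * DD G (us @ u # replicate (Suc r - 1) (padd X l u) @ vs) p"
  proof (cases r)
    case 0 then show ?thesis by (simp add: W_def)
  next
    case (Suc r')
    have "DD G (us @ padd X l u # u # W') p = DD G (us @ X # u # W') p + complex_of_real l * DD G (us @ u # u # W') p"
      by (rule DD_linear_mid[OF p X Suc.prems(1)]) (use Ws' X in auto)
    moreover have "DD G (us @ padd X l u # u # W') p = DD G (us @ u # W l) p"
      by (rule DD_perm) (use Suc Suc.prems WX X p Ws' in \<open>auto simp: W_def W'_def\<close>)
    ultimately have e: "DD G (us @ X # u # W') p + complex_of_real l * DD G (us @ u # u # W') p = DD G (us @ u # W l) p" by simp
    have "of_nat r * DD G ((us @ [X]) @ u # W') p +
      (complex_of_real l * (of_nat r * DD G ((us @ [u]) @ u # W') p) + complex_of_real 1 * DD G ((us @ [u]) @ W l) p)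
      = of_nat r * (DD G (us @ X # u # W') p + complex_of_real l * DD G (us @ u # u # W') p) + DD G (us @ u # W l) p"
      by (simp add: algebra_simps)
    then show ?thesis unfolding e by (simp add: W_def algebra_simps)
  qed
  ultimately show ?case unfolding eq by simp
qed

lemma comb_WL:
  assumes "\<And>\<psi>. \<psi> \<in> set \<psi>s \<Longrightarrow> (\<psi>, 0) \<in> WL L" "T \<in> comb \<psi>s"
  shows "(T, x) \<in> WL L"
  using assms
proof (induction \<psi>s arbitrary: T)
  case Nil then show ?case by (simp add: WL_zero[OF L])
next
  case (Cons \<psi> \<psi>s)
  then obtain T' l where T: "T = (\<lambda>\<xi>. T' \<xi> + complex_of_real l * \<psi> \<xi>)" "T' \<in> comb \<psi>s" by auto
  have "padd (T', x) l (\<psi>, 0) \<in> WL L" by (rule WL_padd[OF L]) (use Cons T in auto)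
  then show ?case by (simp add: padd_def T)
qed

text \<open>The polynomial \<open>l \<mapsto> DD G [..., (T + l \<psi>, e), ..., (T + l \<psi>, e)] p\<close> is bounded on the unit interval,
  so by the Landau inequality its derivative at 0 is bounded; this trades one entry \<open>(T, e)\<close> for \<open>(\<psi>, 0)\<close>.\<close>

lemma DD_extract:
  assumes C0: "C0 \<ge> 0" "\<And>(g::nat \<Rightarrow> real \<Rightarrow> real) A. derivative_sequence g \<Longrightarrow>
      (\<forall>t\<in>{0..1}. \<bar>g 0 t\<bar> \<le> A) \<Longrightarrow> (\<forall>t\<in>{0..1}. g (Suc n) t = 0) \<Longrightarrow> \<bar>g 1 0\<bar> \<le> C0 * A"
    and p: "p \<in> UL L" and vs: "set vs \<subseteq> WL L"
    and base: "\<And>T. T \<in> comb (rev us @ rest) \<Longrightarrow> norm (DD G (replicate n (T, e) @ vs) p) \<le> M"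
    and W: "\<And>\<psi>. \<psi> \<in> set us \<union> set rest \<Longrightarrow> (\<psi>, 0) \<in> WL L" and n: "length us \<le> n" and T: "T \<in> comb rest"
  shows "norm (DD G (map (\<lambda>\<psi>. (\<psi>, 0)) us @ replicate (n - length us) (T, e) @ vs) p) \<le> (2 * C0) ^ length us * M"
  using base W n T
proof (induction us arbitrary: rest T)
  case Nil then show ?case by simp
next
  case (Cons \<psi> us)
  define m where "m = n - length us"
  have m: "m = Suc (n - length (\<psi> # us))" "m \<le> n" using Cons.prems(3) by (auto simp: m_def)
  define X where "X = (T, e)"
  define u where "u = (\<psi>, 0 :: 'a)"
  define US where "US = map (\<lambda>\<psi>. (\<psi>, 0 :: 'a)) us"
  have XW: "X \<in> WL L" unfolding X_def by (rule comb_WL[OF _ Cons.prems(4)]) (use Cons.prems in auto)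
  have uW: "u \<in> WL L" unfolding u_def by (rule Cons.prems(2)) simp
  have USW: "set US \<subseteq> WL L" unfolding US_def using Cons.prems(2) by auto
  define A where "A = (2 * C0) ^ length us * M"
  have bd: "norm (DD G (US @ replicate m (padd X l u) @ vs) p) \<le> A" if "\<bar>l\<bar> \<le> 1" for l
  proof -
    have "padd X l u = ((\<lambda>\<xi>. T \<xi> + complex_of_real l * \<psi> \<xi>), e)" by (simp add: padd_def X_def u_def)
    moreover have "norm (DD G (map (\<lambda>\<psi>. (\<psi>, 0)) us @ replicate (n - length us) ((\<lambda>\<xi>. T \<xi> + complex_of_real l * \<psi> \<xi>), e) @ vs) p) \<le> (2 * C0) ^ length us * M"
    proof (rule Cons.IH[of "\<psi> # rest"])
      show "(\<lambda>\<xi>. T \<xi> + complex_of_real l * \<psi> \<xi>) \<in> comb (\<psi> # rest)" using Cons.prems(4) that by auto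
    qed (use Cons.prems in auto)
    ultimately show ?thesis by (simp add: US_def m_def A_def)
  qed
  \<comment> \<open>The i-th derivative in l, with the falling factorial m (m - 1) ... (m - i + 1)
    in front. For i > m this factor is 0, so the truncation in m - i does no harm.\<close>
  define h where "h i l = complex_of_real (\<Prod>j<i. real m - real j) * DD G (US @ replicate i u @ replicate (m - i) (padd X l u) @ vs) p" for i l
  have dh: "(h i has_vector_derivative h (Suc i) l) (at l)" for i l
  proof -
    have D: "((\<lambda>l. DD G ((US @ replicate i u) @ replicate (m - i) (padd X l u) @ vs) p) has_vector_derivative
      of_nat (m - i) * DD G ((US @ replicate i u) @ u # replicate (m - i - 1) (padd X l u) @ vs) p) (at l)"
      by (rule DD_replicate_derivative[OF p XW uW]) (use USW uW vs in auto)
    have eq: "complex_of_real (\<Prod>j<i. real m - real j) * (of_nat (m - i) * DD G ((US @ replicate i u) @ u # replicate (m - i - 1) (padd X l u) @ vs) p)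
       = h (Suc i) l"
    proof (cases "i \<le> m")
      case True
      then have "complex_of_real (real m - real i) = of_nat (m - i)" by (simp add: of_nat_diff)
      then show ?thesis by (simp add: h_def replicate_app_Cons_same mult.assoc)
    next
      case False
      then have "(\<Prod>j<Suc i. real m - real j) = 0" by (intro prod_zero) auto
      then show ?thesis unfolding h_def using False by simp
    qed
    show ?thesis unfolding h_def[abs_def] using has_vector_derivative_mult_right[OF D, of "complex_of_real (\<Prod>j<i. real m - real j)"]
      unfolding eq[unfolded h_def] by simp
  qed
  have h0: "norm (h 0 l) \<le> A" if "l \<in> {0..1}" for l using bd[of l] that by (simp add: h_def)
  \<comment> \<open>The degree m is at most n, so one Landau constant of order n + 1 serves all
    stages of the induction.\<close>
  have hn: "h (Suc n) l = 0" for l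
  proof -
    have "(\<Prod>j<Suc n. real m - real j) = 0" by (rule prod_zero) (use m(2) in \<open>auto intro!: bexI[of _ m]\<close>)
    then show ?thesis by (simp add: h_def)
  qed
  have "\<bar>Re (h 1 0)\<bar> \<le> C0 * A"
  proof (rule C0(2)[of "\<lambda>i l. Re (h i l)"])
    show "\<forall>m t. ((\<lambda>l. Re (h m l)) has_real_derivative Re (h (Suc m) t)) (at t)"
      using bounded_linear.has_vector_derivative[OF bounded_linear_Re dh] by (simp add: has_real_derivative_iff_has_vector_derivative)
    show "\<forall>t\<in>{0..1}. \<bar>Re (h 0 t)\<bar> \<le> A" using h0 abs_Re_le_cmod order_trans by blast
  qed (use hn in auto)
  moreover have "\<bar>Im (h 1 0)\<bar> \<le> C0 * A"
  proof (rule C0(2)[of "\<lambda>i l. Im (h i l)"])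
    show "\<forall>m t. ((\<lambda>l. Im (h m l)) has_real_derivative Im (h (Suc m) t)) (at t)"
      using bounded_linear.has_vector_derivative[OF bounded_linear_Im dh] by (simp add: has_real_derivative_iff_has_vector_derivative)
    show "\<forall>t\<in>{0..1}. \<bar>Im (h 0 t)\<bar> \<le> A" using h0 abs_Im_le_cmod order_trans by blast
  qed (use hn in auto)
  \<comment> \<open>The inequality is real; real and imaginary part together give the factor
    2.\<close>
  ultimately have h1: "norm (h 1 0) \<le> 2 * C0 * A" using cmod_le[of "h 1 0"] by simp
  have "DD G (US @ u # replicate (m - 1) X @ vs) p = DD G (u # US @ replicate (m - 1) X @ vs) p"
    by (rule DD_move) (use p uW USW XW vs in auto)
  then have "h 1 0 = of_nat m * DD G (map (\<lambda>\<psi>. (\<psi>, 0)) (\<psi> # us) @ replicate (n - length (\<psi> # us)) (T, e) @ vs) p"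
    using m(1) by (simp add: h_def padd_0 US_def u_def X_def)
  then have "norm (h 1 0) = real m * norm (DD G (map (\<lambda>\<psi>. (\<psi>, 0)) (\<psi> # us) @ replicate (n - length (\<psi> # us)) (T, e) @ vs) p)"
    by (simp only: norm_mult norm_of_nat)
  moreover have "1 * norm (DD G (map (\<lambda>\<psi>. (\<psi>, 0)) (\<psi> # us) @ replicate (n - length (\<psi> # us)) (T, e) @ vs) p)
     \<le> real m * norm (DD G (map (\<lambda>\<psi>. (\<psi>, 0)) (\<psi> # us) @ replicate (n - length (\<psi> # us)) (T, e) @ vs) p)"
    by (intro mult_right_mono) (use m in auto)
  ultimately show ?case using h1 by (simp add: A_def mult.assoc)
qed

end

section \<open>Gluing counterexamples into one admissible family\<close>

lemma A0_combination:
  fixes f g T :: "'a::euclidean_space \<Rightarrow> complex"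
  assumes L: "compact L" and f: "f \<in> A0" "off L f" and g: "g \<in> A0" "off L g"
    and T: "T \<in> A00" "off L T"
  shows "(\<lambda>\<xi>. f \<xi> + complex_of_real a * (g \<xi> + complex_of_real b * T \<xi> - f \<xi>)) \<in> A0"
proof -
  have gf: "test_fun (\<lambda>\<xi>. g \<xi> + complex_of_real (-1) * f \<xi>)" "integral UNIV (\<lambda>\<xi>. g \<xi> + complex_of_real (-1) * f \<xi>) = 0"
    using test_fun_comb[OF L, of g f "-1"] f g by (simp_all add: A0_def)
  have d: "((\<lambda>\<xi>. g \<xi> + complex_of_real (-1) * f \<xi>), 0) \<in> WL L"
    using gf f(2) g(2) by (simp add: WL_def A00_def)
  have "(T, 0) \<in> WL L" using T by (simp add: WL_def)
  from WL_padd[OF L d this, of b]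
  have "padd ((\<lambda>\<xi>. g \<xi> + complex_of_real (-1) * f \<xi>), 0) b (T, 0) \<in> WL L" .
  moreover have "(f, 0) \<in> UL L" using f by (simp add: UL_def)
  ultimately have "padd (f, 0) a (padd ((\<lambda>\<xi>. g \<xi> + complex_of_real (-1) * f \<xi>), 0) b (T, 0)) \<in> UL L"
    by (intro UL_padd[OF L])
  then have "(\<lambda>\<xi>. f \<xi> + complex_of_real a * (g \<xi> + complex_of_real (-1) * f \<xi> + complex_of_real b * T \<xi>)) \<in> A0"
    by (simp add: UL_def padd_def)
  moreover have "(\<lambda>\<xi>. f \<xi> + complex_of_real a * (g \<xi> + complex_of_real (-1) * f \<xi> + complex_of_real b * T \<xi>))
    = (\<lambda>\<xi>. f \<xi> + complex_of_real a * (g \<xi> + complex_of_real b * T \<xi> - f \<xi>))" by (simp add: algebra_simps)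
  ultimately show ?thesis by simp
qed

text \<open>The factor l is uniform in c and d, which later depend on xi: it is a coordinate of e
  for order one and 0 for higher orders.\<close>

lemma pd_affine_param:
  fixes e x0 y :: "'a::euclidean_space"
  assumes "vs \<noteq> []" "set vs \<subseteq> Basis"
  shows "\<exists>l. \<bar>l\<bar> \<le> norm e \<and> (\<forall>(c::complex) d. pd vs (\<lambda>y. c + complex_of_real ((y - x0) \<bullet> e) * d) y = complex_of_real l * d)"
proof -
  obtain us v where uv: "vs = us @ [v]" using assms(1) by (metis rev_exhaust)
  have v: "pd [v] (\<lambda>y. c + complex_of_real ((y - x0) \<bullet> e) * d) = (\<lambda>_. complex_of_real (v \<bullet> e) * d)" for c d :: complex
  proof
    fix y :: 'a
    have "((\<lambda>h. c + complex_of_real ((y + h *\<^sub>R v - x0) \<bullet> e) * d) has_vector_derivative (0 + complex_of_real (v \<bullet> e) * d)) (at 0)"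
      by (intro has_vector_derivative_add has_vector_derivative_const has_vector_derivative_mult_left has_vector_derivative_of_real)
        (auto intro!: derivative_eq_intros simp: has_real_derivative_iff_has_vector_derivative[symmetric] inner_diff_left inner_add_left)
    then show "pd [v] (\<lambda>y. c + complex_of_real ((y - x0) \<bullet> e) * d) y = complex_of_real (v \<bullet> e) * d"
      by (simp add: vector_derivative_at)
  qed
  have "norm v = 1" using assms uv by (auto simp: norm_Basis)
  then have ve: "\<bar>v \<bullet> e\<bar> \<le> norm e" using Cauchy_Schwarz_ineq2[of v e] by simp
  show ?thesis
  proof (cases "us = []")
    case True
    with ve show ?thesis unfolding uv pd_append v by (intro exI[of _ "v \<bullet> e"]) simp
  next
    case False
    then show ?thesis unfolding uv pd_append v by (intro exI[of _ 0]) (simp add: pd_const)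
  qed
qed

text \<open>The exponent is the one that moderateness gives for K and beta before any family is
  chosen. Failure for some B is excluded by testing this exponent on a single family built from
  counterexamples with constants 0, 1, 2, and so on.\<close>

lemma moderate_affine_estimate:
  fixes \<Omega> :: "'a::euclidean_space set"
  assumes mod: "moderate \<Omega> R" and K: "compact K" "K \<subseteq> \<Omega>" and \<beta>: "set \<beta> \<subseteq> Basis"
  shows "\<exists>N::nat. \<forall>B. bounded_D B \<longrightarrow> (\<exists>\<epsilon>0 C. 0 < \<epsilon>0 \<and> \<epsilon>0 \<le> 1 \<and> (\<forall>\<epsilon> x \<phi> T. 0 < \<epsilon> \<longrightarrow> \<epsilon> < \<epsilon>0 \<longrightarrow> x \<in> K \<longrightarrow> \<phi> \<in> B \<inter> A0 \<longrightarrow> T \<in> B \<inter> A00 \<longrightarrow>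
     norm (pd \<beta> (\<lambda>y. R (Seps \<epsilon> (\<lambda>\<xi>. \<phi> \<xi> + complex_of_real ((y - x) \<bullet> e) * T \<xi>), y)) x) \<le> C * \<epsilon> powr (- real N)))"
proof -
  have "\<exists>N::nat. \<forall>\<phi>. Cb \<Omega> \<phi> \<longrightarrow> (\<exists>\<epsilon>0 C. \<epsilon>0 \<in> {0<..1} \<and> (\<forall>\<epsilon>\<in>{0<..<\<epsilon>0}. \<forall>x\<in>K.
      norm (pd \<beta> (\<lambda>y. R (Seps \<epsilon> (\<phi> \<epsilon> y), y)) x) \<le> C * \<epsilon> powr (- real N)))"
    by (rule mod[unfolded moderate_def, THEN conjunct2, rule_format]) (use K \<beta> in blast)
  then obtain N :: nat where N: "\<forall>\<phi>. Cb \<Omega> \<phi> \<longrightarrow> (\<exists>\<epsilon>0 C. \<epsilon>0 \<in> {0<..1} \<and> (\<forall>\<epsilon>\<in>{0<..<\<epsilon>0}. \<forall>x\<in>K.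
      norm (pd \<beta> (\<lambda>y. R (Seps \<epsilon> (\<phi> \<epsilon> y), y)) x) \<le> C * \<epsilon> powr (- real N)))"
    by (elim exE)
  define V where "V \<epsilon> x \<phi> T = norm (pd \<beta> (\<lambda>y. R (Seps \<epsilon> (\<lambda>\<xi>. \<phi> \<xi> + complex_of_real ((y - x) \<bullet> e) * T \<xi>), y)) x)"
    for \<epsilon> :: real and x :: 'a and \<phi> T :: "'a \<Rightarrow> complex"
  show ?thesis
  proof (intro exI[of _ N] allI impI, rule ccontr)
    fix B :: "('a \<Rightarrow> complex) set" assume B: "bounded_D B"
    assume neg: "\<not> (\<exists>\<epsilon>0 C. 0 < \<epsilon>0 \<and> \<epsilon>0 \<le> 1 \<and> (\<forall>\<epsilon> x \<phi> T. 0 < \<epsilon> \<longrightarrow> \<epsilon> < \<epsilon>0 \<longrightarrow> x \<in> K \<longrightarrow> \<phi> \<in> B \<inter> A0 \<longrightarrow> T \<in> B \<inter> A00 \<longrightarrow>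
     norm (pd \<beta> (\<lambda>y. R (Seps \<epsilon> (\<lambda>\<xi>. \<phi> \<xi> + complex_of_real ((y - x) \<bullet> e) * T \<xi>), y)) x) \<le> C * \<epsilon> powr (- real N)))"
    have bad: "\<exists>\<epsilon> x \<phi> T. 0 < \<epsilon> \<and> \<epsilon> < \<epsilon>0 \<and> x \<in> K \<and> \<phi> \<in> B \<inter> A0 \<and> T \<in> B \<inter> A00 \<and> V \<epsilon> x \<phi> T > C * \<epsilon> powr (- real N)"
      if "0 < \<epsilon>0" "\<epsilon>0 \<le> 1" for \<epsilon>0 C
    proof (rule ccontr)
      assume "\<not> ?thesis"
      then have *: "V \<epsilon> x \<phi> T \<le> C * \<epsilon> powr (- real N)" if "0 < \<epsilon>" "\<epsilon> < \<epsilon>0" "x \<in> K" "\<phi> \<in> B \<inter> A0" "T \<in> B \<inter> A00" for \<epsilon> x \<phi> T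
        using that not_le by blast
      show False
        by (rule neg[unfolded V_def[symmetric], THEN notE], rule exI[of _ \<epsilon>0], rule exI[of _ C])
          (intro conjI allI impI that *)
    qed
    define P where "P j z \<longleftrightarrow> (case z of (\<epsilon>, x, \<phi>, T) \<Rightarrow> 0 < \<epsilon> \<and> \<epsilon> < 1 \<and> x \<in> K \<and> \<phi> \<in> B \<inter> A0 \<and> T \<in> B \<inter> A00 \<and> V \<epsilon> x \<phi> T > real j * \<epsilon> powr (- real N))"
      for j :: nat and z :: "real \<times> 'a \<times> ('a \<Rightarrow> complex) \<times> ('a \<Rightarrow> complex)"
    have "\<exists>z. P 0 z" using bad[of 1 0] unfolding P_def by fastforce
    \<comment> \<open>More than halving eps at each stage separates the bumps constructed
      below.\<close>
    moreover have "\<exists>z'. P (Suc j) z' \<and> fst z' < fst z / 2" if "P j z" for j z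
    proof -
      have "0 < fst z / 2" "fst z / 2 \<le> 1" using that by (auto simp: P_def)
      from bad[OF this, of "real (Suc j)"] obtain \<epsilon> x \<phi> T where *: "0 < \<epsilon>" "\<epsilon> < fst z / 2" "x \<in> K" "\<phi> \<in> B \<inter> A0" "T \<in> B \<inter> A00"
        "V \<epsilon> x \<phi> T > real (Suc j) * \<epsilon> powr (- real N)" by blast
      moreover from *(2) \<open>fst z / 2 \<le> 1\<close> have "\<epsilon> < 1" by simp
      ultimately have "P (Suc j) (\<epsilon>, x, \<phi>, T)" unfolding P_def by blast
      with *(2) show ?thesis by (intro exI[of _ "(\<epsilon>, x, \<phi>, T)"]) simp
    qed
    ultimately obtain z where z: "\<And>j. P j (z j)" "\<And>j. fst (z (Suc j)) < fst (z j) / 2"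
      using dependent_nat_choice[of P "\<lambda>j z z'. fst z' < fst z / 2"] by metis
    define ep where "ep j = fst (z j)" for j
    define xx where "xx j = fst (snd (z j))" for j
    define ph where "ph j = fst (snd (snd (z j)))" for j
    define TT where "TT j = snd (snd (snd (z j)))" for j
    have zz: "0 < ep j" "ep j < 1" "xx j \<in> K" "ph j \<in> B" "ph j \<in> A0" "TT j \<in> B" "TT j \<in> A00"
      "V (ep j) (xx j) (ph j) (TT j) > real j * ep j powr (- real N)" for j
      using z(1)[of j] by (auto simp: P_def ep_def xx_def ph_def TT_def split_def)
    have eS: "ep (Suc j) < ep j / 2" for j using z(2) by (simp add: ep_def)
    have edec: "ep i \<le> ep j / 2" if "j < i" for i j
      using that
    proof (induction i)
      case (Suc i)
      show ?case
      proof (cases "j = i")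
        case True then show ?thesis using eS[of i] by simp
      next
        case False
        then have "ep i \<le> ep j / 2" using Suc by simp
        then show ?thesis using eS[of i] zz(1)[of i] by linarith
      qed
    qed simp
    have epow: "ep j \<le> (1/2) ^ j" for j
    proof (induction j)
      case 0 then show ?case using zz(2)[of 0] by simp
    next
      case (Suc j) then show ?case using eS[of j] by simp
    qed
    have esmall: "\<exists>J. \<forall>j\<ge>J. ep j < \<eta>" if eta: "\<eta> > 0" for \<eta>
    proof -
      obtain J where J: "(1/2) ^ J < \<eta>" using real_arch_pow_inv[OF eta, of "1/2"] by auto
      have "ep j < \<eta>" if "j \<ge> J" for j
      proof -
        have "(1/2 :: real) ^ j \<le> (1/2) ^ J" using that by (intro power_decreasing) auto
        with J epow[of j] show ?thesis by linarith
      qed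
      then show ?thesis by blast
    qed
    \<comment> \<open>A bump with value 1 at \<open>ep j\<close>, supported within distance 3/16
      \<open>ep j\<close>. For j < i, \<open>ep i\<close> is at most half of \<open>ep j\<close>,
      and 19/16 times 1/2 is less than 13/16, so the bumps are disjoint.\<close>
    define a where "a j \<epsilon> = cutoff ((\<epsilon> - ep j) * 4 / ep j)" for j \<epsilon>
    have a0: "a j \<epsilon> = 0" if "\<bar>\<epsilon> - ep j\<bar> \<ge> 3/16 * ep j" for j \<epsilon>
    proof -
      have "\<bar>(\<epsilon> - ep j) * 4 / ep j\<bar> = \<bar>\<epsilon> - ep j\<bar> * 4 / ep j" by (simp only: abs_mult abs_divide abs_numeral abs_of_pos[OF zz(1)])
      also have "\<dots> \<ge> 3/4" using that zz(1)[of j] by (simp add: pos_le_divide_eq)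
      finally show ?thesis unfolding a_def by (rule cutoff_eq_0)
    qed
    have a1: "a j (ep j) = 1" for j by (simp add: a_def cutoff_eq_1)
    have alt: "a j \<epsilon> = 0" if "j < i" "a i \<epsilon> \<noteq> 0" for i j \<epsilon>
    proof -
      have "\<bar>\<epsilon> - ep i\<bar> < 3/16 * ep i" using a0[of i \<epsilon>] that by force
      with edec[OF that(1)] zz(1)[of j] zz(1)[of i] have "\<bar>\<epsilon> - ep j\<bar> \<ge> 3/16 * ep j" by linarith
      then show ?thesis by (rule a0)
    qed
    have adis: "a j \<epsilon> = 0" if "j \<noteq> i" "a i \<epsilon> \<noteq> 0" for i j \<epsilon>
      using alt[of j i \<epsilon>] alt[of i j \<epsilon>] that by (cases "j < i") auto
    \<comment> \<open>The deviation from the background \<open>ph 0\<close>. Fully switched on, at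
      \<open>ep j\<close>, it replaces \<open>ph 0\<close> by the j-th affine family; its integral
      is 0, so every intermediate stage stays in \<open>A0\<close>.\<close>
    define t where "t j y \<xi> = ph j \<xi> + complex_of_real ((y - xx j) \<bullet> e) * TT j \<xi> - ph 0 \<xi>" for j y \<xi>
    define \<phi> where "\<phi> \<epsilon> y \<xi> = ph 0 \<xi> + (\<Sum>j. complex_of_real (a j \<epsilon>) * t j y \<xi>)" for \<epsilon> y \<xi>
    have single: "\<exists>j. \<forall>y. \<phi> \<epsilon> y = (\<lambda>\<xi>. ph 0 \<xi> + complex_of_real (a j \<epsilon>) * t j y \<xi>)" for \<epsilon>
    proof -
      obtain j where j: "\<forall>i. i \<noteq> j \<longrightarrow> a i \<epsilon> = 0" using adis by metis
      have "(\<Sum>i. complex_of_real (a i \<epsilon>) * t i y \<xi>) = (\<Sum>i\<in>{j}. complex_of_real (a i \<epsilon>) * t i y \<xi>)" for y \<xi>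
        by (rule suminf_finite) (use j in auto)
      then show ?thesis by (intro exI[of _ j]) (simp add: \<phi>_def fun_eq_iff)
    qed
    have at: "\<phi> (ep j) y = (\<lambda>\<xi>. ph j \<xi> + complex_of_real ((y - xx j) \<bullet> e) * TT j \<xi>)" for j y
    proof -
      have "a i (ep j) = 0" if "i \<noteq> j" for i by (rule adis[OF that]) (simp add: a1)
      then have "(\<Sum>i. complex_of_real (a i (ep j)) * t i y \<xi>) = (\<Sum>i\<in>{j}. complex_of_real (a i (ep j)) * t i y \<xi>)" for \<xi>
        by (intro suminf_finite) auto
      then show ?thesis by (simp add: \<phi>_def fun_eq_iff a1 t_def)
    qed
    obtain L where L: "compact L" "\<And>\<phi>. \<phi> \<in> B \<Longrightarrow> off L \<phi>" using bounded_D_support[OF B] by blast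
    have BC: "smooth f" if "f \<in> B" for f using B that by (auto simp: bounded_D_def test_fun_def)
    have \<phi>A: "\<phi> \<epsilon> y \<in> A0" for \<epsilon> y
    proof -
      obtain j where j: "\<phi> \<epsilon> y = (\<lambda>\<xi>. ph 0 \<xi> + complex_of_real (a j \<epsilon>) * t j y \<xi>)" using single by blast
      show ?thesis unfolding j t_def by (rule A0_combination[OF L(1)]) (use zz L(2) in blast)+
    qed
    have \<phi>v: "\<forall>\<xi>. \<xi> \<notin> L \<longrightarrow> \<phi> \<epsilon> y \<xi> = 0" for \<epsilon> y
    proof (intro allI impI)
      fix \<xi> assume "\<xi> \<notin> L"
      then have "ph i \<xi> = 0" "TT i \<xi> = 0" for i using L(2) zz by blast+
      then show "\<phi> \<epsilon> y \<xi> = 0" using single[of \<epsilon>] by (auto simp: t_def)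
    qed
    have Cb: "Cb \<Omega> \<phi>"
      unfolding Cb_def
    proof (intro conjI ballI allI impI)
      show "\<phi> \<epsilon> x \<in> A0" for \<epsilon> x by (rule \<phi>A)
      \<comment> \<open>The bumps accumulate at eps = 0; on the open half line the sum is locally
        finite.\<close>
      define W where "W = {0::real<..} \<times> (UNIV :: 'a set)"
      have oW: "open W" unfolding W_def by (intro open_Times) auto
      have sm: "smooth_D_on W (\<lambda>(\<epsilon>, x). \<phi> \<epsilon> x)"
        unfolding smooth_D_on_def
      proof (intro conjI ballI allI impI oW)
        show "test_fun (case p of (\<epsilon>, x) \<Rightarrow> \<phi> \<epsilon> x)" for p using \<phi>A by (auto simp: A0_def split_def)
        show "\<exists>M. compact M \<and> (\<forall>p\<in>S. tsupp (case p of (\<epsilon>, x) \<Rightarrow> \<phi> \<epsilon> x) \<subseteq> M)" for S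
          using \<phi>v vanish_tsupp[OF L(1)] L(1) by (intro exI[of _ L]) (auto simp: split_def)
        show "Cinf_on (W \<times> UNIV) (\<lambda>(p, \<xi>). (case p of (\<epsilon>, x) \<Rightarrow> \<phi> \<epsilon> x) \<xi>)"
        proof (rule Cinf_on_local)
          fix q :: "(real \<times> 'a) \<times> 'a" assume "q \<in> W \<times> UNIV"
          then have e0: "fst (fst q) > 0" by (auto simp: W_def)
          define \<eta> where "\<eta> = fst (fst q) / 2"
          have \<eta>: "\<eta> > 0" "fst (fst q) > \<eta>" using e0 by (auto simp: \<eta>_def)
          obtain J where J: "\<And>j. j \<ge> J \<Longrightarrow> ep j < \<eta> / 2" using esmall[of "\<eta> / 2"] \<eta> by auto
          define S where "S = {q :: (real \<times> 'a) \<times> 'a. fst (fst q) > \<eta>}"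
          have oS: "open S" unfolding S_def by (intro open_Collect_less continuous_intros)
          have z0: "a j \<epsilon> = 0" if "j \<ge> J" "\<epsilon> > \<eta>" for j \<epsilon>
          proof (rule a0)
            show "3/16 * ep j \<le> \<bar>\<epsilon> - ep j\<bar>" using J[OF that(1)] that(2) zz(1)[of j] by linarith
          qed
          have p1: "smooth (\<lambda>q::(real \<times> 'a) \<times> 'a. fst (fst q))" "smooth (\<lambda>q::(real \<times> 'a) \<times> 'a. snd (fst q))"
            "smooth (\<lambda>q::(real \<times> 'a) \<times> 'a. snd q)" by (intro Cinf_intros open_UNIV)+
          have cB: "smooth (\<lambda>q::(real \<times> 'a) \<times> 'a. f (snd q))" if "f \<in> B" for f
            by (rule Cinf_on_compose[OF p1(3) BC[OF that]]) simp
          have ca: "smooth (\<lambda>q::(real \<times> 'a) \<times> 'a. a j (fst (fst q)))" for j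
          proof -
            have "smooth (\<lambda>\<epsilon>::real. (\<epsilon> - ep j) * 4 / ep j)"
              unfolding divide_inverse by (intro Cinf_intros open_UNIV)
            from Cinf_on_compose[OF this Cinf_cutoff] have "smooth (a j)" by (simp add: a_def[abs_def])
            from Cinf_on_compose[OF p1(1) this] show ?thesis by simp
          qed
          have "smooth (\<lambda>q::(real \<times> 'a) \<times> 'a. ph 0 (snd q) + (\<Sum>j<J. complex_of_real (a j (fst (fst q))) * t j (snd (fst q)) (snd q)))"
            unfolding t_def by (intro Cinf_on_sum Cinf_intros open_UNIV cB ca zz p1)
          from Cinf_on_subset[OF this oS]
          have "Cinf_on S (\<lambda>(p, \<xi>). (case p of (\<epsilon>, x) \<Rightarrow> \<phi> \<epsilon> x) \<xi>)"
          proof (rule Cinf_on_cong)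
            fix q assume q: "q \<in> S"
            have "(\<Sum>j. complex_of_real (a j (fst (fst q))) * t j (snd (fst q)) (snd q)) = (\<Sum>j<J. complex_of_real (a j (fst (fst q))) * t j (snd (fst q)) (snd q))"
              by (rule suminf_finite) (use q z0 in \<open>auto simp: S_def\<close>)
            then show "ph 0 (snd q) + (\<Sum>j<J. complex_of_real (a j (fst (fst q))) * t j (snd (fst q)) (snd q)) = (case q of (p, \<xi>) \<Rightarrow> (case p of (\<epsilon>, x) \<Rightarrow> \<phi> \<epsilon> x) \<xi>)"
              by (simp add: \<phi>_def split_def)
          qed simp
          moreover have "q \<in> S" using \<eta> by (simp add: S_def)
          ultimately show "\<exists>S. q \<in> S \<and> Cinf_on S (\<lambda>(p, \<xi>). (case p of (\<epsilon>, x) \<Rightarrow> \<phi> \<epsilon> x) \<xi>)"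
            by (intro exI[of _ S] conjI)
        qed (intro open_Times oW open_UNIV)
      qed
      show "\<exists>W \<Phi>. {0<..1} \<times> \<Omega> \<subseteq> W \<and> smooth_D_on W \<Phi> \<and> (\<forall>\<epsilon>\<in>{0<..1}. \<forall>x\<in>\<Omega>. \<Phi> (\<epsilon>, x) = \<phi> \<epsilon> x)"
        by (rule exI[of _ W], rule exI[of _ "\<lambda>(\<epsilon>, x). \<phi> \<epsilon> x"]) (use sm in \<open>auto simp: W_def\<close>)
      fix K1 :: "'a set" and vs :: "'a list"
      assume K1: "compact K1 \<and> K1 \<subseteq> \<Omega> \<and> set vs \<subseteq> Basis"
      show "bounded_D {(\<lambda>\<xi>. pd vs (\<lambda>y. \<phi> \<epsilon> y \<xi>) x) | \<epsilon> x. \<epsilon> \<in> {0<..1} \<and> x \<in> K1}"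
      \<comment> \<open>Without differentiation the affine factor has to be bounded over K1 and K;
        after at least one derivative only a bounded multiple of \<open>TT j\<close> is
        left.\<close>
      proof (cases "vs = []")
        case True
        have "compact ((\<lambda>(x, y). (x - y) \<bullet> e) ` (K1 \<times> K))" unfolding split_def
          using K1 K by (intro compact_continuous_image compact_Times continuous_intros) auto
        then obtain D where "\<forall>z\<in>(\<lambda>(x, y). (x - y) \<bullet> e) ` (K1 \<times> K). norm z \<le> D" using compact_imp_bounded bounded_iff by metis
        then have D: "\<bar>(x - y) \<bullet> e\<bar> \<le> D" if "x \<in> K1" "y \<in> K" for x y using that by auto
        define B1 where "B1 = combs B B 1"
        define B2 where "B2 = combs B1 B D"
        define B3 where "B3 = combs B B2 1"
        have "bounded_D B3" unfolding B3_def B2_def B1_def by (intro bounded_D_comb B)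
        then show ?thesis
        proof (rule bounded_D_subset, safe)
          fix \<epsilon> x assume x: "x \<in> K1"
          obtain j where j: "\<phi> \<epsilon> x = (\<lambda>\<xi>. ph 0 \<xi> + complex_of_real (a j \<epsilon>) * t j x \<xi>)" using single by blast
          have "(\<lambda>\<xi>. ph j \<xi> + complex_of_real (-1) * ph 0 \<xi>) \<in> B1" unfolding B1_def using zz(4)
            by (intro CollectI exI[of _ "ph j"] exI[of _ "ph 0"] exI[of _ "-1 :: real"]) auto
          then have "(\<lambda>\<xi>. (ph j \<xi> + complex_of_real (-1) * ph 0 \<xi>) + complex_of_real ((x - xx j) \<bullet> e) * TT j \<xi>) \<in> B2"
            unfolding B2_def using zz(6) D[OF x zz(3)]
            by (intro CollectI exI[of _ "\<lambda>\<xi>. ph j \<xi> + complex_of_real (-1) * ph 0 \<xi>"] exI[of _ "TT j"] exI[of _ "(x - xx j) \<bullet> e"]) auto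
          moreover have "(\<lambda>\<xi>. (ph j \<xi> + complex_of_real (-1) * ph 0 \<xi>) + complex_of_real ((x - xx j) \<bullet> e) * TT j \<xi>) = t j x"
            by (auto simp: t_def)
          ultimately have "t j x \<in> B2" by simp
          then have "\<phi> \<epsilon> x \<in> B3" unfolding j B3_def using zz(4)[of 0] cutoff_nonneg cutoff_le_1
            by (intro CollectI exI[of _ "ph 0"] exI[of _ "t j x"] exI[of _ "a j \<epsilon>"]) (auto simp: a_def abs_le_iff intro: order_trans[of _ 0])
          then show "(\<lambda>\<xi>. pd vs (\<lambda>y. \<phi> \<epsilon> y \<xi>) x) \<in> B3" by (simp add: True)
        qed
      next
        case False
        define B1 where "B1 = combs {\<lambda>_. 0} B (norm e)"
        have "bounded_D B1" unfolding B1_def by (intro bounded_D_comb bounded_D_zero B)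
        then show ?thesis
        proof (rule bounded_D_subset, safe)
          fix \<epsilon> x assume x: "x \<in> K1"
          obtain j where j: "\<And>y. \<phi> \<epsilon> y = (\<lambda>\<xi>. ph 0 \<xi> + complex_of_real (a j \<epsilon>) * t j y \<xi>)" using single by blast
          obtain l where l: "\<bar>l\<bar> \<le> norm e" "\<And>(c::complex) d. pd vs (\<lambda>y. c + complex_of_real ((y - xx j) \<bullet> e) * d) x = complex_of_real l * d"
            using pd_affine_param[of vs e "xx j" x] False K1 by blast
          have "pd vs (\<lambda>y. \<phi> \<epsilon> y \<xi>) x = complex_of_real l * (complex_of_real (a j \<epsilon>) * TT j \<xi>)" for \<xi>
          proof -
            have "(\<lambda>y. \<phi> \<epsilon> y \<xi>) = (\<lambda>y. (ph 0 \<xi> + complex_of_real (a j \<epsilon>) * (ph j \<xi> - ph 0 \<xi>)) + complex_of_real ((y - xx j) \<bullet> e) * (complex_of_real (a j \<epsilon>) * TT j \<xi>))"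
              unfolding j t_def by (simp add: algebra_simps)
            then show ?thesis using l(2) by simp
          qed
          then have eq: "(\<lambda>\<xi>. pd vs (\<lambda>y. \<phi> \<epsilon> y \<xi>) x) = (\<lambda>\<xi>. 0 + complex_of_real (l * a j \<epsilon>) * TT j \<xi>)" by (simp add: mult.assoc)
          have "\<bar>l * a j \<epsilon>\<bar> \<le> norm e * 1" unfolding abs_mult
            by (intro mult_mono l(1)) (use cutoff_nonneg cutoff_le_1 in \<open>auto simp: a_def abs_le_iff intro: order_trans[of _ 0]\<close>)
          then show "(\<lambda>\<xi>. pd vs (\<lambda>y. \<phi> \<epsilon> y \<xi>) x) \<in> B1" unfolding eq B1_def using zz(6)[of j]
            by (intro CollectI exI[of _ "\<lambda>_. 0"] exI[of _ "TT j"] exI[of _ "l * a j \<epsilon>"]) auto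
        qed
      qed
    qed
    from N[THEN spec, THEN mp, OF this] obtain \<epsilon>0 C where e0: "\<epsilon>0 \<in> {0<..1}" and
      e0C: "\<forall>\<epsilon>\<in>{0<..<\<epsilon>0}. \<forall>x\<in>K. norm (pd \<beta> (\<lambda>y. R (Seps \<epsilon> (\<phi> \<epsilon> y), y)) x) \<le> C * \<epsilon> powr (- real N)"
      by (elim exE conjE)
    have eC: "\<epsilon>0 > 0" "\<And>\<epsilon> x. 0 < \<epsilon> \<Longrightarrow> \<epsilon> < \<epsilon>0 \<Longrightarrow> x \<in> K \<Longrightarrow>
      norm (pd \<beta> (\<lambda>y. R (Seps \<epsilon> (\<phi> \<epsilon> y), y)) x) \<le> C * \<epsilon> powr (- real N)"
      using e0 e0C[rule_format] by simp_all
    obtain J where J: "\<And>j. j \<ge> J \<Longrightarrow> ep j < \<epsilon>0" using esmall[OF eC(1)] by blast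
    obtain J' :: nat where J': "C \<le> real J'" using real_arch_simple by blast
    define j where "j = max J J'"
    have "V (ep j) (xx j) (ph j) (TT j) \<le> C * ep j powr (- real N)"
      using eC(2)[OF zz(1)[of j] J zz(3)[of j]] unfolding at V_def by (simp add: j_def)
    also have "\<dots> \<le> real j * ep j powr (- real N)" using J' by (intro mult_right_mono) (auto simp: j_def)
    finally show False using zz(8)[of j] by simp
  qed
qed

lemma moderate_imp_estimate:
  fixes \<Omega> :: "'a::euclidean_space set"
  assumes \<Omega>: "open \<Omega>" and mod: "moderate \<Omega> R" and K: "compact K" "K \<subseteq> \<Omega>" and \<alpha>: "set \<alpha> \<subseteq> Basis"
  shows "\<exists>N::nat. N \<ge> 1 \<and> estimate \<Omega> R K \<alpha> k N"
proof -
  have R: "Ed \<Omega> R" using mod by (simp add: moderate_def)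
  obtain e :: 'a where e: "e \<in> Basis" using nonempty_Basis by blast
  \<comment> \<open>The k entries (T, e) from the extra derivatives are to be traded for the k
    directions. Those from occurrences of e in alpha also carry T; they are reduced to (0, e) at the
    end by taking T = 0.\<close>
  define n where "n = k + count_list \<alpha> e"
  define others where "others = filter (\<lambda>v. v \<noteq> e) \<alpha>"
  \<comment> \<open>Landau's inequality on [0, 1] for order n + 1 with vanishing top
    derivative.\<close>
  obtain C0 where C0: "C0 \<ge> 0" "\<And>(g::nat \<Rightarrow> real \<Rightarrow> real) A. derivative_sequence g \<Longrightarrow>
      (\<forall>t\<in>{0..1}. \<bar>g 0 t\<bar> \<le> A) \<Longrightarrow> (\<forall>t\<in>{0..1}. g (Suc n) t = 0) \<Longrightarrow> \<bar>g 1 0\<bar> \<le> C0 * A"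
  proof -
    obtain C0 where c: "C0 > 0" "\<forall>(g::nat \<Rightarrow> real \<Rightarrow> real) a \<delta> A B. \<delta> > 0 \<longrightarrow> derivative_sequence g \<longrightarrow>
     (\<forall>t\<in>{a..a+\<delta>}. \<bar>g 0 t\<bar> \<le> A) \<longrightarrow> (\<forall>t\<in>{a..a+\<delta>}. \<bar>g (Suc n) t\<bar> \<le> B) \<longrightarrow>
     (\<forall>j\<le>Suc n. \<forall>t\<in>{a..a+\<delta>}. \<bar>g j t\<bar> \<le> C0 * (A / \<delta> ^ j + B * \<delta> ^ (Suc n - j)))"
      using landau_inequality[of "Suc n"] by blast
    show thesis
    proof (rule that[of C0])
      fix g :: "nat \<Rightarrow> real \<Rightarrow> real" and A
      assume "derivative_sequence g" "\<forall>t\<in>{0..1}. \<bar>g 0 t\<bar> \<le> A" "\<forall>t\<in>{0..1}. g (Suc n) t = 0"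
      then show "\<bar>g 1 0\<bar> \<le> C0 * A" using c(2)[rule_format, of 1 g 0 A 0 1 0] by simp
    qed (use c in simp)
  qed
  define \<beta> where "\<beta> = replicate k e @ \<alpha>"
  have \<beta>: "set \<beta> \<subseteq> Basis" using \<alpha> e by (auto simp: \<beta>_def)
  obtain N0 :: nat where N0: "\<And>B. bounded_D B \<Longrightarrow> \<exists>\<epsilon>0 C. 0 < \<epsilon>0 \<and> \<epsilon>0 \<le> 1 \<and> (\<forall>\<epsilon> x \<phi> T. 0 < \<epsilon> \<longrightarrow> \<epsilon> < \<epsilon>0 \<longrightarrow> x \<in> K \<longrightarrow> \<phi> \<in> B \<inter> A0 \<longrightarrow> T \<in> B \<inter> A00 \<longrightarrow>
     norm (pd \<beta> (\<lambda>y. R (Seps \<epsilon> (\<lambda>\<xi>. \<phi> \<xi> + complex_of_real ((y - x) \<bullet> e) * T \<xi>), y)) x) \<le> C * \<epsilon> powr (- real N0))"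
    using moderate_affine_estimate[OF mod K \<beta>, of e] by blast
  \<comment> \<open>The successor secures N \<ge> 1; since eps < 1, the larger exponent only weakens
    the bound.\<close>
  have "estimate \<Omega> R K \<alpha> k (Suc N0)"
    unfolding estimate_def
  proof (intro allI impI)
    fix B :: "('a \<Rightarrow> complex) set" assume B: "bounded_D B"
    \<comment> \<open>\<open>CB m\<close> contains every combination of m functions from B with
      coefficients in [-1, 1], so T ranges over one bounded set whatever directions are
      chosen.\<close>
    define CB where "CB = rec_nat {\<lambda>_::'a. 0::complex} (\<lambda>_ S. combs S B 1)"
    have CB0: "CB 0 = {\<lambda>_. 0}" and CBS: "CB (Suc m) = combs (CB m) B 1" for m
      by (simp_all add: CB_def)
    have bCB: "bounded_D (CB m)" for m
      by (induction m) (simp add: CB0 bounded_D_zero, unfold CBS, intro bounded_D_comb B)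
    have combCB: "T \<in> CB (length \<psi>s)" if "T \<in> comb \<psi>s" "set \<psi>s \<subseteq> B" for T \<psi>s
      using that
    proof (induction \<psi>s arbitrary: T)
      case Nil then show ?case by (simp add: CB0)
    next
      case (Cons \<psi> \<psi>s)
      then obtain T' l where "T = (\<lambda>\<xi>. T' \<xi> + complex_of_real l * \<psi> \<xi>)" "T' \<in> comb \<psi>s" "\<bar>l\<bar> \<le> 1" by auto
      moreover from this have "T' \<in> CB (length \<psi>s)" using Cons by auto
      ultimately show ?case using Cons.prems(2) by (simp add: CBS) blast
    qed
    have "bounded_D (\<Union>i\<in>{True, False}. if i then B else CB k)" by (rule bounded_D_UN) (use B bCB in auto)
    then have BB: "bounded_D (B \<union> CB k)" by (simp add: Un_commute)
    obtain L where cL: "compact L" and Lsup: "\<And>\<phi>. \<phi> \<in> B \<union> CB k \<Longrightarrow> off L \<phi>" using bounded_D_support[OF BB] by blast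
    obtain r K' where K': "r > 0" "compact K'" "K' \<subseteq> \<Omega>" "\<And>x y. x \<in> K \<Longrightarrow> dist x y \<le> r \<Longrightarrow> y \<in> K'"
      using compact_neighbourhood[OF K(1) \<Omega> K(2)] by blast
    obtain e1 where e1: "e1 \<in> {0<..1}" "\<And>\<epsilon> \<xi>. 0 < \<epsilon> \<Longrightarrow> \<epsilon> < e1 \<Longrightarrow> \<xi> \<in> L \<Longrightarrow> norm (\<epsilon> *\<^sub>R \<xi>) \<le> r/2"
      using small_support[OF cL, of "r/2"] K'(1) by auto
    obtain e2 C1 where e2: "0 < e2" "e2 \<le> 1" and C1: "\<And>\<epsilon> x \<phi> T. 0 < \<epsilon> \<Longrightarrow> \<epsilon> < e2 \<Longrightarrow> x \<in> K \<Longrightarrow> \<phi> \<in> (B \<union> CB k) \<inter> A0 \<Longrightarrow> T \<in> (B \<union> CB k) \<inter> A00 \<Longrightarrow>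
     norm (pd \<beta> (\<lambda>y. R (Seps \<epsilon> (\<lambda>\<xi>. \<phi> \<xi> + complex_of_real ((y - x) \<bullet> e) * T \<xi>), y)) x) \<le> C1 * \<epsilon> powr (- real N0)"
      using N0[OF BB] by blast
    define C where "C = (2 * C0) ^ k * \<bar>C1\<bar> + 1"
    show "\<exists>\<epsilon>0 C. \<epsilon>0 \<in> {0<..1} \<and> C > 0 \<and>
          (\<forall>\<epsilon>\<in>{0<..<\<epsilon>0}. \<forall>x\<in>K. \<forall>\<phi>\<in>B \<inter> A0. \<forall>\<psi>s.
             length \<psi>s = k \<and> set \<psi>s \<subseteq> B \<inter> A00 \<longrightarrow>
             (Seps \<epsilon> \<phi>, x) \<in> UOm \<Omega> \<and>
             norm (scaled_diff R \<epsilon> \<alpha> \<psi>s \<phi> x)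
               \<le> C * \<epsilon> powr (- real (Suc N0)))"
    proof (rule exI[of _ "min e1 e2"], rule exI[of _ C], intro conjI ballI allI impI)
      show "min e1 e2 \<in> {0<..1}" using e1 e2 by auto
      show "C > 0" unfolding C_def using C0(1) by (simp add: add_nonneg_pos)
      fix \<epsilon> x \<phi> \<psi>s assume ee: "\<epsilon> \<in> {0<..<min e1 e2}" and x: "x \<in> K" and \<phi>: "\<phi> \<in> B \<inter> A0" and \<psi>s: "length \<psi>s = k \<and> set \<psi>s \<subseteq> B \<inter> A00"
      have ep: "0 < \<epsilon>" "\<epsilon> < e1" "\<epsilon> < e2" "\<epsilon> < 1" using ee e2 by auto
      have in_Om: "y + \<epsilon> *\<^sub>R \<xi> \<in> \<Omega>" if "dist x y \<le> r/2" "\<xi> \<in> L" for y \<xi>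
      proof -
        have "dist x (y + \<epsilon> *\<^sub>R \<xi>) \<le> dist x y + norm (\<epsilon> *\<^sub>R \<xi>)"
          using dist_triangle[of x "y + \<epsilon> *\<^sub>R \<xi>" y] by (simp add: dist_norm)
        also have "\<dots> \<le> r" using that(1) e1(2)[OF ep(1,2) that(2)] by simp
        finally show ?thesis using K' x by blast
      qed
      have \<phi>L: "off L \<phi>" using Lsup \<phi> by blast
      show "(Seps \<epsilon> \<phi>, x) \<in> UOm \<Omega>"
        by (rule Seps_UOm[OF ep(1) cL _ \<phi>L]) (use \<phi> x K in_Om[of x] K'(1) in auto)
      obtain \<theta> where \<theta>: "smooth \<theta>" "\<And>y. \<theta> y \<in> ball x (r/2)" "\<And>y. y \<in> ball x (r/2/2) \<Longrightarrow> \<theta> y = y"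
        using localizer[of "r/2" x] K'(1) by auto
      have r4: "r/2/2 > 0" using K' by simp
      have tO: "\<theta> y \<in> \<Omega>" for y using K'(3,4) x \<theta>(2)[of y] K'(1) by (auto intro!: subsetD[OF K'(3)] K'(4)[OF x])
      have tO2: "\<theta> y + \<epsilon> *\<^sub>R \<xi> \<in> \<Omega>" if "\<xi> \<in> L" for y \<xi>
        by (rule in_Om[OF _ that]) (use \<theta>(2)[of y] in simp)
      define G where "G = (\<lambda>(\<phi>, y). R (Seps \<epsilon> \<phi>, \<theta> y))"
      interpret curve_functional L G
        unfolding G_def by (rule curve_functional_Seps[OF R ep(1) cL \<theta>(1) tO tO2])
      have p: "(\<phi>, x) \<in> UL L" using \<phi> \<phi>L by (simp add: UL_def)
      define vs where "vs = map (\<lambda>v. ((\<lambda>_::'a. 0::complex), v)) others"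
      have zW: "((\<lambda>_. 0), v) \<in> WL L" for v by (rule WL_zero[OF cL])
      have vsW: "set vs \<subseteq> WL L" unfolding vs_def using zW by auto
      have \<psi>W: "(\<psi>, 0) \<in> WL L" if "\<psi> \<in> set (rev \<psi>s) \<union> set []" for \<psi>
        using \<psi>s Lsup[of \<psi>] that by (auto simp: WL_def)
      define M where "M = C1 * \<epsilon> powr (- real N0)"
      have base: "norm (DD G (replicate n (T, e) @ vs) (\<phi>, x)) \<le> M" if T: "T \<in> comb (rev (rev \<psi>s) @ [])" for T
      proof -
        have TW: "(T, v) \<in> WL L" for v by (rule comb_WL[of \<psi>s]) (use \<psi>W T in auto)
        have TB: "T \<in> (B \<union> CB k) \<inter> A00" using TW[of 0] combCB[of T \<psi>s] T \<psi>s by (auto simp: WL_def)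
        define c where "c y = ((\<lambda>\<xi>. \<phi> \<xi> + complex_of_real ((y - x) \<bullet> e) * T \<xi>), y)" for y
        \<comment> \<open>The increment of c in the direction v: it is (T, e) for v = e, and (0, v)
          for the other basis vectors by orthogonality.\<close>
        define D where "D v = ((\<lambda>\<xi>. complex_of_real (v \<bullet> e) * T \<xi>), v)" for v
        have "pd \<beta> (\<lambda>y. R (Seps \<epsilon> (\<lambda>\<xi>. \<phi> \<xi> + complex_of_real ((y - x) \<bullet> e) * T \<xi>), y)) x = pd \<beta> (\<lambda>y. DD G [] (c y)) x"
          by (rule pd_cong_on[of "ball x (r/2/2)"]) (use \<theta>(3) r4 in \<open>auto simp: c_def G_def\<close>)
        also have "\<dots> = DD G (map D \<beta> @ []) (c x)"
          by (rule pd_DD_affine) (simp add: c_def D_def padd_def algebra_simps inner_diff_left inner_add_left)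
        also have "c x = (\<phi>, x)" by (simp add: c_def)
        also have "DD G (map D \<beta> @ []) (\<phi>, x) = DD G (replicate n (T, e) @ vs) (\<phi>, x)"
        proof (rule DD_perm[OF _ _ p])
          have De: "D e = (T, e)" using e by (simp add: D_def)
          have Dv: "D v = ((\<lambda>_. 0), v)" if "v \<in> Basis" "v \<noteq> e" for v using that e by (simp add: D_def inner_not_same_Basis)
          have "mset (map D \<alpha>) = mset (replicate (count_list \<alpha> e) (T, e) @ vs)"
            unfolding vs_def others_def using \<alpha>
            by (induction \<alpha>) (auto simp: De Dv)
          then show "mset (map D \<beta> @ []) = mset (replicate n (T, e) @ vs)"
            by (simp add: \<beta>_def n_def De replicate_add map_replicate)
          have "D v \<in> WL L" if "v \<in> set \<beta>" for v
            using De Dv[of v] TW[of e] zW[of v] that \<beta> by (cases "v = e") auto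
          then show "set (map D \<beta> @ []) \<subseteq> WL L" by auto
        qed
        finally have "DD G (replicate n (T, e) @ vs) (\<phi>, x) = pd \<beta> (\<lambda>y. R (Seps \<epsilon> (\<lambda>\<xi>. \<phi> \<xi> + complex_of_real ((y - x) \<bullet> e) * T \<xi>), y)) x" by simp
        then show ?thesis unfolding M_def using C1[OF ep(1,3) x _ TB, of \<phi>] \<phi> by simp
      qed
      have lk: "length (rev \<psi>s) = k" using \<psi>s by simp
      \<comment> \<open>\<open>DD_extract\<close> peels directions off the head and collects them
        reversed in the combination; reversing the list beforehand leaves exactly
        \<open>comb \<psi>s\<close>, and the empty rest leaves T = 0.\<close>
      have ext: "norm (DD G (map (\<lambda>\<psi>. (\<psi>, 0)) (rev \<psi>s) @ replicate (n - k) ((\<lambda>_. 0), e) @ vs) (\<phi>, x)) \<le> (2 * C0) ^ k * M"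
      proof -
        have "norm (DD G (map (\<lambda>\<psi>. (\<psi>, 0)) (rev \<psi>s) @ replicate (n - length (rev \<psi>s)) ((\<lambda>_. 0), e) @ vs) (\<phi>, x))
            \<le> (2 * C0) ^ length (rev \<psi>s) * M"
        proof (rule DD_extract[where rest = "[]" and n = n])
          show "\<bar>g 1 0\<bar> \<le> C0 * A" if "derivative_sequence g"
            "\<forall>t\<in>{0..1}. \<bar>g 0 t\<bar> \<le> A" "\<forall>t\<in>{0..1}. g (Suc n) t = 0" for g :: "nat \<Rightarrow> real \<Rightarrow> real" and A
            by (rule C0(2)[OF that])
          show "length (rev \<psi>s) \<le> n" unfolding lk by (simp add: n_def)
        qed (use C0(1) p vsW base \<psi>W in auto)
        then show ?thesis unfolding lk .
      qed
      have "scaled_diff R \<epsilon> \<alpha> \<psi>s \<phi> x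
        = DD G (map (\<lambda>v. ((\<lambda>_. 0), v)) \<alpha> @ map (\<lambda>\<psi>. (\<psi>, 0)) \<psi>s) (\<phi>, x)"
        unfolding G_def by (rule pd_d1_DD[OF r4 \<theta>(3)])
      also have "\<dots> = DD G (map (\<lambda>\<psi>. (\<psi>, 0)) (rev \<psi>s) @ replicate (n - k) ((\<lambda>_. 0), e) @ vs) (\<phi>, x)"
      proof (rule DD_perm[OF _ _ p])
        have "mset (map (\<lambda>v. ((\<lambda>_::'a. 0::complex), v)) \<alpha>) = mset (replicate (count_list \<alpha> e) ((\<lambda>_. 0), e) @ vs)"
          unfolding vs_def others_def by (induction \<alpha>) auto
        then show "mset (map (\<lambda>v. ((\<lambda>_. 0), v)) \<alpha> @ map (\<lambda>\<psi>. (\<psi>, 0)) \<psi>s) = mset (map (\<lambda>\<psi>. (\<psi>, 0)) (rev \<psi>s) @ replicate (n - k) ((\<lambda>_. 0), e) @ vs)"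
          by (simp add: n_def)
        show "set (map (\<lambda>v. ((\<lambda>_. 0), v)) \<alpha> @ map (\<lambda>\<psi>. (\<psi>, 0)) \<psi>s) \<subseteq> WL L" using zW \<psi>W by auto
      qed
      finally have "norm (scaled_diff R \<epsilon> \<alpha> \<psi>s \<phi> x) \<le> (2 * C0) ^ k * M" using ext by simp
      also have "\<dots> \<le> (2 * C0) ^ k * (\<bar>C1\<bar> * \<epsilon> powr (- real N0))"
        unfolding M_def using C0(1) by (intro mult_left_mono mult_right_mono) auto
      also have "\<dots> \<le> C * \<epsilon> powr (- real N0)" unfolding C_def by (simp add: algebra_simps)
      also have "\<dots> \<le> C * \<epsilon> powr (- real (Suc N0))"
        using ep \<open>C > 0\<close> by (intro mult_left_mono powr_mono') auto
      finally show "norm (scaled_diff R \<epsilon> \<alpha> \<psi>s \<phi> x) \<le> C * \<epsilon> powr (- real (Suc N0))" .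
    qed
  qed
  then show ?thesis by (intro exI[of _ "Suc N0"]) simp
qed

theorem mainTheorem1:
  fixes \<Omega> :: "'a::euclidean_space set"
    and R :: "(('a \<Rightarrow> complex) \<times> 'a) \<Rightarrow> complex"
  assumes "open \<Omega>"
    and "Ed \<Omega> R"
  shows "moderate \<Omega> R \<longleftrightarrow>
    (\<forall>K \<alpha> k. compact K \<and> K \<subseteq> \<Omega> \<and> set \<alpha> \<subseteq> Basis \<longrightarrow>
      (\<exists>N::nat. N \<ge> 1 \<and> (\<forall>B. bounded_D B \<longrightarrow>
        (\<exists>\<epsilon>0 C. \<epsilon>0 \<in> {0<..1} \<and> C > 0 \<and>
          (\<forall>\<epsilon>\<in>{0<..<\<epsilon>0}. \<forall>x\<in>K. \<forall>\<phi>\<in>B \<inter> A0. \<forall>\<psi>s.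
             length \<psi>s = k \<and> set \<psi>s \<subseteq> B \<inter> A00 \<longrightarrow>
             (Seps \<epsilon> \<phi>, x) \<in> UOm \<Omega> \<and>
             norm (pd \<alpha> (\<lambda>y. d1 (\<lambda>(\<phi>', y'). R (Seps \<epsilon> \<phi>', y')) \<psi>s \<phi> y) x)
               \<le> C * \<epsilon> powr (- real N))))))"
  unfolding estimate_def[symmetric]
proof
  assume "moderate \<Omega> R"
  then show "\<forall>K \<alpha> k. compact K \<and> K \<subseteq> \<Omega> \<and> set \<alpha> \<subseteq> Basis \<longrightarrow> (\<exists>N::nat. N \<ge> 1 \<and> estimate \<Omega> R K \<alpha> k N)"
    using moderate_imp_estimate[OF assms(1)] by blast
next
  assume "\<forall>K \<alpha> k. compact K \<and> K \<subseteq> \<Omega> \<and> set \<alpha> \<subseteq> Basis \<longrightarrow> (\<exists>N::nat. N \<ge> 1 \<and> estimate \<Omega> R K \<alpha> k N)"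
  then show "moderate \<Omega> R" using moderateI[OF assms] by blast
qed

end
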